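(* Let $f=\frac1n\sum_{i=1}^nf_i$ on $\mathbb{R}^d$ satisfy: $f^*=\inf f>-\infty$; $\{f_i\}_{i=1}^n$ is $L$-mean-squared smooth; $f$ is $\mu$-PL; and let $\mathbf{W}$ be a mixing matrix of the network with $1-\lambda_2(\mathbf{W})\ge\gamma$, $\gamma\in(0,1]$. Put $\kappa=L/\mu$ and let $\epsilon>0$. Run the DRONE algorithm with $$p=\frac{1}{\min\{\sqrt n,\kappa\}+1},\quad b=\Big\lceil\frac{1-p}{p}\Big\rceil,\quad \eta=\min\Big\{\frac1{20L},\frac p{2\mu}\Big\},\quad q=\frac1n,$$ $$K=\Big\lceil\frac{\sqrt2\,(4+\log n)}{(\sqrt2-1)\sqrt\gamma}\Big\rceil,\quad T=\Big\lceil\frac1{\mu\eta}\log\frac{\Phi^0}{\epsilon}\Big\rceil .$$ Then the output satisfies $\mathbb{E}[f(\mathbf{x}^{\rm out})-f^*]\le\epsilon$, and the algorithm uses communication complexity (number of communication rounds) $\tilde O\big((\kappa/\sqrt\gamma)\log(1/\epsilon)\big)$, time complexity $\tilde O\big(\kappa(1+\tau/\sqrt\gamma)\log(1/\epsilon)\big)$, and LFO complexity $O\big((n+\kappa\sqrt n)\log(1/\epsilon)\big)$ in expectation.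
   Context: Assumptions. $\{f_i\}$ is $L$-mean-squared smooth if $\frac1n\sum_i\|\nabla f_i(\mathbf{x})-\nabla f_i(\mathbf{y})\|^2\le L^2\|\mathbf{x}-\mathbf{y}\|^2$ for all $\mathbf{x},\mathbf{y}$; $f$ is $\mu$-PL if $f(\mathbf{x})-\inf f\le\frac1{2\mu}\|\nabla f(\mathbf{x})\|^2$ for all $\mathbf{x}$. Agents $1,\dots,n$ form a connected network, agent $i$ holding $f_i$. A mixing matrix $\mathbf{W}\in\mathbb{R}^{n\times n}$ satisfies $\mathbf{W}=\mathbf{W}^\top$, $\mathbf{W}\mathbf{1}=\mathbf{1}$, $\mathbf{0}\preceq\mathbf{W}\preceq\mathbf{I}$, and $w_{i,j}>0$ if $i=j$ or agents $i,j$ are connected, $w_{i,j}=0$ otherwise; $\lambda_2(\mathbf{W})$ is its second-largest eigenvalue. Notation. For $\mathbf{X}\in\mathbb{R}^{n\times d}$ with rows $\mathbf{x}(1),\dots,\mathbf{x}(n)$, let $\bar{\mathbf{x}}=\frac1n\mathbf{1}^\top\mathbf{X}$ and let $\nabla\mathbf{F}(\mathbf{X})\in\mathbb{R}^{n\times d}$ have rows $\nabla f_i(\mathbf{x}(i))$ (row vectors are used as inputs). $\|\cdot\|$ is the Euclidean/Frobenius norm. Bars similarly denote row averages: $\bar{\mathbf{s}}^t=\frac1n\mathbf{1}^\top\mathbf{S}^t$. $\mathrm{AccGossip}(\mathbf{Y}^0,\mathbf{W},K)$: set $\mathbf{Y}^{-1}=\mathbf{Y}^0$, $\eta_y=1/(1+\sqrt{1-\lambda_2^2(\mathbf{W})})$,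 iterate $\mathbf{Y}^{k+1}=(1+\eta_y)\mathbf{W}\mathbf{Y}^k-\eta_y\mathbf{Y}^{k-1}$, and output $\mathbf{Y}^K$. DRONE. Input $\bar{\mathbf{x}}^0\in\mathbb{R}^{1\times d}$, mini-batch size $b$, iteration number $T$, stepsize $\eta>0$, probabilities $p,q\in(0,1]$, communication number $K$. Set $\mathbf{X}^0=\mathbf{1}\bar{\mathbf{x}}^0$ and $\mathbf{S}^0=\mathbf{G}^0=\nabla\mathbf{F}(\mathbf{X}^0)$. For $t=0,\dots,T-1$: draw (independently) $\zeta^t\sim\mathrm{Bernoulli}(p)$ and $[\xi_1^t,\dots,\xi_n^t]^\top\sim\mathrm{Multinomial}(b,q\mathbf{1})$; set $\mathbf{X}^{t+1}=\mathrm{AccGossip}(\mathbf{X}^t-\eta\mathbf{S}^t,\mathbf{W},K)$; for every $i$ in parallel set $\mathbf{g}^{t+1}(i)=\nabla f_i(\mathbf{x}^{t+1}(i))$ if $\zeta^t=1$, and $\mathbf{g}^{t+1}(i)=\mathbf{g}^t(i)+\frac{\xi_i^t}{bq}\big(\nabla f_i(\mathbf{x}^{t+1}(i))-\nabla f_i(\mathbf{x}^t(i))\big)$ otherwise; let $\mathbf{G}^{t+1}$ have rows $\mathbf{g}^{t+1}(i)$; set $\mathbf{S}^{t+1}=\mathrm{AccGossip}(\mathbf{S}^t+\mathbf{G}^{t+1}-\mathbf{G}^t,\mathbf{W},K)$. Output $\mathbf{x}^{\rm out}$ sampled uniformly from $\{\mathbf{x}^T(i)\}_{i=1}^n$. Lyapunov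 function: $\Phi^t=\mathbb{E}[f(\bar{\mathbf{x}}^t)-f^*]+\alpha U^t+\beta V^t+LC^t$, with $\alpha=2\eta/p$, $\beta=8L\rho^2n\eta^2$, $\rho=\sqrt{14}\,\big(1-(1-1/\sqrt2)\sqrt{1-\lambda_2(\mathbf{W})}\big)^K$, $U^t=\mathbb{E}\|\frac1n\sum_{i=1}^n(\mathbf{g}^t(i)-\nabla f_i(\mathbf{x}^t(i)))\|^2$, $V^t=\frac1n\mathbb{E}\|\mathbf{G}^t-\nabla\mathbf{F}(\mathbf{X}^t)\|^2$, $C^t=\mathbb{E}\|\mathbf{X}^t-\mathbf{1}\bar{\mathbf{x}}^t\|^2+\eta^2\mathbb{E}\|\mathbf{S}^t-\mathbf{1}\bar{\mathbf{s}}^t\|^2$. Complexities. One communication round is one multiplication of an aggregated variable by $\mathbf{W}$ and costs time $\tau>0$; computing local gradients costs one unit of time, in parallel across agents; the LFO complexity is the total number (over all agents) of evaluations of $(f_i(\mathbf{x}),\nabla f_i(\mathbf{x}))$ (an agent with $\zeta^t=0$ and $\xi_i^t=0$ makes no call). $\tilde O$ hides logarithmic factors in $\kappa$ and $n$. Hidden constants may depend on the initial value $\Phi^0$, which is treated as fixed when writing $\log(1/\epsilon)$ (in the regime of small $\epsilon$), but not on $L,\mu,n,\gamma,\tau,\epsilon$.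
   Formalization: The communication and time bounds are stated for κ ≥ 1; this is automatic unless f is constant, and for constant f with κ → 0 (e.g. f_1 = ax, f_2 = −ax) those bounds are false, since T ≥ 2 log(Φ^0/ε). *)

theory Defs
  imports
    "HOL-Probability.Probability"
    "HOL-Computational_Algebra.Computational_Algebra"
    "Jordan_Normal_Form.Char_Poly"
begin

(* The number of agents and the dimension are both quantified inside the statement (hidden
   constants must not depend on them), so vectors and matrices are those of Jordan_Normal_Form.
   Agents are the indices 0, ..., n - 1. *)

no_notation inner (infix "\<bullet>" 70)


definition vec_norm :: "real vec \<Rightarrow> real" where
  "vec_norm v = sqrt (v \<bullet> v)"

definition frob_norm :: "real mat \<Rightarrow> real" where
  "frob_norm A = sqrt (\<Sum>i<dim_row A. \<Sum>j<dim_col A. (A $$ (i, j))\<^sup>2)"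

text \<open>Frechet differentiability on \<open>carrier_vec d\<close> (the type \<open>real vec\<close> collects all
  dimensions and carries no norm, so the library derivative does not apply).\<close>

definition has_gradient :: "nat \<Rightarrow> (real vec \<Rightarrow> real) \<Rightarrow> real vec \<Rightarrow> real vec \<Rightarrow> bool" where
  "has_gradient d f x g \<longleftrightarrow> g \<in> carrier_vec d \<and>
     (\<forall>e>0. \<exists>\<delta>>0. \<forall>y\<in>carrier_vec d. vec_norm (y - x) < \<delta> \<longrightarrow>
        \<bar>f y - f x - g \<bullet> (y - x)\<bar> \<le> e * vec_norm (y - x))"

definition differentiable_vec :: "nat \<Rightarrow> (real vec \<Rightarrow> real) \<Rightarrow> bool" where
  "differentiable_vec d f \<longleftrightarrow> (\<forall>x\<in>carrier_vec d. \<exists>g. has_gradient d f x g)"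

definition gradient :: "nat \<Rightarrow> (real vec \<Rightarrow> real) \<Rightarrow> real vec \<Rightarrow> real vec" where
  "gradient d f x = (THE g. has_gradient d f x g)"


definition avg_fun :: "nat \<Rightarrow> (nat \<Rightarrow> real vec \<Rightarrow> real) \<Rightarrow> real vec \<Rightarrow> real" where
  "avg_fun n fs x = (\<Sum>i<n. fs i x) / real n"

definition inf_value :: "nat \<Rightarrow> (real vec \<Rightarrow> real) \<Rightarrow> real" where
  "inf_value d f = Inf (f ` carrier_vec d)"

definition mean_squared_smooth :: "nat \<Rightarrow> nat \<Rightarrow> (nat \<Rightarrow> real vec \<Rightarrow> real) \<Rightarrow> real \<Rightarrow> bool" where
  "mean_squared_smooth n d fs L \<longleftrightarrow>
     (\<forall>x\<in>carrier_vec d. \<forall>y\<in>carrier_vec d.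
        (\<Sum>i<n. (vec_norm (gradient d (fs i) x - gradient d (fs i) y))\<^sup>2) / real n
          \<le> L\<^sup>2 * (vec_norm (x - y))\<^sup>2)"

definition PL_condition :: "nat \<Rightarrow> (real vec \<Rightarrow> real) \<Rightarrow> real \<Rightarrow> bool" where
  "PL_condition d f \<mu> \<longleftrightarrow>
     (\<forall>x\<in>carrier_vec d. f x - inf_value d f \<le> 1 / (2 * \<mu>) * (vec_norm (gradient d f x))\<^sup>2)"

text \<open>\<open>E\<close> is the adjacency relation of the agents.\<close>

definition connected_network :: "nat \<Rightarrow> (nat \<times> nat) set \<Rightarrow> bool" where
  "connected_network n E \<longleftrightarrow>
     E \<subseteq> {..<n} \<times> {..<n} \<and> sym E \<and> (\<forall>i<n. \<forall>j<n. (i, j) \<in> E\<^sup>*)"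

definition pos_semidef :: "real mat \<Rightarrow> bool" where
  "pos_semidef A \<longleftrightarrow> (\<forall>v\<in>carrier_vec (dim_row A). 0 \<le> v \<bullet> (A *\<^sub>v v))"

definition mixing_matrix :: "nat \<Rightarrow> (nat \<times> nat) set \<Rightarrow> real mat \<Rightarrow> bool" where
  "mixing_matrix n E W \<longleftrightarrow>
     W \<in> carrier_mat n n \<and> transpose_mat W = W \<and>
     W *\<^sub>v vec n (\<lambda>_. 1) = vec n (\<lambda>_. 1) \<and>
     pos_semidef W \<and> pos_semidef (1\<^sub>m n - W) \<and>
     (\<forall>i<n. \<forall>j<n. if i = j \<or> (i, j) \<in> E then W $$ (i, j) > 0 else W $$ (i, j) = 0)"

text \<open>Eigenvalues are counted with multiplicity.  A single agent has no second eigenvalue; the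
  value \<open>0\<close> chosen then makes \<open>1 - lambda2 W \<ge> \<gamma>\<close> hold for every \<open>\<gamma> \<le> 1\<close>.\<close>

definition lambda2 :: "real mat \<Rightarrow> real" where
  "lambda2 W = (if dim_row W = 1 then 0
     else rev (sorted_list_of_multiset (proots (char_poly W))) ! 1)"


text \<open>The pair is \<open>(Y\<^sup>k, Y\<^sup>k\<^sup>-\<^sup>1)\<close>, started at \<open>(Y\<^sup>0, Y\<^sup>0)\<close>.\<close>

definition acc_gossip :: "real mat \<Rightarrow> real mat \<Rightarrow> nat \<Rightarrow> real mat" where
  "acc_gossip Y0 W K =
     (let \<eta>y = 1 / (1 + sqrt (1 - (lambda2 W)\<^sup>2))
      in fst (((\<lambda>(Y, Y'). ((1 + \<eta>y) \<cdot>\<^sub>m (W * Y) - \<eta>y \<cdot>\<^sub>m Y', Y)) ^^ K) (Y0, Y0)))"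


text \<open>Besides the iterates, the state counts the multiplications of an aggregated variable by
  \<open>W\<close>, the units of (parallel) gradient computation time, and the calls of the local first-order
  oracles of all agents.\<close>

record drone_state =
  itX :: "real mat"
  itS :: "real mat"
  itG :: "real mat"
  comm_rounds :: nat
  grad_time :: nat
  lfo_calls :: nat

definition row_mean :: "real mat \<Rightarrow> real vec" where
  "row_mean X = vec (dim_col X) (\<lambda>j. (\<Sum>i<dim_row X. X $$ (i, j)) / real (dim_row X))"

definition const_rows :: "nat \<Rightarrow> real vec \<Rightarrow> real mat" where
  "const_rows n v = mat\<^sub>r n (dim_vec v) (\<lambda>_. v)"

definition nabla_F :: "nat \<Rightarrow> nat \<Rightarrow> (nat \<Rightarrow> real vec \<Rightarrow> real) \<Rightarrow> real mat \<Rightarrow> real mat" where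
  "nabla_F n d fs X = mat\<^sub>r n d (\<lambda>i. gradient d (fs i) (row X i))"

text \<open>\<open>Multinomial(b, q\<one>)\<close>: the number of occurrences of each agent among \<open>b\<close> independent draws,
  every agent having probability \<open>q\<close>.  It is a distribution only for \<open>n q = 1\<close>.\<close>

definition multinomial_pmf :: "nat \<Rightarrow> nat \<Rightarrow> real \<Rightarrow> (nat \<Rightarrow> nat) pmf" where
  "multinomial_pmf n b q =
     map_pmf (\<lambda>js i. count_list js i) (replicate_pmf b (embed_pmf (\<lambda>i. if i < n then q else 0)))"

definition drone_init :: "nat \<Rightarrow> nat \<Rightarrow> (nat \<Rightarrow> real vec \<Rightarrow> real) \<Rightarrow> real vec \<Rightarrow> drone_state" where
  "drone_init n d fs x0 =
     (let X0 = const_rows n x0 in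
      \<lparr> itX = X0, itS = nabla_F n d fs X0, itG = nabla_F n d fs X0,
        comm_rounds = 0, grad_time = 1, lfo_calls = n \<rparr>)"

text \<open>Each of the two calls of \<open>acc_gossip\<close> multiplies \<open>K\<close> times by \<open>W\<close>.  An agent makes one
  oracle call if \<open>\<zeta> = 1\<close>, and if \<open>\<zeta> = 0\<close> and \<open>\<xi> i > 0\<close> it makes two calls (at the new and at the
  old point); as agents work in parallel, the elapsed time is the maximum over the agents.\<close>

definition drone_update ::
  "nat \<Rightarrow> nat \<Rightarrow> (nat \<Rightarrow> real vec \<Rightarrow> real) \<Rightarrow> real mat \<Rightarrow> nat \<Rightarrow> nat \<Rightarrow> real \<Rightarrow> real \<Rightarrow>
   bool \<Rightarrow> (nat \<Rightarrow> nat) \<Rightarrow> drone_state \<Rightarrow> drone_state" where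
  "drone_update n d fs W K b \<eta> q \<zeta> \<xi> s =
     (let X = itX s; S = itS s; G = itG s;
          X' = acc_gossip (X - \<eta> \<cdot>\<^sub>m S) W K;
          G' = mat\<^sub>r n d (\<lambda>i.
                 if \<zeta> then gradient d (fs i) (row X' i)
                 else row G i + (real (\<xi> i) / (real b * q)) \<cdot>\<^sub>v
                        (gradient d (fs i) (row X' i) - gradient d (fs i) (row X i)));
          S' = acc_gossip (S + G' - G) W K;
          calls = (\<lambda>i. if \<zeta> then 1 else if \<xi> i > 0 then 2 else 0)
      in \<lparr> itX = X', itS = S', itG = G',
           comm_rounds = comm_rounds s + K + K,
           grad_time = grad_time s + Max (calls ` {..<n}),
           lfo_calls = lfo_calls s + (\<Sum>i<n. calls i) \<rparr>)"

primrec drone ::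
  "nat \<Rightarrow> nat \<Rightarrow> (nat \<Rightarrow> real vec \<Rightarrow> real) \<Rightarrow> real mat \<Rightarrow> real vec \<Rightarrow> nat \<Rightarrow> real \<Rightarrow> real \<Rightarrow> real \<Rightarrow> nat \<Rightarrow>
   nat \<Rightarrow> drone_state pmf" where
  "drone n d fs W x0 b \<eta> p q K 0 = return_pmf (drone_init n d fs x0)"
| "drone n d fs W x0 b \<eta> p q K (Suc t) =
     do { s \<leftarrow> drone n d fs W x0 b \<eta> p q K t;
          \<zeta> \<leftarrow> bernoulli_pmf p;
          \<xi> \<leftarrow> multinomial_pmf n b q;
          return_pmf (drone_update n d fs W K b \<eta> q \<zeta> \<xi> s) }"

definition drone_output ::
  "nat \<Rightarrow> nat \<Rightarrow> (nat \<Rightarrow> real vec \<Rightarrow> real) \<Rightarrow> real mat \<Rightarrow> real vec \<Rightarrow> nat \<Rightarrow> real \<Rightarrow> real \<Rightarrow> real \<Rightarrow> nat \<Rightarrow>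
   nat \<Rightarrow> real vec pmf" where
  "drone_output n d fs W x0 b \<eta> p q K T =
     do { s \<leftarrow> drone n d fs W x0 b \<eta> p q K T;
          i \<leftarrow> pmf_of_set {..<n};
          return_pmf (row (itX s) i) }"

text \<open>Total time when a communication round costs \<open>\<tau>\<close>.\<close>

definition run_time :: "real \<Rightarrow> drone_state \<Rightarrow> real" where
  "run_time \<tau> s = real (grad_time s) + \<tau> * real (comm_rounds s)"


definition drone_Lyapunov ::
  "nat \<Rightarrow> nat \<Rightarrow> (nat \<Rightarrow> real vec \<Rightarrow> real) \<Rightarrow> real \<Rightarrow> real mat \<Rightarrow> real vec \<Rightarrow> nat \<Rightarrow> real \<Rightarrow> real \<Rightarrow> real \<Rightarrow>
   nat \<Rightarrow> nat \<Rightarrow> real" where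
  "drone_Lyapunov n d fs L W x0 b \<eta> p q K t =
     (let f = avg_fun n fs;
          E = measure_pmf.expectation (drone n d fs W x0 b \<eta> p q K t);
          \<rho> = sqrt 14 * (1 - (1 - 1 / sqrt 2) * sqrt (1 - lambda2 W)) ^ K;
          \<alpha> = 2 * \<eta> / p;
          \<beta> = 8 * L * \<rho>\<^sup>2 * real n * \<eta>\<^sup>2;
          U = E (\<lambda>s. (vec_norm (row_mean (itG s - nabla_F n d fs (itX s))))\<^sup>2);
          V = 1 / real n * E (\<lambda>s. (frob_norm (itG s - nabla_F n d fs (itX s)))\<^sup>2);
          C = E (\<lambda>s. (frob_norm (itX s - const_rows n (row_mean (itX s))))\<^sup>2)
              + \<eta>\<^sup>2 * E (\<lambda>s. (frob_norm (itS s - const_rows n (row_mean (itS s))))\<^sup>2)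
      in E (\<lambda>s. f (row_mean (itX s)) - inf_value d f) + \<alpha> * U + \<beta> * V + L * C)"

end

theory Submission
  imports Defs
begin

text \<open>Every run of accelerated gossip contracts the deviations of the rows of \<open>X\<close> and \<open>S\<close> from their
  means by \<open>\<rho> \<le> sqrt 14 * exp (- 4) / n\<close>, which is small enough to pay for the factors \<open>n\<close> lost because
  mean-squared smoothness makes a single agent only \<open>sqrt n * L\<close>-smooth.  The spectral bound on gossip is
  reduced to a scalar second-order recurrence in an orthonormal eigenbasis of \<open>W\<close>.  Since the row
  mean of \<open>S\<close> always equals that of \<open>G\<close>, the mean iterate performs gradient descent with an inexact
  gradient; the Polyak-Lojasiewicz inequality makes \<open>f - f*\<close> decrease, the reset probability \<open>p\<close> makes
  the estimation errors \<open>U\<close> and \<open>V\<close> decrease, and the new errors are bounded by the change of the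
  local gradients, which the term \<open>\<parallel>mean S\<parallel>\<^sup>2\<close> of the descent inequality absorbs.  Altogether the
  Lyapunov function contracts by \<open>1 - \<mu> \<eta>\<close> in expectation per step.  It also dominates the expected
  gap of the random row that is returned, because the first-order terms of the rows around their
  mean cancel.\<close>

section \<open>Gradients and the descent lemma\<close>

text \<open>Given a state, the next \<open>X\<close> is determined; chance enters a step only
  through the estimator \<open>G\<close>. So the change \<open>\<Delta>\<close> of the local
  gradients is a constant under the conditional expectation, and sampling matters only through
  second moments of multinomial averages. Two error terms occur because the noise has two sizes:
  averaged over the agents it is of order \<open>DD / b\<close>, for the separate rows of order
  \<open>n * DD / b\<close>. The first enters the descent through \<open>U\<close>. The second
  reaches the iterates only through the deviation of \<open>S\<close>, hence after gossip, so
  \<open>V\<close> can have a weight proportional to the square of \<rho>. The weight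
  \<open>2 * \<eta> / p\<close> of \<open>U\<close> comes from the reset: half of the decrease
  \<open>p\<close> pays for \<open>\<eta> * U\<close> in the descent inequality, the other half
  gives the rate \<open>\<mu> * \<eta> \<le> p / 2\<close>. The batch size makes
  \<open>(1 - p) / b \<le> p\<close>, which cancels the \<open>1 / p\<close> in that weight and
  leaves about \<open>2 * \<eta> * DD\<close>, affordable for small \<open>L * \<eta>\<close>. What
  remains is of order \<open>n^2\<close> times the square of \<rho>, and this is the quantity that
  \<open>K\<close> must make small.\<close>

no_notation vec_nth (infixl "$" 90)
no_notation fps_nth (infixl "$" 75)

lemma scalar_prod_sum:
  assumes "dim_vec v = d"
  shows "u \<bullet> v = (\<Sum>j<d. u $ j * v $ j)"
  using assms by (simp add: scalar_prod_def atLeast0LessThan)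

lemma vec_norm_sq:
  assumes "v \<in> carrier_vec d"
  shows "(vec_norm v)\<^sup>2 = (\<Sum>j<d. (v $ j)\<^sup>2)"
  using assms unfolding vec_norm_def
  by (subst real_sqrt_pow2) (auto simp: scalar_prod_sum power2_eq_square intro!: sum_nonneg)

lemma vec_norm_eq_sqrt:
  assumes "v \<in> carrier_vec d"
  shows "vec_norm v = sqrt (\<Sum>j<d. (v $ j)\<^sup>2)"
  using assms unfolding vec_norm_def by (simp add: scalar_prod_sum[of v d] power2_eq_square)

lemma vec_norm_nonneg [simp]: "0 \<le> vec_norm v"
  unfolding vec_norm_def by (auto simp: scalar_prod_def intro!: sum_nonneg)

lemma vec_norm_smult:
  assumes "v \<in> carrier_vec d"
  shows "vec_norm (c \<cdot>\<^sub>v v) = \<bar>c\<bar> * vec_norm v"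
proof -
  have "vec_norm (c \<cdot>\<^sub>v v) = sqrt (c\<^sup>2 * (\<Sum>j<d. (v $ j)\<^sup>2))"
    using assms by (simp add: vec_norm_eq_sqrt[of _ d] power_mult_distrib sum_distrib_left)
  then show ?thesis using assms by (simp add: vec_norm_eq_sqrt[of _ d] real_sqrt_mult)
qed

lemma abs_scalar_prod_le:
  assumes "u \<in> carrier_vec d" "v \<in> carrier_vec d"
  shows "\<bar>u \<bullet> v\<bar> \<le> vec_norm u * vec_norm v"
proof -
  have "(u \<bullet> v)\<^sup>2 \<le> (\<Sum>j<d. (u $ j)\<^sup>2) * (\<Sum>j<d. (v $ j)\<^sup>2)"
    using assms by (simp add: scalar_prod_sum[of v d] Cauchy_Schwarz_ineq_sum)
  then have "(u \<bullet> v)\<^sup>2 \<le> (vec_norm u * vec_norm v)\<^sup>2"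
    using assms by (simp add: vec_norm_sq[of _ d] power_mult_distrib)
  then show ?thesis using abs_le_square_iff[of "u \<bullet> v" "vec_norm u * vec_norm v"] by simp
qed

lemma has_gradient_unique:
  assumes x: "x \<in> carrier_vec d" and g: "has_gradient d f x g" and h: "has_gradient d f x h"
  shows "g = h"
proof (rule ccontr)
  assume "g \<noteq> h"
  have gc: "g \<in> carrier_vec d" "h \<in> carrier_vec d" using g h by (auto simp: has_gradient_def)
  define u where "u = g - h"
  have u: "u \<in> carrier_vec d" using gc by (simp add: u_def)
  have "vec_norm u \<noteq> 0"
  proof
    assume "vec_norm u = 0"
    then have "(\<Sum>j<d. (u $ j)\<^sup>2) = 0" using vec_norm_sq[OF u] by simp
    then have "\<forall>j<d. u $ j = 0" by (subst (asm) sum_nonneg_eq_0_iff) auto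
    then have "g = h" using gc by (intro eq_vecI) (auto simp: u_def)
    then show False using \<open>g \<noteq> h\<close> by simp
  qed
  then have pos: "vec_norm u > 0" using vec_norm_nonneg[of u] by linarith
  \<comment> \<open>Along \<open>u\<close> the two linear parts differ by t |u|^2, while the two
    error bounds together allow 2 e t |u|; a quarter of the norm makes this half of the
    difference.\<close>
  define e where "e = vec_norm u / 4"
  have e: "e > 0" using pos by (simp add: e_def)
  obtain d1 where d1: "d1 > 0" "\<And>y. y \<in> carrier_vec d \<Longrightarrow> vec_norm (y - x) < d1 \<Longrightarrow>
      \<bar>f y - f x - g \<bullet> (y - x)\<bar> \<le> e * vec_norm (y - x)"
    using g e unfolding has_gradient_def by blast
  obtain d2 where d2: "d2 > 0" "\<And>y. y \<in> carrier_vec d \<Longrightarrow> vec_norm (y - x) < d2 \<Longrightarrow>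
      \<bar>f y - f x - h \<bullet> (y - x)\<bar> \<le> e * vec_norm (y - x)"
    using h e unfolding has_gradient_def by blast
  define t where "t = min d1 d2 / (2 * vec_norm u)"
  have t: "t > 0" using d1 d2 pos by (simp add: t_def)
  define y where "y = x + t \<cdot>\<^sub>v u"
  have y: "y \<in> carrier_vec d" using x u by (simp add: y_def)
  have yx: "y - x = t \<cdot>\<^sub>v u" using x u by (intro eq_vecI) (auto simp: y_def)
  have n: "vec_norm (y - x) = t * vec_norm u" using u t by (simp add: yx vec_norm_smult)
  have lt: "t * vec_norm u < d1" "t * vec_norm u < d2" using d1(1) d2(1) pos by (auto simp: t_def)
  have "g \<bullet> (y - x) - h \<bullet> (y - x) = t * (u \<bullet> u)"
    using gc u by (simp add: yx scalar_prod_sum[of _ d] u_def sum_distrib_left algebra_simps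
        flip: sum_subtractf)
  also have "u \<bullet> u = (vec_norm u)\<^sup>2" using vec_norm_sq[OF u] u by (simp add: scalar_prod_sum power2_eq_square)
  finally have "t * (vec_norm u)\<^sup>2 = g \<bullet> (y - x) - h \<bullet> (y - x)" by simp
  also have "\<dots> \<le> 2 * e * (t * vec_norm u)"
    using d1(2)[OF y] d2(2)[OF y] lt n by simp
  also have "\<dots> = t * (vec_norm u)\<^sup>2 / 2" by (simp add: e_def power2_eq_square)
  finally show False using t pos by simp
qed

lemma gradient_eqI:
  assumes "x \<in> carrier_vec d" "has_gradient d f x g"
  shows "gradient d f x = g"
  unfolding gradient_def using assms by (auto intro!: the_equality dest: has_gradient_unique)

lemma has_gradient_gradient:
  assumes "differentiable_vec d f" "x \<in> carrier_vec d"
  shows "has_gradient d f x (gradient d f x)"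
  using assms gradient_eqI unfolding differentiable_vec_def by metis

lemma gradient_carrier:
  assumes "differentiable_vec d f" "x \<in> carrier_vec d"
  shows "gradient d f x \<in> carrier_vec d"
  using has_gradient_gradient[OF assms] by (simp add: has_gradient_def)

lemma has_gradient_add:
  assumes f: "has_gradient d f x g" and f': "has_gradient d f' x g'"
  and x: "x \<in> carrier_vec d"
  shows "has_gradient d (\<lambda>y. f y + f' y) x (g + g')"
  unfolding has_gradient_def
proof (intro conjI allI impI)
  show "g + g' \<in> carrier_vec d" using f f' by (simp add: has_gradient_def)
  fix e :: real assume "e > 0"
  then have e: "e / 2 > 0" by simp
  obtain d1 where d1: "d1 > 0" "\<And>y. y \<in> carrier_vec d \<Longrightarrow> vec_norm (y - x) < d1 \<Longrightarrow>
      \<bar>f y - f x - g \<bullet> (y - x)\<bar> \<le> e / 2 * vec_norm (y - x)"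
    using f e unfolding has_gradient_def by blast
  obtain d2 where d2: "d2 > 0" "\<And>y. y \<in> carrier_vec d \<Longrightarrow> vec_norm (y - x) < d2 \<Longrightarrow>
      \<bar>f' y - f' x - g' \<bullet> (y - x)\<bar> \<le> e / 2 * vec_norm (y - x)"
    using f' e unfolding has_gradient_def by blast
  show "\<exists>\<delta>>0. \<forall>y\<in>carrier_vec d. vec_norm (y - x) < \<delta> \<longrightarrow>
      \<bar>f y + f' y - (f x + f' x) - (g + g') \<bullet> (y - x)\<bar> \<le> e * vec_norm (y - x)"
  proof (intro exI[of _ "min d1 d2"] conjI ballI impI)
    show "0 < min d1 d2" using d1 d2 by simp
    fix y assume y: "y \<in> carrier_vec d" "vec_norm (y - x) < min d1 d2"
    have "(g + g') \<bullet> (y - x) = g \<bullet> (y - x) + g' \<bullet> (y - x)"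
      using f f' x y by (intro add_scalar_prod_distrib[of _ d]) (auto simp: has_gradient_def)
    moreover have "\<bar>f y - f x - g \<bullet> (y - x)\<bar> \<le> e / 2 * vec_norm (y - x)"
      "\<bar>f' y - f' x - g' \<bullet> (y - x)\<bar> \<le> e / 2 * vec_norm (y - x)"
      using d1(2)[OF y(1)] d2(2)[OF y(1)] y(2) by auto
    ultimately have "\<bar>f y + f' y - (f x + f' x) - (g + g') \<bullet> (y - x)\<bar>
        \<le> e / 2 * vec_norm (y - x) + e / 2 * vec_norm (y - x)" by linarith
    then show "\<bar>f y + f' y - (f x + f' x) - (g + g') \<bullet> (y - x)\<bar> \<le> e * vec_norm (y - x)"
      by simp
  qed
qed

lemma has_gradient_scale:
  assumes f: "has_gradient d f x g" and x: "x \<in> carrier_vec d"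
  shows "has_gradient d (\<lambda>y. c * f y) x (c \<cdot>\<^sub>v g)"
  unfolding has_gradient_def
proof (intro conjI allI impI)
  show "c \<cdot>\<^sub>v g \<in> carrier_vec d" using f by (simp add: has_gradient_def)
  fix e :: real assume "e > 0"
  \<comment> \<open>The \<open>+ 1\<close> covers \<open>c = 0\<close>.\<close>
  then have e: "e / (\<bar>c\<bar> + 1) > 0" by simp
  obtain d1 where d1: "d1 > 0" "\<And>y. y \<in> carrier_vec d \<Longrightarrow> vec_norm (y - x) < d1 \<Longrightarrow>
      \<bar>f y - f x - g \<bullet> (y - x)\<bar> \<le> e / (\<bar>c\<bar> + 1) * vec_norm (y - x)"
    using f e unfolding has_gradient_def by blast
  show "\<exists>\<delta>>0. \<forall>y\<in>carrier_vec d. vec_norm (y - x) < \<delta> \<longrightarrow>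
      \<bar>c * f y - c * f x - (c \<cdot>\<^sub>v g) \<bullet> (y - x)\<bar> \<le> e * vec_norm (y - x)"
  proof (intro exI[of _ d1] conjI ballI impI)
    show "0 < d1" by fact
    fix y assume y: "y \<in> carrier_vec d" "vec_norm (y - x) < d1"
    have "(c \<cdot>\<^sub>v g) \<bullet> (y - x) = c * (g \<bullet> (y - x))"
      using f x y by (intro smult_scalar_prod_distrib[of _ d]) (auto simp: has_gradient_def)
    then have "\<bar>c * f y - c * f x - (c \<cdot>\<^sub>v g) \<bullet> (y - x)\<bar> = \<bar>c\<bar> * \<bar>f y - f x - g \<bullet> (y - x)\<bar>"
      by (simp add: algebra_simps flip: abs_mult)
    also have "\<dots> \<le> \<bar>c\<bar> * (e / (\<bar>c\<bar> + 1) * vec_norm (y - x))"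
      by (intro mult_left_mono d1(2) y) simp
    also have "\<dots> = (\<bar>c\<bar> / (\<bar>c\<bar> + 1)) * (e * vec_norm (y - x))" by simp
    also have "\<dots> \<le> 1 * (e * vec_norm (y - x))"
      using \<open>e > 0\<close> by (intro mult_right_mono) auto
    finally show "\<bar>c * f y - c * f x - (c \<cdot>\<^sub>v g) \<bullet> (y - x)\<bar> \<le> e * vec_norm (y - x)" by simp
  qed
qed

lemma has_gradient_sum:
  fixes n :: nat
  assumes "x \<in> carrier_vec d" "\<And>i. i < n \<Longrightarrow> has_gradient d (fs i) x (g i)"
  shows "has_gradient d (\<lambda>y. \<Sum>i<n. fs i y) x (vec d (\<lambda>j. \<Sum>i<n. g i $ j))"
  using assms(2)
proof (induction n)
  case 0
  have "\<bar>vec d (\<lambda>j. 0) \<bullet> (y - x)\<bar> = 0" if "y \<in> carrier_vec d" for y :: "real vec"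
    using that assms(1) by (simp add: scalar_prod_sum[of _ d])
  then show ?case by (auto simp: has_gradient_def intro!: exI[of _ 1])
next
  case (Suc n)
  have "has_gradient d (\<lambda>y. (\<Sum>i<n. fs i y) + fs n y) x (vec d (\<lambda>j. \<Sum>i<n. g i $ j) + g n)"
    using Suc assms(1) by (intro has_gradient_add) auto
  moreover have "vec d (\<lambda>j. \<Sum>i<n. g i $ j) + g n = vec d (\<lambda>j. \<Sum>i<Suc n. g i $ j)"
    using Suc.prems[of n] by (intro eq_vecI) (auto simp: has_gradient_def)
  ultimately show ?case by simp
qed

lemma has_gradient_avg_fun:
  assumes "x \<in> carrier_vec d" "\<And>i. i < n \<Longrightarrow> differentiable_vec d (fs i)"
  shows "has_gradient d (avg_fun n fs) x (vec d (\<lambda>j. (\<Sum>i<n. gradient d (fs i) x $ j) / real n))"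
proof -
  have "has_gradient d (\<lambda>y. (1 / real n) * (\<Sum>i<n. fs i y)) x
     ((1 / real n) \<cdot>\<^sub>v vec d (\<lambda>j. \<Sum>i<n. gradient d (fs i) x $ j))"
    using assms by (intro has_gradient_scale has_gradient_sum has_gradient_gradient) auto
  moreover have "(1 / real n) \<cdot>\<^sub>v vec d (\<lambda>j. \<Sum>i<n. gradient d (fs i) x $ j)
     = vec d (\<lambda>j. (\<Sum>i<n. gradient d (fs i) x $ j) / real n)"
    by (intro eq_vecI) auto
  moreover have "(\<lambda>y. (1 / real n) * (\<Sum>i<n. fs i y)) = avg_fun n fs"
    by (simp add: avg_fun_def fun_eq_iff)
  ultimately show ?thesis by simp
qed

text \<open>Bridge to real calculus: along a line the gradient on \<open>carrier_vec d\<close>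
  becomes an ordinary derivative, so monotonicity can be read off its sign.\<close>

lemma has_gradient_line:
  assumes x: "x \<in> carrier_vec d" and h: "h \<in> carrier_vec d"
    and g: "has_gradient d f (x + t \<cdot>\<^sub>v h) g"
  shows "((\<lambda>s. f (x + s \<cdot>\<^sub>v h)) has_real_derivative (g \<bullet> h)) (at t)"
  unfolding has_field_derivative_def has_derivative_within_alt
proof (intro conjI allI impI)
  show "bounded_linear ((*) (g \<bullet> h))" by (rule bounded_linear_mult_right)
  fix e :: real assume e: "e > 0"
  define N where "N = vec_norm h + 1"
  have N: "N > 0" unfolding N_def using vec_norm_nonneg[of h] by linarith
  obtain \<delta> where \<delta>: "\<delta> > 0" "\<And>y. y \<in> carrier_vec d \<Longrightarrow> vec_norm (y - (x + t \<cdot>\<^sub>v h)) < \<delta> \<Longrightarrow>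
      \<bar>f y - f (x + t \<cdot>\<^sub>v h) - g \<bullet> (y - (x + t \<cdot>\<^sub>v h))\<bar> \<le> (e / N) * vec_norm (y - (x + t \<cdot>\<^sub>v h))"
    using g e N unfolding has_gradient_def by (metis divide_pos_pos)
  show "\<exists>\<delta>>0. \<forall>s\<in>UNIV. norm (s - t) < \<delta> \<longrightarrow>
      norm (f (x + s \<cdot>\<^sub>v h) - f (x + t \<cdot>\<^sub>v h) - g \<bullet> h * (s - t)) \<le> e * norm (s - t)"
  proof (intro exI[of _ "\<delta> / N"] conjI ballI impI)
    show "0 < \<delta> / N" using \<delta> N by simp
    fix s assume s: "norm (s - t) < \<delta> / N"
    have eq: "(x + s \<cdot>\<^sub>v h) - (x + t \<cdot>\<^sub>v h) = (s - t) \<cdot>\<^sub>v h"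
      using x h by (intro eq_vecI) (auto simp: algebra_simps)
    have nrm: "vec_norm ((s - t) \<cdot>\<^sub>v h) = \<bar>s - t\<bar> * vec_norm h" using h by (rule vec_norm_smult)
    have "\<bar>s - t\<bar> * vec_norm h \<le> \<bar>s - t\<bar> * N" by (intro mult_left_mono) (auto simp: N_def)
    also have "\<dots> < \<delta>" using s N by (simp add: pos_less_divide_eq)
    finally have "\<bar>f (x + s \<cdot>\<^sub>v h) - f (x + t \<cdot>\<^sub>v h) - g \<bullet> ((s - t) \<cdot>\<^sub>v h)\<bar> \<le> (e / N) * (\<bar>s - t\<bar> * vec_norm h)"
      using \<delta>(2)[of "x + s \<cdot>\<^sub>v h"] x h by (simp add: eq nrm)
    also have "\<dots> = (vec_norm h / N) * (e * \<bar>s - t\<bar>)" by simp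
    also have "\<dots> \<le> 1 * (e * \<bar>s - t\<bar>)"
      using e N by (intro mult_right_mono) (auto simp: N_def)
    finally show "norm (f (x + s \<cdot>\<^sub>v h) - f (x + t \<cdot>\<^sub>v h) - g \<bullet> h * (s - t)) \<le> e * norm (s - t)"
      using g h by (simp add: has_gradient_def mult.commute)
  qed
qed

text \<open>\<open>\<psi>\<close> is \<open>f\<close> along the segment minus its tangent and minus
  the quadratic term. The Lipschitz bound makes its derivative nonpositive for
  \<open>t \<ge> 0\<close>, and \<open>\<psi> 1 \<le> \<psi> 0\<close> is the claim; no integral is
  involved.\<close>

lemma smooth_descent:
  assumes diff: "differentiable_vec d f"
    and lip: "\<And>x y. x \<in> carrier_vec d \<Longrightarrow> y \<in> carrier_vec d \<Longrightarrow>
      vec_norm (gradient d f x - gradient d f y) \<le> L * vec_norm (x - y)"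
    and x: "x \<in> carrier_vec d" and h: "h \<in> carrier_vec d"
  shows "f (x + h) \<le> f x + gradient d f x \<bullet> h + L / 2 * (vec_norm h)\<^sup>2"
proof -
  define G where "G t = gradient d f (x + t \<cdot>\<^sub>v h)" for t :: real
  define \<psi> where "\<psi> t = f (x + t \<cdot>\<^sub>v h) - t * (G 0 \<bullet> h) - L / 2 * t\<^sup>2 * (vec_norm h)\<^sup>2" for t
  have c: "x + t \<cdot>\<^sub>v h \<in> carrier_vec d" for t :: real using x h by simp
  have Gc: "G t \<in> carrier_vec d" for t using gradient_carrier[OF diff c] by (simp add: G_def)
  have der: "(\<psi> has_real_derivative (G t \<bullet> h - G 0 \<bullet> h - L * t * (vec_norm h)\<^sup>2)) (at t)" for t
    unfolding \<psi>_def
    by (rule derivative_eq_intros has_gradient_line[OF x h has_gradient_gradient[OF diff c]] refl)+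
       (simp add: G_def)
  have np: "G t \<bullet> h - G 0 \<bullet> h - L * t * (vec_norm h)\<^sup>2 \<le> 0" if "0 \<le> t" for t
  proof -
    have "G t \<bullet> h - G 0 \<bullet> h = (G t - G 0) \<bullet> h"
      using Gc h by (simp add: minus_scalar_prod_distrib[of _ d])
    also have "\<dots> \<le> vec_norm (G t - G 0) * vec_norm h"
      using abs_scalar_prod_le[of "G t - G 0" d h] Gc h by simp
    also have "vec_norm (G t - G 0) \<le> L * vec_norm ((x + t \<cdot>\<^sub>v h) - (x + 0 \<cdot>\<^sub>v h))"
      unfolding G_def by (rule lip[OF c c])
    also have "(x + t \<cdot>\<^sub>v h) - (x + 0 \<cdot>\<^sub>v h) = t \<cdot>\<^sub>v h" using x h by (intro eq_vecI) auto
    also have "vec_norm (t \<cdot>\<^sub>v h) = t * vec_norm h" using h that by (simp add: vec_norm_smult)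
    finally show ?thesis by (simp add: power2_eq_square mult_right_mono algebra_simps)
  qed
  have "\<psi> 1 \<le> \<psi> 0"
    by (rule DERIV_nonpos_imp_nonincreasing[of 0 1]) (use der np in fastforce)+
  moreover have "x + 1 \<cdot>\<^sub>v h = x + h" "x + 0 \<cdot>\<^sub>v h = x" using x h by auto
  ultimately show ?thesis by (simp add: \<psi>_def G_def)
qed

section \<open>Real symmetric matrices\<close>

text \<open>Over the complex numbers the characteristic polynomial has a root \<open>a\<close>. For
  a real symmetric matrix the Hermitian form \<open>S\<close>, which equals \<open>a * N\<close>, is
  its own conjugate, so \<open>a\<close> is real. As a root of the real characteristic polynomial it
  then has a real eigenvector.\<close>

lemma real_symmetric_eigenvector:
  fixes A :: "real mat"
  assumes A: "A \<in> carrier_mat n n" and sym: "transpose_mat A = A" and n: "n > 0"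
  obtains e v where "v \<in> carrier_vec n" "v \<noteq> 0\<^sub>v n" "A *\<^sub>v v = e \<cdot>\<^sub>v v"
proof -
  define C where "C = map_mat complex_of_real A"
  have C: "C \<in> carrier_mat n n" using A by (simp add: C_def)
  obtain as where as: "char_poly C = (\<Prod>a\<leftarrow>as. [:- a, 1:])" "length as = n"
    using char_poly_factorized[OF C] by blast
  then obtain a where "a \<in> set as" using n by (cases as) auto
  then have root: "poly (char_poly C) a = 0"
    unfolding as(1) poly_prod_list by (auto simp: prod_list_zero_iff)
  then have "eigenvalue C a" using eigenvalue_root_char_poly[OF C] by simp
  then obtain w where w: "w \<in> carrier_vec n" "w \<noteq> 0\<^sub>v n" "C *\<^sub>v w = a \<cdot>\<^sub>v w"
    unfolding eigenvalue_def eigenvector_def using C by auto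
  define S where "S = (\<Sum>i<n. \<Sum>j<n. cnj (w $ i) * A $$ (i, j) * w $ j)"
  define N where "N = (\<Sum>i<n. (cmod (w $ i))\<^sup>2)"
  have row: "(\<Sum>j<n. A $$ (i, j) * w $ j) = a * w $ i" if "i < n" for i
  proof -
    have "(C *\<^sub>v w) $ i = (\<Sum>j<n. A $$ (i, j) * w $ j)"
      using A w(1) that by (simp add: C_def scalar_prod_def atLeast0LessThan)
    then show ?thesis using w that by simp
  qed
  have "S = (\<Sum>i<n. cnj (w $ i) * (\<Sum>j<n. A $$ (i, j) * w $ j))"
    by (simp add: S_def sum_distrib_left mult.assoc)
  also have "\<dots> = (\<Sum>i<n. a * (cmod (w $ i))\<^sup>2)"
  proof (intro sum.cong refl)
    fix i assume "i \<in> {..<n}"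
    then have "(\<Sum>j<n. A $$ (i, j) * w $ j) = a * w $ i" using row by simp
    then show "cnj (w $ i) * (\<Sum>j<n. A $$ (i, j) * w $ j) = a * complex_of_real ((cmod (w $ i))\<^sup>2)"
      unfolding complex_norm_square by (simp only: ac_simps)
  qed
  also have "\<dots> = a * N" by (simp add: N_def sum_distrib_left)
  finally have S1: "S = a * N" .
  have symA: "A $$ (i, j) = A $$ (j, i)" if "i < n" "j < n" for i j
    using A that arg_cong[OF sym, of "\<lambda>M. M $$ (i, j)"] by simp
  have "cnj S = (\<Sum>i<n. \<Sum>j<n. w $ i * A $$ (i, j) * cnj (w $ j))" by (simp add: S_def)
  also have "\<dots> = (\<Sum>j<n. \<Sum>i<n. w $ i * A $$ (i, j) * cnj (w $ j))" by (rule sum.swap)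
  also have "\<dots> = S" unfolding S_def
    by (intro sum.cong refl) (use symA in \<open>simp add: ac_simps\<close>)
  finally have S2: "cnj S = S" .
  obtain i where i: "i < n" "w $ i \<noteq> 0"
    using w(1,2) by (metis carrier_vecD eq_vecI index_zero_vec)
  have "N \<ge> (cmod (w $ i))\<^sup>2" unfolding N_def using i by (intro member_le_sum) auto
  then have "N > 0" using i by (smt (verit) zero_less_norm_iff zero_less_power)
  then have "cnj a = a" using S1 S2 by auto
  then have ar: "a = of_real (Re a)" by (metis Reals_cnj_iff of_real_Re)
  have "char_poly C = map_poly of_real (char_poly A)"
    unfolding C_def by (rule of_real_hom.char_poly_hom[OF A])
  then have "poly (map_poly complex_of_real (char_poly A)) (of_real (Re a)) = 0" using root ar by metis
  then have "poly (char_poly A) (Re a) = 0" by simp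
  then have "eigenvalue A (Re a)" using eigenvalue_root_char_poly[OF A] by simp
  then show thesis using that A unfolding eigenvalue_def eigenvector_def by auto
qed

(* The Householder reflection exchanging v and the first unit vector. *)
lemma symmetric_orthogonal_first_col:
  fixes v :: "real vec"
  assumes v: "v \<in> carrier_vec (Suc n)" and v1: "v \<bullet> v = 1"
  obtains H where "H \<in> carrier_mat (Suc n) (Suc n)" "transpose_mat H = H"
    "H * H = 1\<^sub>m (Suc n)" "col H 0 = v"
proof -
  let ?N = "Suc n"
  define w where "w = v - unit_vec ?N 0"
  have w: "w \<in> carrier_vec ?N" using v by (simp add: w_def)
  have wi: "w $ i = v $ i - (if i = 0 then 1 else 0)" if "i < ?N" for i
    using that v by (simp add: w_def unit_vec_def)
  define s where "s = (\<Sum>i<?N. w $ i * w $ i)"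
  have "s = (\<Sum>i<?N. v $ i * v $ i) - 2 * v $ 0 + 1"
    unfolding s_def sum.lessThan_Suc_shift by (simp add: wi algebra_simps)
  moreover have "(\<Sum>i<?N. v $ i * v $ i) = 1" using v v1 by (simp add: scalar_prod_sum[of v ?N])
  \<comment> \<open>For a unit vector, |v - e_0|^2 = 2 - 2 v_0; this is what turns the first column
    of the reflection into \<open>v\<close>.\<close>
  ultimately have s0: "s = - 2 * w $ 0" by (simp add: wi)
  \<comment> \<open>If \<open>v\<close> already is the first unit vector, then \<open>s = 0\<close>,
    hence \<open>2 / s = 0\<close>, and \<open>H\<close> is the identity, as desired.\<close>
  define H where "H = mat ?N ?N (\<lambda>(i, j). (if i = j then 1 else 0) - 2 / s * w $ i * w $ j)"
  have 1: "H \<in> carrier_mat ?N ?N" by (simp add: H_def)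
  have 2: "transpose_mat H = H" by (rule eq_matI) (auto simp: H_def)
  have 3: "H * H = 1\<^sub>m ?N"
  proof (rule eq_matI)
    fix i j assume "i < dim_row (1\<^sub>m ?N)" "j < dim_col (1\<^sub>m ?N)"
    then have ij: "i < ?N" "j < ?N" by auto
    let ?d = "\<lambda>i j. (if i = j then 1 else 0 :: real)"
    have delta: "(\<Sum>k<?N. ?d i k * F k) = F i" for F
      using ij by (simp add: if_distrib[of "\<lambda>x. x * _"] cong: if_cong del: sum.lessThan_Suc)
    have delta': "(\<Sum>k<?N. ?d k j * F k) = F j" for F
      using ij by (simp add: if_distrib[of "\<lambda>x. x * _"] cong: if_cong del: sum.lessThan_Suc)
    have dd: "(\<Sum>k<?N. ?d i k * ?d k j) = ?d i j" by (rule delta)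
    have "(H * H) $$ (i, j) = (\<Sum>k<?N. (?d i k - 2 / s * w $ i * w $ k) * (?d k j - 2 / s * w $ k * w $ j))"
      using ij by (simp add: H_def scalar_prod_def atLeast0LessThan)
    also have "\<dots> = (\<Sum>k<?N. ?d i k * ?d k j - ?d i k * (2 / s * w $ k * w $ j)
         - ?d k j * (2 / s * w $ i * w $ k) + (2 / s)\<^sup>2 * w $ i * w $ j * (w $ k * w $ k))"
      by (intro sum.cong refl) (simp add: algebra_simps power2_eq_square)
    also have "\<dots> = ?d i j - 2 / s * w $ i * w $ j - 2 / s * w $ i * w $ j + (2 / s)\<^sup>2 * w $ i * w $ j * s"
      unfolding sum.distrib sum_subtractf dd delta delta' sum_distrib_left[symmetric] s_def[symmetric] ..
    also have "\<dots> = ?d i j" by (simp add: power2_eq_square)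
    finally show "(H * H) $$ (i, j) = 1\<^sub>m ?N $$ (i, j)" using ij by simp
  qed (simp_all add: H_def)
  have 4: "col H 0 = v"
  proof (rule eq_vecI)
    fix i assume "i < dim_vec v"
    then have i: "i < ?N" using v by simp
    have "col H 0 $ i = (if i = 0 then 1 else 0) - 2 / s * w $ i * w $ 0" using i by (simp add: H_def)
    also have "\<dots> = (if i = 0 then 1 else 0) + w $ i"
    proof (cases "s = 0")
      case True
      then have "\<forall>i<?N. w $ i * w $ i = 0" unfolding s_def by (subst (asm) sum_nonneg_eq_0_iff) auto
      then show ?thesis using i by simp
    next
      case False
      then show ?thesis using s0 by (simp add: field_simps)
    qed
    also have "\<dots> = v $ i" using i by (simp add: wi)
    finally show "col H 0 $ i = v $ i" .
  qed (use v in \<open>simp add: H_def\<close>)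
  show thesis using that 1 2 3 4 by blast
qed

text \<open>Deflation: \<open>H\<close> carries the first unit vector to a unit eigenvector, so the
  first column of \<open>H * (A * H)\<close> is \<open>e\<close> times that unit vector, and by
  symmetry so is the first row. The induction hypothesis diagonalizes the remaining block, and
  \<open>H * Q\<close> combines both changes of basis.\<close>

theorem real_symmetric_diagonalization:
  fixes A :: "real mat"
  assumes "A \<in> carrier_mat n n" "transpose_mat A = A"
  shows "\<exists>P lam. P \<in> carrier_mat n n \<and> transpose_mat P * P = 1\<^sub>m n \<and> A * P = P * mat_diag n lam"
  using assms
proof (induction n arbitrary: A)
  case 0
  then show ?case by (intro exI[of _ "1\<^sub>m 0"] exI[of _ "\<lambda>_. 0"]) (auto intro!: eq_matI simp: mat_diag_def)
next
  case (Suc n)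
  let ?N = "Suc n"
  note A = Suc.prems(1)
  obtain e v0 where v0: "v0 \<in> carrier_vec ?N" "v0 \<noteq> 0\<^sub>v ?N" "A *\<^sub>v v0 = e \<cdot>\<^sub>v v0"
    using real_symmetric_eigenvector[OF Suc.prems] by blast
  define v where "v = (1 / sqrt (v0 \<bullet> v0)) \<cdot>\<^sub>v v0"
  have v: "v \<in> carrier_vec ?N" using v0 by (simp add: v_def)
  obtain i where "i < ?N" "v0 $ i \<noteq> 0" using v0(1,2) by (metis carrier_vecD eq_vecI index_zero_vec)
  moreover from this have "0 < v0 $ i * v0 $ i" by (metis not_real_square_gt_zero)
  ultimately have "v0 \<bullet> v0 > 0" using v0(1)
    by (auto simp: scalar_prod_sum[of v0 ?N] simp del: sum.lessThan_Suc intro!: sum_pos2[of _ i])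
  then have v1: "v \<bullet> v = 1" using v0 by (simp add: v_def)
  have Av: "A *\<^sub>v v = e \<cdot>\<^sub>v v"
    using v0 A by (simp add: v_def mult_mat_vec[of _ ?N ?N] smult_smult_assoc mult.commute)
  obtain H where H: "H \<in> carrier_mat ?N ?N" "transpose_mat H = H" "H * H = 1\<^sub>m ?N" "col H 0 = v"
    using symmetric_orthogonal_first_col[OF v v1] by blast
  define B where "B = H * (A * H)"
  have B: "B \<in> carrier_mat ?N ?N" using A H by (simp add: B_def)
  have Bsym: "transpose_mat B = B"
    using A H Suc.prems(2) by (simp add: B_def transpose_mult[of _ ?N ?N _ ?N] assoc_mult_mat[of _ ?N ?N _ ?N _ ?N])
  have "col (A * H) 0 = A *\<^sub>v v" using A H col_mult2[of A ?N ?N H ?N 0] by simp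
  then have "col B 0 = H *\<^sub>v (e \<cdot>\<^sub>v v)"
    using A H Av col_mult2[of H ?N ?N "A * H" ?N 0] by (simp add: B_def)
  also have "\<dots> = e \<cdot>\<^sub>v (H *\<^sub>v col H 0)" using H v by (simp add: mult_mat_vec[of _ ?N ?N])
  also have "H *\<^sub>v col H 0 = col (1\<^sub>m ?N) 0" using H col_mult2[of H ?N ?N H ?N 0] by simp
  finally have cB: "col B 0 = e \<cdot>\<^sub>v col (1\<^sub>m ?N) 0" .
  have colB: "B $$ (i, 0) = (if i = 0 then e else 0)" if "i < ?N" for i
  proof -
    have "B $$ (i, 0) = col B 0 $ i" using B that by simp
    then show ?thesis unfolding cB using that by simp
  qed
  have rowB: "B $$ (0, i) = (if i = 0 then e else 0)" if "i < ?N" for i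
    using that B colB[OF that] arg_cong[OF Bsym, of "\<lambda>M. M $$ (0, i)"] by simp
  define B' where "B' = mat n n (\<lambda>(i, j). B $$ (Suc i, Suc j))"
  have B': "B' \<in> carrier_mat n n" by (simp add: B'_def)
  have Bblock: "B = four_block_mat (mat 1 1 (\<lambda>_. e)) (0\<^sub>m 1 n) (0\<^sub>m n 1) B'"
    using B colB rowB by (intro eq_matI) (auto simp: B'_def)
  have "transpose_mat B' = B'"
  proof (rule eq_matI)
    fix i j assume "i < dim_row B'" "j < dim_col B'"
    then show "transpose_mat B' $$ (i, j) = B' $$ (i, j)"
      using B arg_cong[OF Bsym, of "\<lambda>M. M $$ (Suc i, Suc j)"] by (simp add: B'_def)
  qed (simp_all add: B'_def)
  then obtain P' lam' where P': "P' \<in> carrier_mat n n" "transpose_mat P' * P' = 1\<^sub>m n"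
    "B' * P' = P' * mat_diag n lam'"
    using Suc.IH[OF B'] by blast
  define Q where "Q = four_block_mat (1\<^sub>m 1) (0\<^sub>m 1 n) (0\<^sub>m n 1) P'"
  have Q: "Q \<in> carrier_mat ?N ?N" using P' by (intro carrier_matI) (auto simp: Q_def)
  define lam where "lam i = (case i of 0 \<Rightarrow> e | Suc k \<Rightarrow> lam' k)" for i
  have D: "mat_diag ?N lam = four_block_mat (mat 1 1 (\<lambda>_. e)) (0\<^sub>m 1 n) (0\<^sub>m n 1) (mat_diag n lam')"
    by (intro eq_matI) (auto simp: mat_diag_def lam_def split: nat.splits)
  have BQ: "B * Q = Q * mat_diag ?N lam"
    unfolding Bblock Q_def D using P' B'
    by (subst (1 2) mult_four_block_mat[of _ 1 1 _ n _ n _ _ 1 _ n])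
       (auto simp: left_mult_zero_mat[of _ n n])
  have QQ: "transpose_mat Q * Q = 1\<^sub>m ?N"
    unfolding Q_def using P'
    by (subst transpose_four_block_mat[of _ 1 1 _ n _ n], simp_all,
        subst mult_four_block_mat[of _ 1 1 _ n _ n _ _ 1 _ n]) auto
  have QT: "transpose_mat Q \<in> carrier_mat ?N ?N" and HA: "A * H \<in> carrier_mat ?N ?N"
    and HQ: "H * Q \<in> carrier_mat ?N ?N" and D: "mat_diag ?N lam \<in> carrier_mat ?N ?N"
    using Q H A by auto
  have HB: "H * B = A * H"
    unfolding B_def assoc_mult_mat[OF H(1) H(1) HA, symmetric] H(3) by (rule left_mult_one_mat[OF HA])
  have "A * (H * Q) = H * B * Q" unfolding HB by (rule assoc_mult_mat[OF A H(1) Q, symmetric])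
  also have "\<dots> = H * (B * Q)" by (rule assoc_mult_mat[OF H(1) B Q])
  also have "\<dots> = H * Q * mat_diag ?N lam" unfolding BQ by (rule assoc_mult_mat[OF H(1) Q D, symmetric])
  finally have e1: "A * (H * Q) = H * Q * mat_diag ?N lam" .
  have "transpose_mat (H * Q) * (H * Q) = transpose_mat Q * H * (H * Q)"
    by (simp only: transpose_mult[OF H(1) Q] H(2))
  also have "\<dots> = transpose_mat Q * (H * (H * Q))" by (rule assoc_mult_mat[OF QT H(1) HQ])
  also have "H * (H * Q) = 1\<^sub>m ?N * Q" unfolding H(3)[symmetric] by (rule assoc_mult_mat[OF H(1) H(1) Q, symmetric])
  also have "1\<^sub>m ?N * Q = Q" by (rule left_mult_one_mat[OF Q])
  finally have e2: "transpose_mat (H * Q) * (H * Q) = 1\<^sub>m ?N" unfolding QQ .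
  show ?case using e1 e2 H Q by (intro exI[of _ "H * Q"] exI[of _ lam]) auto
qed

text \<open>\<open>u i k\<close> is entry \<open>k\<close> of the \<open>i\<close>-th eigenvector.
  Orthonormality and completeness are the two orders of multiplying \<open>P\<close> with its
  transpose. The multiset \<open>proots\<close> keeps multiplicities, because \<open>lambda2\<close>
  is read off the sorted roots.\<close>

lemma orthonormal_eigenbasis:
  fixes A :: "real mat"
  assumes A: "A \<in> carrier_mat n n" and sym: "transpose_mat A = A"
  obtains u :: "nat \<Rightarrow> nat \<Rightarrow> real" and lam :: "nat \<Rightarrow> real"
  where "\<And>i k. i < n \<Longrightarrow> k < n \<Longrightarrow> (\<Sum>l<n. A $$ (k, l) * u i l) = lam i * u i k"
    and "\<And>i j. i < n \<Longrightarrow> j < n \<Longrightarrow> (\<Sum>k<n. u i k * u j k) = (if i = j then 1 else 0)"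
    and "\<And>k l. k < n \<Longrightarrow> l < n \<Longrightarrow> (\<Sum>i<n. u i k * u i l) = (if k = l then 1 else 0)"
    and "proots (char_poly A) = mset (map lam [0..<n])"
proof -
  obtain P lam where P: "P \<in> carrier_mat n n" "transpose_mat P * P = 1\<^sub>m n" "A * P = P * mat_diag n lam"
    using real_symmetric_diagonalization[OF A sym] by blast
  have PT: "transpose_mat P \<in> carrier_mat n n" using P by simp
  have PP: "P * transpose_mat P = 1\<^sub>m n" by (rule mat_mult_left_right_inverse[OF PT P(1,2)])
  define u where "u i k = P $$ (k, i)" for i k
  have 1: "(\<Sum>l<n. A $$ (k, l) * u i l) = lam i * u i k" if "i < n" "k < n" for i k
  proof -
    have "(\<Sum>l<n. A $$ (k, l) * u i l) = (A * P) $$ (k, i)"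
      using A P(1) that by (simp add: u_def scalar_prod_def atLeast0LessThan)
    also have "\<dots> = lam i * u i k" unfolding P(3) using P(1) that
      by (subst mat_diag_mult_right[of _ n n]) (auto simp: u_def)
    finally show ?thesis .
  qed
  have 2: "(\<Sum>k<n. u i k * u j k) = (if i = j then 1 else 0)" if "i < n" "j < n" for i j
    using P(1) that arg_cong[OF P(2), of "\<lambda>M. M $$ (i, j)"]
    by (simp add: u_def scalar_prod_def atLeast0LessThan)
  have 3: "(\<Sum>i<n. u i k * u i l) = (if k = l then 1 else 0)" if "k < n" "l < n" for k l
    using P(1) that arg_cong[OF PP, of "\<lambda>M. M $$ (k, l)"]
    by (simp add: u_def scalar_prod_def atLeast0LessThan)
  have "A = A * (P * transpose_mat P)" using A by (simp add: PP)
  also have "\<dots> = P * mat_diag n lam * transpose_mat P"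
    using A P PT by (simp flip: assoc_mult_mat)
  finally have "similar_mat A (mat_diag n lam)"
    using A P PT PP by (intro similar_matI[of _ _ P "transpose_mat P" n]) auto
  then have "char_poly A = char_poly (mat_diag n lam)" by (rule char_poly_similar)
  also have "\<dots> = (\<Prod>a\<leftarrow>diag_mat (mat_diag n lam). [:- a, 1:])"
    by (rule char_poly_upper_triangular[of _ n]) (auto simp: mat_diag_def)
  also have "diag_mat (mat_diag n lam) = map lam [0..<n]"
    by (simp add: diag_mat_def mat_diag_def)
  finally have cp: "char_poly A = (\<Prod>a\<leftarrow>map lam [0..<n]. [:- a, 1:])" .
  have nz: "(\<Prod>a\<leftarrow>es. [:- a, 1:]) \<noteq> 0" for es :: "real list"
    by (auto simp: prod_list_zero_iff)
  have "proots (\<Prod>a\<leftarrow>es. [:- a, 1:]) = mset es" for es :: "real list"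
  proof (induction es)
    case (Cons a es)
    have "proots ([:- a, 1:] * (\<Prod>a\<leftarrow>es. [:- a, 1:]))
        = proots [:- a, 1:] + proots (\<Prod>a\<leftarrow>es. [:- a, 1:])"
      by (rule proots_mult) (use nz in auto)
    then show ?case using Cons by (simp del: mult_pCons_left mult_pCons_right)
  qed simp
  then have 4: "proots (char_poly A) = mset (map lam [0..<n])" unfolding cp .
  show thesis using that[OF 1 2 3 4] by blast
qed

text \<open>Finds the one index \<open>i0\<close> to be set aside: sorting permutes positions, and
  every index other than the one sent to the front lands at rank 1 or later. Ties do no harm, since
  positions rather than values are distinguished.\<close>

lemma second_in_descending_list:
  fixes es :: "real list"
  assumes n: "length es = n" "n \<ge> 2"
  obtains i0 i1 where "i0 < n" "i1 < n" "i1 \<noteq> i0" "es ! i1 = rev (sort es) ! 1"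
    "\<And>i. i < n \<Longrightarrow> i \<noteq> i0 \<Longrightarrow> es ! i \<le> rev (sort es) ! 1"
proof -
  let ?l = "rev (sort es)"
  have "mset es = mset ?l" by simp
  then obtain \<pi> where \<pi>: "\<pi> permutes {..<length ?l}" "permute_list \<pi> ?l = es"
    by (rule mset_eq_permutation)
  have nth: "es ! i = ?l ! \<pi> i" if "i < n" for i
    using permute_list_nth[OF \<pi>(1), of i] \<pi>(2) that n by simp
  have \<pi>n: "\<pi> i < n \<longleftrightarrow> i < n" for i using permutes_in_image[OF \<pi>(1), of i] n by simp
  obtain i0 i1 where i: "\<pi> i0 = 0" "\<pi> i1 = 1" using permutes_surj[OF \<pi>(1)] by (metis surjD)
  then have "i0 < n" "i1 < n" "i1 \<noteq> i0" using \<pi>n[of i0] \<pi>n[of i1] n by auto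
  moreover have "es ! i \<le> ?l ! 1" if "i < n" "i \<noteq> i0" for i
  proof -
    have "\<pi> i \<noteq> 0" using that i permutes_inj[OF \<pi>(1)] by (metis injD)
    then have "?l ! \<pi> i \<le> ?l ! 1" using \<pi>n[of i] that n by (intro sorted_rev_nth_mono) auto
    then show ?thesis using nth that by simp
  qed
  ultimately show thesis using that nth i by metis
qed

section \<open>Accelerated gossip\<close>

text \<open>Trades the natural rate \<open>1 / (1 + t)\<close> for the form that occurs in \<rho>.
  Both sides agree at \<open>t = 0\<close> and at \<open>t = 1\<close>, which explains the constant
  \<open>1 - 1 / sqrt 2\<close>. After multiplication by \<open>1 + t\<close> the difference is a
  cubic with factor \<open>t * (1 - t)\<close>, and the linear factor left over is positive at both
  ends.\<close>

lemma inverse_one_plus_le_square: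
  fixes t :: real
  assumes "0 \<le> t" "t \<le> 1"
  shows "1 / (1 + t) \<le> (1 - (1 - 1 / sqrt 2) * t)\<^sup>2"
proof -
  define r where "r = sqrt 2"
  have r2: "r * r = 2" and r: "1 \<le> r" by (simp_all add: r_def)
  have rh: "1 / r = r / 2" using r2 r by (simp add: field_simps)
  have r3: "r \<le> 3 / 2" unfolding r_def by (rule real_le_lsqrt) (auto simp: power2_eq_square)
  have r4: "r \<ge> 5 / 4" unfolding r_def by (rule real_le_rsqrt) (auto simp: power2_eq_square)
  \<comment> \<open>The last summand vanishes for \<open>r = sqrt 2\<close>; with it the equation is
    an identity in a free \<open>r\<close>.\<close>
  have "(1 - (1 - r / 2) * t)\<^sup>2 * (1 + t) - 1
      = t * ((1 - t) * ((r - 1) - (3 / 2 - r) * t)) + (r * r - 2) * t\<^sup>2 * (1 + t) / 4"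
    by (simp add: power2_eq_square algebra_simps) (simp add: field_simps)
  moreover have "t * ((1 - t) * ((r - 1) - (3 / 2 - r) * t)) \<ge> 0"
  proof -
    have "(3 / 2 - r) * t \<le> (3 / 2 - r) * 1" using assms r3 by (intro mult_left_mono) auto
    then show ?thesis using assms r4 by (intro mult_nonneg_nonneg) auto
  qed
  ultimately have "1 \<le> (1 - (1 - r / 2) * t)\<^sup>2 * (1 + t)" using r2 by simp
  then show ?thesis using assms by (simp add: rh flip: r_def) (simp add: field_simps)
qed

(* The quadratic form y(k+1)^2 - a y(k+1) y(k) + eta y(k)^2, with a = (1 + eta) lam, is multiplied
   by exactly eta in every step. *)
lemma accelerated_recurrence_bound:
  fixes y :: "nat \<Rightarrow> real"
  assumes l: "0 \<le> lam" "lam \<le> l2" "l2 < 1"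
    and \<eta>: "\<eta> = 1 / (1 + sqrt (1 - l2\<^sup>2))"
    and y1: "y 1 = (1 + \<eta>) * lam * y 0 - \<eta> * y 0"
    and rec: "\<And>k. y (Suc (Suc k)) = (1 + \<eta>) * lam * y (Suc k) - \<eta> * y k"
  shows "(y k)\<^sup>2 \<le> 14 * ((1 - (1 - 1 / sqrt 2) * sqrt (1 - l2)) ^ k)\<^sup>2 * (y 0)\<^sup>2"
proof -
  define s where "s = sqrt (1 - l2\<^sup>2)"
  have l2: "l2\<^sup>2 \<le> l2" "l2 \<ge> 0" using l by (auto simp: power2_eq_square mult_left_le)
  then have s: "s \<ge> 0" "s\<^sup>2 = 1 - l2\<^sup>2" using l by (auto simp: s_def)
  have \<eta>s: "\<eta> = 1 / (1 + s)" using \<eta> by (simp add: s_def)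
  have \<eta>0: "\<eta> > 0" using s by (simp add: \<eta>s)
  define a where "a = (1 + \<eta>) * lam"
  define Q where "Q k = (y (Suc k))\<^sup>2 - a * y (Suc k) * y k + \<eta> * (y k)\<^sup>2" for k
  have "Q k = \<eta> ^ (Suc k) * (1 + \<eta> - a) * (y 0)\<^sup>2" for k
  proof (induction k)
    case 0
    have y1': "y (Suc 0) = (a - \<eta>) * y 0" using y1 by (simp add: a_def algebra_simps)
    show ?case unfolding Q_def y1' by (simp add: power2_eq_square algebra_simps)
  next
    case (Suc k)
    have "Q (Suc k) = \<eta> * Q k"
      unfolding Q_def rec[folded a_def] by (simp add: power2_eq_square algebra_simps)
    then show ?case using Suc by simp
  qed
  moreover have "Q k \<ge> (\<eta> - a\<^sup>2 / 4) * (y k)\<^sup>2"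
  proof -
    have "Q k - (\<eta> - a\<^sup>2 / 4) * (y k)\<^sup>2 = (y (Suc k) - a / 2 * y k)\<^sup>2"
      by (simp add: Q_def power2_eq_square algebra_simps)
    then show ?thesis by (metis diff_ge_0_iff_ge zero_le_power2)
  qed
  ultimately have main: "(\<eta> - a\<^sup>2 / 4) * (y k)\<^sup>2 \<le> \<eta> ^ k * (\<eta> * (1 + \<eta> - a)) * (y 0)\<^sup>2"
    by (simp add: mult.assoc mult.left_commute)
  \<comment> \<open>It remains to bound the ratio of \<open>\<eta> * (1 + \<eta> - a)\<close> to
    \<open>\<eta> - a^2 / 4\<close> uniformly in \<open>lam\<close>. Multiplying both by
    \<open>(1 + s)^2\<close> clears all denominators. The first becomes
    \<open>(2 + s) * (1 - lam)\<close> and the second at least \<open>3 / 8\<close> of it, so the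
    ratio is at most \<open>8 / 3\<close> even for \<open>lam\<close> close to 1.\<close>
  have \<eta>1: "\<eta> * (1 + s) = 1" using s by (simp add: \<eta>s)
  have "a * (1 + s) = ((1 + s) + \<eta> * (1 + s)) * lam" by (simp add: a_def algebra_simps)
  then have a1: "a * (1 + s) = (2 + s) * lam" unfolding \<eta>1 by simp
  have "\<eta> * (1 + \<eta> - a) * (1 + s)\<^sup>2 = \<eta> * (1 + s) * ((1 + s) + \<eta> * (1 + s) - a * (1 + s))"
    by (simp add: power2_eq_square algebra_simps)
  then have eq1: "\<eta> * (1 + \<eta> - a) * (1 + s)\<^sup>2 = (2 + s) * (1 - lam)"
    unfolding \<eta>1 a1 by (simp add: algebra_simps)
  have "(\<eta> - a\<^sup>2 / 4) * (1 + s)\<^sup>2 = \<eta> * (1 + s) * (1 + s) - (a * (1 + s))\<^sup>2 / 4"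
    by (simp add: power2_eq_square algebra_simps)
  then have eq2: "(\<eta> - a\<^sup>2 / 4) * (1 + s)\<^sup>2 = ((2 + s)\<^sup>2 * (1 - lam\<^sup>2) - s\<^sup>2) / 4"
    unfolding \<eta>1 a1 by (simp add: power2_eq_square field_simps)
  \<comment> \<open>The momentum is tuned to \<open>l2\<close>; \<open>lam \<le> l2\<close> is what
    keeps the quadratic form positive definite.\<close>
  have "s\<^sup>2 \<le> 1 - lam\<^sup>2" using l s by (simp add: power_mono)
  then have "(2 + s)\<^sup>2 * (1 - lam\<^sup>2) - s\<^sup>2 \<ge> ((2 + s)\<^sup>2 - 1) * (1 - lam\<^sup>2)" by (simp add: algebra_simps)
  moreover have "((2 + s)\<^sup>2 - 1) * (1 - lam\<^sup>2) \<ge> (3 / 2 * (2 + s)) * (1 - lam)"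
  proof (rule mult_mono)
    show "3 / 2 * (2 + s) \<le> (2 + s)\<^sup>2 - 1" using s by (simp add: power2_eq_square algebra_simps)
    show "1 - lam \<le> 1 - lam\<^sup>2" using l by (simp add: power2_eq_square mult_left_le)
    show "0 \<le> (2 + s)\<^sup>2 - 1" using s by (simp add: power2_eq_square algebra_simps)
  qed (use l in auto)
  ultimately have "(2 + s)\<^sup>2 * (1 - lam\<^sup>2) - s\<^sup>2 \<ge> 3 / 2 * ((2 + s) * (1 - lam))"
    unfolding mult.assoc[symmetric] by (rule order_trans[rotated])
  moreover have "3 / 2 * X \<le> Y \<Longrightarrow> 3 / 8 * X \<le> Y / 4" for X Y :: real by simp
  ultimately have key: "(\<eta> - a\<^sup>2 / 4) * (1 + s)\<^sup>2 \<ge> 3 / 8 * ((2 + s) * (1 - lam))"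
    unfolding eq2 by blast
  have posl: "(2 + s) * (1 - lam) > 0" using s l by simp
  have S: "(1 + s)\<^sup>2 > 0" using s by simp
  have "(\<eta> - a\<^sup>2 / 4) * (1 + s)\<^sup>2 > 0" using key posl by linarith
  then have pos: "\<eta> - a\<^sup>2 / 4 > 0" using S by (simp add: zero_less_mult_iff)
  have "\<eta> * (1 + \<eta> - a) * (1 + s)\<^sup>2 \<le> (8 / 3 * (\<eta> - a\<^sup>2 / 4)) * (1 + s)\<^sup>2"
    using key eq1 by linarith
  then have le: "\<eta> * (1 + \<eta> - a) \<le> 8 / 3 * (\<eta> - a\<^sup>2 / 4)" using S by (metis mult_le_cancel_right_pos)
  note main
  also have "\<eta> ^ k * (\<eta> * (1 + \<eta> - a)) * (y 0)\<^sup>2 \<le> \<eta> ^ k * (8 / 3 * (\<eta> - a\<^sup>2 / 4)) * (y 0)\<^sup>2"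
    using \<eta>0 le by (intro mult_right_mono mult_left_mono) auto
  also have "\<dots> = (\<eta> - a\<^sup>2 / 4) * (8 / 3 * \<eta> ^ k * (y 0)\<^sup>2)" by (simp only: ac_simps)
  finally have "(\<eta> - a\<^sup>2 / 4) * (y k)\<^sup>2 \<le> (\<eta> - a\<^sup>2 / 4) * (8 / 3 * \<eta> ^ k * (y 0)\<^sup>2)" .
  then have b1: "(y k)\<^sup>2 \<le> 8 / 3 * \<eta> ^ k * (y 0)\<^sup>2" using pos by (metis mult_le_cancel_left_pos)
  define t where "t = sqrt (1 - l2)"
  have t: "0 \<le> t" "t \<le> 1" using l l2 by (auto simp: t_def)
  have "t \<le> s" unfolding t_def s_def using l2 by simp
  then have "\<eta> \<le> 1 / (1 + t)" unfolding \<eta>s using t by (intro divide_left_mono) auto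
  also have "\<dots> \<le> (1 - (1 - 1 / sqrt 2) * t)\<^sup>2" by (rule inverse_one_plus_le_square[OF t])
  finally have "\<eta> ^ k \<le> ((1 - (1 - 1 / sqrt 2) * t)\<^sup>2) ^ k" using \<eta>0 by (intro power_mono) auto
  also have "\<dots> = ((1 - (1 - 1 / sqrt 2) * t) ^ k)\<^sup>2" by (simp add: power_mult[symmetric] mult.commute)
  finally have "\<eta> ^ k \<le> ((1 - (1 - 1 / sqrt 2) * t) ^ k)\<^sup>2" .
  then have "8 / 3 * \<eta> ^ k * (y 0)\<^sup>2 \<le> 14 * ((1 - (1 - 1 / sqrt 2) * t) ^ k)\<^sup>2 * (y 0)\<^sup>2"
    by (intro mult_right_mono mult_mono) (use \<eta>0 in auto)
  with b1 show ?thesis unfolding t_def by (rule order_trans)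
qed

definition col_sum :: "nat \<Rightarrow> real mat \<Rightarrow> nat \<Rightarrow> real" where
  "col_sum n A j = (\<Sum>i<n. A $$ (i, j))"

text \<open>The squared Frobenius distance to the matrix whose rows all equal the mean row, arranged
  by columns because \<open>W\<close> acts on each column separately.\<close>

definition dev :: "nat \<Rightarrow> nat \<Rightarrow> real mat \<Rightarrow> real" where
  "dev n d A = (\<Sum>j<d. \<Sum>i<n. (A $$ (i, j) - col_sum n A j / real n)\<^sup>2)"

text \<open>The column sums of \<open>W\<close> are 1, so the entries of an eigenvector satisfy
  \<open>(1 - lam i) * sum = 0\<close>, and every eigenvector except \<open>u i0\<close> is
  orthogonal to the all-ones vector. That vector is thus a multiple of \<open>u i0\<close>, and
  subtracting the mean of \<open>y\<close> amounts to dropping the coefficient at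
  \<open>i0\<close>.\<close>

lemma mixing_matrix_eigenbasis:
  assumes W: "mixing_matrix n E W" and n: "n \<ge> 1" and l2: "lambda2 W < 1"
  obtains u :: "nat \<Rightarrow> nat \<Rightarrow> real" and lam :: "nat \<Rightarrow> real" and i0
  where "\<And>i k. i < n \<Longrightarrow> k < n \<Longrightarrow> (\<Sum>l<n. W $$ (k, l) * u i l) = lam i * u i k"
    and "\<And>i. i < n \<Longrightarrow> i \<noteq> i0 \<Longrightarrow> 0 \<le> lam i \<and> lam i \<le> lambda2 W"
    and "\<And>y :: nat \<Rightarrow> real. (\<Sum>k<n. (y k - (\<Sum>l<n. y l) / real n)\<^sup>2)
        = (\<Sum>i\<in>{..<n} - {i0}. (\<Sum>l<n. u i l * y l)\<^sup>2)"
proof -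
  have Wc: "W \<in> carrier_mat n n" and sym: "transpose_mat W = W"
    and W1: "W *\<^sub>v vec n (\<lambda>_. 1) = vec n (\<lambda>_. 1)" and psd: "pos_semidef W"
    using W by (auto simp: mixing_matrix_def)
  obtain u lam where ev: "\<And>i k. i < n \<Longrightarrow> k < n \<Longrightarrow> (\<Sum>l<n. W $$ (k, l) * u i l) = lam i * u i k"
    and orth: "\<And>i j. i < n \<Longrightarrow> j < n \<Longrightarrow> (\<Sum>k<n. u i k * u j k) = (if i = j then 1 else 0)"
    and compl: "\<And>k l. k < n \<Longrightarrow> l < n \<Longrightarrow> (\<Sum>i<n. u i k * u i l) = (if k = l then 1 else 0)"
    and roots: "proots (char_poly W) = mset (map lam [0..<n])"
    by (rule orthonormal_eigenbasis[OF Wc sym]) blast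
  have nonneg: "0 \<le> lam i" if "i < n" for i
  proof -
    let ?v = "vec n (u i)"
    have "0 \<le> ?v \<bullet> (W *\<^sub>v ?v)" using psd Wc unfolding pos_semidef_def by auto
    also have "?v \<bullet> (W *\<^sub>v ?v) = (\<Sum>k<n. u i k * (\<Sum>l<n. W $$ (k, l) * u i l))"
      using Wc by (simp add: scalar_prod_def atLeast0LessThan)
    also have "\<dots> = lam i * (\<Sum>k<n. u i k * u i k)"
      using that by (simp add: ev sum_distrib_left mult.left_commute)
    finally show ?thesis using that by (simp add: orth)
  qed
  obtain i0 where i0: "i0 < n" "\<And>i. i < n \<Longrightarrow> i \<noteq> i0 \<Longrightarrow> lam i \<le> lambda2 W"
  proof (cases "n = 1")
    case True
    then show thesis using that[of 0] by auto
  next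
    case False
    define es where "es = map lam [0..<n]"
    have "lambda2 W = rev (sort es) ! 1" 
      using False Wc by (simp add: lambda2_def roots[folded es_def])
    then show thesis using second_in_descending_list[of es n] False n that
      by (auto simp: es_def)
  qed
  have col1: "(\<Sum>k<n. W $$ (k, l)) = 1" if "l < n" for l
  proof -
    have "(W *\<^sub>v vec n (\<lambda>_. 1)) $ l = (\<Sum>k<n. W $$ (l, k))"
      using Wc that by (simp add: scalar_prod_def atLeast0LessThan)
    also have "\<dots> = (\<Sum>k<n. W $$ (k, l))"
      by (intro sum.cong refl) (use Wc that arg_cong[OF sym, of "\<lambda>M. M $$ (_, l)"] in
        \<open>metis carrier_matD index_transpose_mat(1) lessThan_iff sym\<close>)
    finally show ?thesis using W1 that by simp
  qed
  have usum: "(\<Sum>l<n. u i l) = 0" if i: "i < n" "i \<noteq> i0" for i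
  proof -
    have "lam i * (\<Sum>k<n. u i k) = (\<Sum>k<n. \<Sum>l<n. W $$ (k, l) * u i l)"
      using i by (simp add: ev sum_distrib_left)
    also have "\<dots> = (\<Sum>l<n. \<Sum>k<n. W $$ (k, l) * u i l)" by (rule sum.swap)
    also have "\<dots> = (\<Sum>l<n. u i l)" by (simp add: col1 sum_distrib_right[symmetric])
    finally have "(1 - lam i) * (\<Sum>k<n. u i k) = 0" by (simp add: algebra_simps)
    then show ?thesis using i0(2)[OF i] l2 by simp
  qed
  have expand: "(\<Sum>i<n. (\<Sum>l<n. u i l * z l) * u i k) = z k" if "k < n" for k and z :: "nat \<Rightarrow> real"
  proof -
    have "(\<Sum>i<n. (\<Sum>l<n. u i l * z l) * u i k) = (\<Sum>i<n. \<Sum>l<n. z l * (u i l * u i k))"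
      by (simp add: sum_distrib_right sum_distrib_left ac_simps)
    also have "\<dots> = (\<Sum>l<n. z l * (\<Sum>i<n. u i l * u i k))"
      by (subst sum.swap) (simp add: sum_distrib_left)
    also have "\<dots> = z k" using that by (simp add: compl if_distrib[of "\<lambda>x. _ * x"] cong: if_cong)
    finally show ?thesis .
  qed
  have parseval: "(\<Sum>k<n. z k * x k) = (\<Sum>i<n. (\<Sum>l<n. u i l * z l) * (\<Sum>l<n. u i l * x l))"
    for z x :: "nat \<Rightarrow> real"
  proof -
    have "(\<Sum>k<n. z k * x k) = (\<Sum>k<n. (\<Sum>i<n. (\<Sum>l<n. u i l * z l) * u i k) * x k)"
      by (simp add: expand)
    also have "\<dots> = (\<Sum>i<n. \<Sum>k<n. (\<Sum>l<n. u i l * z l) * (u i k * x k))"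
      by (subst sum.swap) (simp add: sum_distrib_right mult.assoc)
    finally show ?thesis by (simp add: sum_distrib_left)
  qed
  \<comment> \<open>Otherwise the all-ones vector would be orthogonal to the whole basis, and
    Parseval would give \<open>n = 0\<close>.\<close>
  have u0: "(\<Sum>l<n. u i0 l) \<noteq> 0"
  proof
    assume "(\<Sum>l<n. u i0 l) = 0"
    then have "(\<Sum>l<n. u i l) = 0" if "i < n" for i using usum that by (cases "i = i0") auto
    then have "(\<Sum>k<n. 1 * (1 :: real)) = 0" by (subst parseval) simp
    then show False using n by simp
  qed
  have dev: "(\<Sum>k<n. (y k - (\<Sum>l<n. y l) / real n)\<^sup>2) = (\<Sum>i\<in>{..<n} - {i0}. (\<Sum>l<n. u i l * y l)\<^sup>2)"
    for y :: "nat \<Rightarrow> real"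
  proof -
    define m where "m = (\<Sum>l<n. y l) / real n"
    define z where "z k = y k - m" for k
    have uz: "(\<Sum>l<n. u i l * z l) = (\<Sum>l<n. u i l * y l)" if "i \<in> {..<n} - {i0}" for i
      using usum that by (simp add: z_def right_diff_distrib sum_subtractf sum_distrib_right[symmetric])
    \<comment> \<open>Parseval reduces the product of \<open>z\<close> with the all-ones vector to
      its \<open>i0\<close> term, so the coefficient of \<open>z\<close> at \<open>i0\<close> must
      vanish.\<close>
    have "(\<Sum>k<n. z k) = 0" using n by (simp add: z_def m_def sum_subtractf)
    then have "0 = (\<Sum>k<n. 1 * z k)" by simp
    also have "\<dots> = (\<Sum>i<n. (\<Sum>l<n. u i l) * (\<Sum>l<n. u i l * z l))" by (subst parseval) simp
    also have "\<dots> = (\<Sum>l<n. u i0 l) * (\<Sum>l<n. u i0 l * z l)"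
      using i0(1) usum by (subst sum.remove[of _ i0]) auto
    finally have uz0: "(\<Sum>l<n. u i0 l * z l) = 0" using u0 by simp
    have "(\<Sum>k<n. (z k)\<^sup>2) = (\<Sum>i<n. (\<Sum>l<n. u i l * z l)\<^sup>2)"
      unfolding power2_eq_square by (rule parseval)
    also have "\<dots> = (\<Sum>i\<in>{..<n} - {i0}. (\<Sum>l<n. u i l * z l)\<^sup>2)"
      using i0(1) uz0 by (subst sum.remove[of _ i0]) auto
    also have "\<dots> = (\<Sum>i\<in>{..<n} - {i0}. (\<Sum>l<n. u i l * y l)\<^sup>2)"
      by (intro sum.cong refl) (simp only: uz)
    finally show ?thesis by (simp add: z_def m_def)
  qed
  show thesis by (rule that[OF ev _ dev]) (use i0(2) nonneg in auto)
qed

lemma acc_gossip_0: "acc_gossip Y W 0 = Y"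
  by (simp add: acc_gossip_def)

lemma acc_gossip_1:
  "acc_gossip Y W (Suc 0) = (1 + 1 / (1 + sqrt (1 - (lambda2 W)\<^sup>2))) \<cdot>\<^sub>m (W * Y)
     - (1 / (1 + sqrt (1 - (lambda2 W)\<^sup>2))) \<cdot>\<^sub>m Y"
  by (simp add: acc_gossip_def Let_def)

lemma acc_gossip_Suc_Suc:
  "acc_gossip Y W (Suc (Suc k)) =
     (1 + 1 / (1 + sqrt (1 - (lambda2 W)\<^sup>2))) \<cdot>\<^sub>m (W * acc_gossip Y W (Suc k))
     - (1 / (1 + sqrt (1 - (lambda2 W)\<^sup>2))) \<cdot>\<^sub>m acc_gossip Y W k"
  by (simp add: acc_gossip_def Let_def case_prod_beta)

lemma acc_gossip_carrier [simp]:
  assumes "W \<in> carrier_mat n n" "Y \<in> carrier_mat n d"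
  shows "acc_gossip Y W k \<in> carrier_mat n d"
  using assms
  by (induction k rule: induct_nat_012) (simp_all add: acc_gossip_0 acc_gossip_1 acc_gossip_Suc_Suc
      minus_carrier_mat)

text \<open>By symmetry of \<open>W\<close>, pairing with an eigenvector replaces \<open>W\<close>
  by its eigenvalue, so each column of the iterates obeys a scalar three-term recurrence. The first
  step has its own form because the iteration starts from two equal matrices.\<close>

lemma acc_gossip_component:
  fixes \<eta> :: real
  assumes W: "W \<in> carrier_mat n n" "transpose_mat W = W" and Y: "Y \<in> carrier_mat n d" and j: "j < d"
    and \<eta>: "\<eta> = 1 / (1 + sqrt (1 - (lambda2 W)\<^sup>2))"
    and ev: "\<And>k. k < n \<Longrightarrow> (\<Sum>l<n. W $$ (k, l) * u l) = lam * u k"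
  defines "y \<equiv> \<lambda>k. \<Sum>l<n. u l * acc_gossip Y W k $$ (l, j)"
  shows "y 1 = (1 + \<eta>) * lam * y 0 - \<eta> * y 0"
    and "y (Suc (Suc k)) = (1 + \<eta>) * lam * y (Suc k) - \<eta> * y k"
proof -
  have WZ: "(\<Sum>l<n. u l * (W * Z) $$ (l, j)) = lam * (\<Sum>l<n. u l * Z $$ (l, j))"
    if Z: "Z \<in> carrier_mat n d" for Z
  proof -
    have Wsym: "W $$ (l, m) = W $$ (m, l)" if "l < n" "m < n" for l m
      using W that by (metis carrier_matD index_transpose_mat(1))
    have "(\<Sum>l<n. u l * (W * Z) $$ (l, j)) = (\<Sum>l<n. \<Sum>m<n. (W $$ (l, m) * u l) * Z $$ (m, j))"
      using W Z j by (simp add: scalar_prod_def atLeast0LessThan sum_distrib_left ac_simps)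
    also have "\<dots> = (\<Sum>m<n. \<Sum>l<n. (W $$ (m, l) * u l) * Z $$ (m, j))"
      by (subst sum.swap) (simp add: Wsym)
    also have "\<dots> = (\<Sum>m<n. (lam * u m) * Z $$ (m, j))"
      by (simp add: ev sum_distrib_right[symmetric])
    finally show ?thesis by (simp add: sum_distrib_left mult.assoc)
  qed
  have step: "(\<Sum>l<n. u l * (c \<cdot>\<^sub>m (W * Z) - e \<cdot>\<^sub>m Z') $$ (l, j))
      = c * lam * (\<Sum>l<n. u l * Z $$ (l, j)) - e * (\<Sum>l<n. u l * Z' $$ (l, j))"
    if Z: "Z \<in> carrier_mat n d" and Z': "Z' \<in> carrier_mat n d" for Z Z' :: "real mat" and c e :: real
  proof -
    have "(\<Sum>l<n. u l * (c \<cdot>\<^sub>m (W * Z) - e \<cdot>\<^sub>m Z') $$ (l, j))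
        = (\<Sum>l<n. c * (u l * (W * Z) $$ (l, j)) - e * (u l * Z' $$ (l, j)))"
      by (intro sum.cong refl) (use W Z Z' j in \<open>auto simp: algebra_simps\<close>)
    then show ?thesis by (simp add: sum_subtractf sum_distrib_left[symmetric] WZ[OF Z])
  qed
  note c = acc_gossip_carrier[OF W(1) Y]
  show "y 1 = (1 + \<eta>) * lam * y 0 - \<eta> * y 0"
    unfolding y_def using step[OF Y Y] by (simp add: acc_gossip_1 acc_gossip_0 \<eta>)
  show "y (Suc (Suc k)) = (1 + \<eta>) * lam * y (Suc k) - \<eta> * y k"
    unfolding y_def acc_gossip_Suc_Suc \<eta> by (rule step[OF c c])
qed

text \<open>The all-ones vector is an eigenvector for the eigenvalue 1, and with
  \<open>lam = 1\<close> the coefficients of the recurrence sum to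
  \<open>(1 + \<eta>) - \<eta> = 1\<close>, so the sequence is constant.\<close>

lemma col_sum_acc_gossip:
  assumes W: "mixing_matrix n E W" and Y: "Y \<in> carrier_mat n d" and j: "j < d"
  shows "col_sum n (acc_gossip Y W k) j = col_sum n Y j"
proof -
  have Wc: "W \<in> carrier_mat n n" and sym: "transpose_mat W = W"
    and W1: "W *\<^sub>v vec n (\<lambda>_. 1) = vec n (\<lambda>_. 1)"
    using W by (auto simp: mixing_matrix_def)
  have row1: "(\<Sum>l<n. W $$ (k, l) * 1) = 1 * 1" if "k < n" for k
  proof -
    have "(W *\<^sub>v vec n (\<lambda>_. 1)) $ k = (\<Sum>l<n. W $$ (k, l))"
      using Wc that by (simp add: scalar_prod_def atLeast0LessThan)
    then show ?thesis using W1 that by simp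
  qed
  note rec = acc_gossip_component[OF Wc sym Y j refl row1]
  show ?thesis
  proof (induction k rule: induct_nat_012)
    case 1
    then show ?case using rec(1) by (simp add: acc_gossip_0 col_sum_def algebra_simps)
  next
    case (ge2 k)
    then show ?case using rec(2)[of k] by (simp add: col_sum_def algebra_simps)
  qed (simp add: acc_gossip_0)
qed

lemma dev_acc_gossip_le:
  assumes W: "mixing_matrix n E W" and n: "n \<ge> 1" and l2: "lambda2 W < 1" and Y: "Y \<in> carrier_mat n d"
  shows "dev n d (acc_gossip Y W k)
    \<le> (sqrt 14 * (1 - (1 - 1 / sqrt 2) * sqrt (1 - lambda2 W)) ^ k)\<^sup>2 * dev n d Y"
proof -
  have Wc: "W \<in> carrier_mat n n" and sym: "transpose_mat W = W"
    using W by (auto simp: mixing_matrix_def)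
  define R where "R = (1 - (1 - 1 / sqrt 2) * sqrt (1 - lambda2 W)) ^ k"
  obtain u lam i0 where ev: "\<And>i k. i < n \<Longrightarrow> k < n \<Longrightarrow> (\<Sum>l<n. W $$ (k, l) * u i l) = lam i * u i k"
    and lam: "\<And>i. i < n \<Longrightarrow> i \<noteq> i0 \<Longrightarrow> 0 \<le> lam i \<and> lam i \<le> lambda2 W"
    and dev: "\<And>y :: nat \<Rightarrow> real. (\<Sum>k<n. (y k - (\<Sum>l<n. y l) / real n)\<^sup>2)
        = (\<Sum>i\<in>{..<n} - {i0}. (\<Sum>l<n. u i l * y l)\<^sup>2)"
    by (rule mixing_matrix_eigenbasis[OF W n l2]) blast
  have dev': "dev n d A = (\<Sum>j<d. \<Sum>i\<in>{..<n} - {i0}. (\<Sum>l<n. u i l * A $$ (l, j))\<^sup>2)" for A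
    unfolding dev_def col_sum_def dev ..
  have "(\<Sum>l<n. u i l * acc_gossip Y W k $$ (l, j))\<^sup>2 \<le> 14 * R\<^sup>2 * (\<Sum>l<n. u i l * Y $$ (l, j))\<^sup>2"
    if i: "i \<in> {..<n} - {i0}" and j: "j < d" for i j
  proof -
    have i': "i < n" using i by simp
    note rec = acc_gossip_component[OF Wc sym Y j refl ev[OF i']]
    show ?thesis
      using accelerated_recurrence_bound[OF _ _ l2 refl rec, of k] lam[of i] i
      unfolding R_def acc_gossip_0 by auto
  qed
  then have "dev n d (acc_gossip Y W k) \<le> (\<Sum>j<d. \<Sum>i\<in>{..<n} - {i0}. 14 * R\<^sup>2 * (\<Sum>l<n. u i l * Y $$ (l, j))\<^sup>2)"
    unfolding dev' by (intro sum_mono) auto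
  also have "\<dots> = 14 * R\<^sup>2 * dev n d Y" unfolding dev' by (simp add: sum_distrib_left)
  finally show ?thesis by (simp add: R_def power_mult_distrib)
qed

section \<open>Multinomial sampling\<close>

text \<open>All distributions of a run have finite support, so expectations are finite sums and
  integrability never becomes an issue.\<close>

lemma expectation_bind_finite:
  fixes g :: "'b \<Rightarrow> real"
  assumes "finite (set_pmf p)" "\<And>x. x \<in> set_pmf p \<Longrightarrow> finite (set_pmf (f x))"
  shows "measure_pmf.expectation (bind_pmf p f) g
    = measure_pmf.expectation p (\<lambda>x. measure_pmf.expectation (f x) g)"
  using assms
  by (subst pmf_expectation_bind[of "set_pmf p"]) (auto simp: integral_measure_pmf[of "set_pmf p"])

lemma expectation_mono_finite:
  fixes f g :: "'a \<Rightarrow> real"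
  assumes "finite (set_pmf p)" "\<And>x. x \<in> set_pmf p \<Longrightarrow> f x \<le> g x"
  shows "measure_pmf.expectation p f \<le> measure_pmf.expectation p g"
  using assms by (auto simp: integral_measure_pmf[of "set_pmf p"] intro!: sum_mono mult_left_mono)

lemma expectation_bernoulli:
  fixes g :: "bool \<Rightarrow> real"
  assumes "0 \<le> p" "p \<le> 1"
  shows "measure_pmf.expectation (bernoulli_pmf p) g = p * g True + (1 - p) * g False"
  using assms by (simp add: integral_bernoulli_pmf)

text \<open>The total mass is 1 because \<open>q = 1 / n\<close>. This gives
  \<open>multinomial_pmf\<close> its meaning: counts of \<open>b\<close> independent uniform
  draws.\<close>

lemma embed_pmf_uniform:
  assumes "n \<ge> 1"
  shows "embed_pmf (\<lambda>i. if i < n then 1 / real n else 0) = pmf_of_set {..<n}"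
proof (rule pmf_eqI)
  fix i
  have "(\<integral>\<^sup>+ i. ennreal (if i < n then 1 / real n else 0) \<partial>count_space UNIV)
      = (\<Sum>i<n. ennreal (if i < n then 1 / real n else 0))"
    by (rule nn_integral_count_space') auto
  also have "\<dots> = ennreal (\<Sum>i<n. 1 / real n)" by (subst sum_ennreal[symmetric]) auto
  also have "\<dots> = 1" using assms by simp
  finally have "pmf (embed_pmf (\<lambda>i. if i < n then 1 / real n else 0)) i = (if i < n then 1 / real n else 0)"
    by (intro pmf_embed_pmf) auto
  then show "pmf (embed_pmf (\<lambda>i. if i < n then 1 / real n else 0)) i = pmf (pmf_of_set {..<n}) i"
    using assms by (subst pmf_of_set) (auto simp: lessThan_empty_iff)
qed

lemma multinomial_pmf_uniform:
  assumes "n \<ge> 1"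
  shows "multinomial_pmf n b (1 / real n)
    = map_pmf (\<lambda>js i. count_list js i) (replicate_pmf b (pmf_of_set {..<n}))"
  by (simp add: multinomial_pmf_def embed_pmf_uniform[OF assms])

lemma set_pmf_uniform:
  fixes n :: nat
  assumes "n \<ge> 1"
  shows "set_pmf (pmf_of_set {..<n}) = {..<n}"
  using assms by (intro set_pmf_of_set) (auto simp: lessThan_empty_iff)

lemma set_replicate_uniform:
  fixes n :: nat
  assumes "n \<ge> 1" "js \<in> set_pmf (replicate_pmf b (pmf_of_set {..<n}))"
  shows "set js \<subseteq> {..<n} \<and> length js = b"
  using assms by (auto simp: set_replicate_pmf set_pmf_uniform lists_eq_set)

lemma finite_replicate_uniform:
  fixes n :: nat
  assumes "n \<ge> 1"
  shows "finite (set_pmf (replicate_pmf b (pmf_of_set {..<n})))"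
  by (rule finite_subset[OF _ finite_lists_length_eq[of "{..<n}" b]])
     (use set_replicate_uniform[OF assms] in auto)

lemma finite_multinomial:
  assumes "n \<ge> 1"
  shows "finite (set_pmf (multinomial_pmf n b (1 / real n)))"
  using finite_replicate_uniform[OF assms] by (simp add: multinomial_pmf_uniform[OF assms])

text \<open>Passes from counts per agent, which are dependent, to a sum over the draws, which are
  independent.\<close>

lemma sum_count_list:
  fixes h :: "nat \<Rightarrow> real"
  assumes "set js \<subseteq> {..<n}"
  shows "(\<Sum>i<n. real (count_list js i) * h i) = sum_list (map h js)"
  using assms
proof (induction js)
  case (Cons x js)
  have "(\<Sum>i<n. real (count_list (x # js) i) * h i)
      = (\<Sum>i<n. real (count_list js i) * h i + (if i = x then h i else 0))"
    by (intro sum.cong refl) (auto simp: algebra_simps)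
  also have "\<dots> = (\<Sum>i<n. real (count_list js i) * h i) + h x"
    using Cons.prems by (simp add: sum.distrib)
  finally show ?case using Cons by simp
qed simp

lemma sum_multinomial:
  assumes n: "n \<ge> 1" and "\<xi> \<in> set_pmf (multinomial_pmf n b (1 / real n))"
  shows "(\<Sum>i<n. \<xi> i) = b"
proof -
  obtain js where js: "js \<in> set_pmf (replicate_pmf b (pmf_of_set {..<n}))" "\<xi> = count_list js"
    using assms(2) by (auto simp: multinomial_pmf_uniform[OF n])
  have "(\<Sum>i<n. real (count_list js i) * 1) = real b"
    using set_replicate_uniform[OF n js(1)] by (subst sum_count_list) (auto simp: sum_list_triv)
  then have "real (\<Sum>i<n. \<xi> i) = real b" by (simp add: js(2))
  then show ?thesis by linarith
qed

text \<open>The right side exceeds the left by the squared mean of \<open>h\<close>: the variance is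
  bounded by the second moment.\<close>

lemma uniform_second_moment:
  fixes h :: "nat \<Rightarrow> real"
  assumes n: "n \<ge> 1"
  shows "measure_pmf.expectation (pmf_of_set {..<n}) (\<lambda>x. (e + h x)\<^sup>2)
    \<le> (e + (\<Sum>i<n. h i) / real n)\<^sup>2 + (\<Sum>i<n. (h i)\<^sup>2) / real n"
proof -
  have "measure_pmf.expectation (pmf_of_set {..<n}) (\<lambda>x. (e + h x)\<^sup>2) = (\<Sum>i<n. (e + h i)\<^sup>2) / real n"
    using n by (subst integral_pmf_of_set) (auto simp: lessThan_empty_iff)
  also have "(\<Sum>i<n. (e + h i)\<^sup>2) = real n * e\<^sup>2 + 2 * e * (\<Sum>i<n. h i) + (\<Sum>i<n. (h i)\<^sup>2)"
    by (simp add: power2_sum sum.distrib sum_distrib_left mult.assoc)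
  also have "\<dots> / real n = e\<^sup>2 + 2 * e * ((\<Sum>i<n. h i) / real n) + (\<Sum>i<n. (h i)\<^sup>2) / real n"
    using n by (simp add: field_simps)
  finally show ?thesis by (simp add: power2_sum)
qed

text \<open>Independent draws add their variances. The shift \<open>c\<close> is arbitrary because
  the induction moves the first draw into it.\<close>

lemma replicate_uniform_second_moment:
  fixes h :: "nat \<Rightarrow> real"
  assumes n: "n \<ge> 1"
  shows "measure_pmf.expectation (replicate_pmf b (pmf_of_set {..<n})) (\<lambda>js. (c + sum_list (map h js))\<^sup>2)
    \<le> (c + real b * ((\<Sum>i<n. h i) / real n))\<^sup>2 + real b * ((\<Sum>i<n. (h i)\<^sup>2) / real n)"
proof (induction b arbitrary: c)
  case (Suc b)
  let ?U = "pmf_of_set {..<n}" and ?m = "(\<Sum>i<n. h i) / real n" and ?v = "(\<Sum>i<n. (h i)\<^sup>2) / real n"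
  have fU: "finite (set_pmf ?U)" using n by (subst set_pmf_of_set) (auto simp: lessThan_empty_iff)
  note fR = finite_replicate_uniform[OF n]
  have "measure_pmf.expectation (replicate_pmf (Suc b) ?U) (\<lambda>js. (c + sum_list (map h js))\<^sup>2)
    = measure_pmf.expectation ?U (\<lambda>x. measure_pmf.expectation (replicate_pmf b ?U)
        (\<lambda>js. ((c + h x) + sum_list (map h js))\<^sup>2))"
    using fU fR by (simp add: expectation_bind_finite add.assoc)
  also have "\<dots> \<le> measure_pmf.expectation ?U (\<lambda>x. ((c + real b * ?m) + h x)\<^sup>2 + real b * ?v)"
    by (intro expectation_mono_finite fU) (use Suc.IH[of "c + h _"] in \<open>simp add: ac_simps\<close>)
  also have "\<dots> = measure_pmf.expectation ?U (\<lambda>x. ((c + real b * ?m) + h x)\<^sup>2) + real b * ?v"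
    using fU by (subst Bochner_Integration.integral_add) (auto intro: integrable_measure_pmf_finite)
  also have "\<dots> \<le> ((c + real b * ?m) + ?m)\<^sup>2 + ?v + real b * ?v"
    using uniform_second_moment[OF n, of "c + real b * ?m" h] by simp
  also have "\<dots> = (c + real (Suc b) * ?m)\<^sup>2 + real (Suc b) * ?v"
    by (simp add: algebra_simps add_divide_distrib)
  finally show ?case .
qed simp

(* The cross term vanishes because the mini-batch average of h is an unbiased estimate of its mean. *)
lemma multinomial_second_moment:
  fixes h :: "nat \<Rightarrow> real"
  assumes n: "n \<ge> 1" and b: "b \<ge> 1"
  shows "measure_pmf.expectation (multinomial_pmf n b (1 / real n))
      (\<lambda>\<xi>. (a + ((\<Sum>i<n. real (\<xi> i) * h i) / real b - (\<Sum>i<n. h i) / real n))\<^sup>2)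
    \<le> a\<^sup>2 + (\<Sum>i<n. (h i)\<^sup>2) / (real b * real n)"
proof -
  let ?m = "(\<Sum>i<n. h i) / real n" and ?R = "replicate_pmf b (pmf_of_set {..<n})"
  have "measure_pmf.expectation (multinomial_pmf n b (1 / real n))
      (\<lambda>\<xi>. (a + ((\<Sum>i<n. real (\<xi> i) * h i) / real b - ?m))\<^sup>2)
    = measure_pmf.expectation ?R (\<lambda>js. (a + ((\<Sum>i<n. real (count_list js i) * h i) / real b - ?m))\<^sup>2)"
    by (simp add: multinomial_pmf_uniform[OF n])
  also have "\<dots> = measure_pmf.expectation ?R
      (\<lambda>js. (1 / real b)\<^sup>2 * (real b * (a - ?m) + sum_list (map h js))\<^sup>2)"
  proof (intro integral_cong_AE AE_pmfI)
    fix js assume "js \<in> set_pmf ?R"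
    then have "(\<Sum>i<n. real (count_list js i) * h i) = sum_list (map h js)"
      using set_replicate_uniform[OF n] by (intro sum_count_list) auto
    moreover have "a + (S / real b - ?m) = 1 / real b * (real b * (a - ?m) + S)" for S
      using b by (simp add: field_simps)
    ultimately show "(a + ((\<Sum>i<n. real (count_list js i) * h i) / real b - ?m))\<^sup>2
        = (1 / real b)\<^sup>2 * (real b * (a - ?m) + sum_list (map h js))\<^sup>2"
      by (metis power_mult_distrib)
  qed auto
  also have "\<dots> \<le> (1 / real b)\<^sup>2 * ((real b * (a - ?m) + real b * ?m)\<^sup>2 + real b * ((\<Sum>i<n. (h i)\<^sup>2) / real n))"
    using replicate_uniform_second_moment[OF n, of b "real b * (a - ?m)" h]
    by (simp add: mult_left_mono)
  also have "real b * (a - ?m) + real b * ?m = real b * a" by (simp add: algebra_simps)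
  also have "(1 / real b)\<^sup>2 * ((real b * a)\<^sup>2 + real b * ((\<Sum>i<n. (h i)\<^sup>2) / real n))
      = a\<^sup>2 + (\<Sum>i<n. (h i)\<^sup>2) / (real b * real n)"
    using b n by (simp add: power2_eq_square field_simps)
  finally show ?thesis .
qed

section \<open>Contraction of the Lyapunov function\<close>

lemma square_sum2_le: "(x + y)\<^sup>2 \<le> 2 * x\<^sup>2 + 2 * (y :: real)\<^sup>2"
  using zero_le_power2[of "x - y"] by (simp add: power2_eq_square algebra_simps)

lemma square_sum3_le: "(x + y + z)\<^sup>2 \<le> 3 * x\<^sup>2 + 3 * y\<^sup>2 + 3 * (z :: real)\<^sup>2"
  using zero_le_power2[of "x - y"] zero_le_power2[of "x - z"] zero_le_power2[of "y - z"]
  by (simp add: power2_eq_square algebra_simps)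

lemma square_mean_le:
  fixes a :: "nat \<Rightarrow> real"
  shows "((\<Sum>i<n. a i) / real n)\<^sup>2 \<le> (\<Sum>i<n. (a i)\<^sup>2) / real n"
proof (cases "n = 0")
  case False
  have "(\<Sum>i<n. a i)\<^sup>2 \<le> real n * (\<Sum>i<n. (a i)\<^sup>2)"
    using sum_squared_le_sum_of_squares[of a "{..<n}"] by (simp add: mult.commute)
  then show ?thesis using False by (simp add: power2_eq_square field_simps)
qed simp

text \<open>The left side bounds the expected next value: with weight \<open>p\<close> the reset,
  after which \<open>U\<close> and \<open>V\<close> vanish, with weight \<open>1 - p\<close> the
  mini-batch update. \<open>F\<close> is the gap at the mean, \<open>Cx\<close> and
  \<open>Cs\<close> are the deviations of \<open>X\<close> and \<open>S\<close>, a prime marks the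
  next iterate, \<open>DD\<close> is the mean squared change of the local gradients and
  \<open>s2\<close> the squared norm of the mean of \<open>S\<close>. The proof sorts by these
  quantities and checks a budget for each.\<close>

lemma drone_step_arith:
  fixes n b :: nat and L \<mu> \<eta> p R :: real
  assumes n: "n \<ge> 1" and b: "b \<ge> 1" and L: "L > 0" and \<mu>: "\<mu> > 0" and \<eta>: "\<eta> > 0"
    and p: "0 < p" "p \<le> 1" and bp: "1 - p \<le> p * real b"
    and L\<eta>: "20 * (L * \<eta>) \<le> 1" and \<mu>\<eta>: "2 * (\<mu> * \<eta>) \<le> p"
    and R: "R \<ge> 0" "(real n)\<^sup>2 * R \<le> 1 / 200"
    and nonneg: "U \<ge> 0" "V \<ge> 0" "Cx \<ge> 0" "Cs \<ge> 0" "DD \<ge> 0" "s2 \<ge> 0"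
    and D1: "F' \<le> (1 - \<mu> * \<eta>) * F - \<eta> / 2 * (1 - L * \<eta>) * s2 + \<eta> * (L\<^sup>2 * Cx + U)"
    and D2: "DD \<le> 3 * L\<^sup>2 * (Cx' + Cx + \<eta>\<^sup>2 * s2)"
    and D3: "Cx' \<le> 2 * R * (Cx + \<eta>\<^sup>2 * Cs)"
  defines "\<alpha> \<equiv> 2 * \<eta> / p" and "\<beta> \<equiv> 8 * L * R * real n * \<eta>\<^sup>2"
  shows "p * (F' + L * (Cx' + \<eta>\<^sup>2 * (2 * R * (Cs + (2 * (real n * DD) + 2 * (real n * V))))))
    + (1 - p) * (F' + \<alpha> * (U + DD / real b) + \<beta> * (V + real n / real b * DD)
        + L * (Cx' + \<eta>\<^sup>2 * (2 * R * (Cs + (1 + real n / real b) * (real n * DD)))))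
    \<le> (1 - \<mu> * \<eta>) * (F + \<alpha> * U + \<beta> * V + L * (Cx + \<eta>\<^sup>2 * Cs))"
    (is "?lhs \<le> ?rhs")
proof -
  define w where "w = (1 - p) / real b"
  have w: "0 \<le> w" "w \<le> p" using b bp p by (auto simp: w_def field_simps)
  define M where "M = Cx + \<eta>\<^sup>2 * Cs"
  have M: "M \<ge> 0" "Cx \<le> M" "\<eta>\<^sup>2 * Cs \<le> M" using nonneg by (auto simp: M_def)
  have "1 * R \<le> (real n)\<^sup>2 * R" using n R(1) by (intro mult_right_mono) auto
  then have R1: "R \<le> 1 / 200" using R(2) by simp
  have \<alpha>0: "\<alpha> \<ge> 0" and \<beta>0: "\<beta> \<ge> 0" using \<eta> p L R by (auto simp: \<alpha>_def \<beta>_def)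
  define c where "c = w * \<alpha> + w * \<beta> * real n + 2 * L * R * \<eta>\<^sup>2 * real n * (1 + p + w * real n)"
  have lhs: "?lhs = F' + L * Cx' + 2 * L * R * (\<eta>\<^sup>2 * Cs) + (1 - p) * (\<alpha> * U)
      + ((1 - p) * \<beta> + 4 * p * L * R * \<eta>\<^sup>2 * real n) * V + c * DD"
    using b unfolding c_def w_def by (simp add: field_simps)
  \<comment> \<open>The summand \<open>w * \<alpha>\<close> is at most \<open>2 * \<eta>\<close>,
    because \<open>w \<le> p\<close> cancels the \<open>1 / p\<close> of \<alpha>. The other
    summands are multiples of \<open>B\<close>, negligible by the bound on
    \<open>n^2 * R\<close>.\<close>
  have c: "c \<le> 21 / 10 * \<eta>"
  proof -
    define B where "B = L * R * \<eta>\<^sup>2 * (real n)\<^sup>2"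
    have B0: "B \<ge> 0" using L R by (simp add: B_def)
    have "B = ((real n)\<^sup>2 * R) * (L * \<eta>) * \<eta>" by (simp add: B_def power2_eq_square)
    also have "\<dots> \<le> (1 / 200) * (1 / 20) * \<eta>"
      using R L\<eta> L \<eta> by (intro mult_right_mono mult_mono) auto
    finally have B: "B \<le> \<eta> / 4000" by simp
    have "w * \<alpha> \<le> p * \<alpha>" using w \<alpha>0 by (intro mult_right_mono) auto
    then have 1: "w * \<alpha> \<le> 2 * \<eta>" using p by (simp add: \<alpha>_def)
    have "w * \<beta> * real n = w * (8 * B)" by (simp add: \<beta>_def B_def power2_eq_square)
    also have "\<dots> \<le> 1 * (8 * B)" using w p B0 by (intro mult_right_mono) auto
    finally have 2: "w * \<beta> * real n \<le> 8 * B" by simp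
    have "1 + p + w * real n \<le> 1 * real n + 1 * real n + 1 * real n"
      using n w p by (intro add_mono mult_mono) auto
    then have "2 * L * R * \<eta>\<^sup>2 * real n * (1 + p + w * real n) \<le> 2 * L * R * \<eta>\<^sup>2 * real n * (3 * real n)"
      using L R by (intro mult_left_mono) auto
    also have "\<dots> = 6 * B" by (simp add: B_def power2_eq_square)
    finally show ?thesis using 1 2 B \<eta> unfolding c_def by linarith
  qed
  have L2: "\<eta> * L\<^sup>2 \<le> L / 20"
    using mult_left_mono[OF L\<eta>, of L] L by (simp add: power2_eq_square algebra_simps)
  have Cx'M: "Cx' \<le> M / 100"
    using D3 mult_right_mono[OF R1, of M] M(1) unfolding M_def[symmetric] by simp
  \<comment> \<open>The \<open>s2\<close> part of \<open>DD\<close> ends up with weight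
    \<open>63 / 4000 * \<eta>\<close>, well below the \<open>19 / 40 * \<eta>\<close> that
    \<open>t5\<close> provides.\<close>
  have "c * DD \<le> 21 / 10 * \<eta> * DD" using c nonneg by (intro mult_right_mono) auto
  also have "\<dots> \<le> 21 / 10 * \<eta> * (3 * L\<^sup>2 * (Cx' + Cx + \<eta>\<^sup>2 * s2))"
    using D2 \<eta> by (intro mult_left_mono) auto
  also have "\<dots> \<le> 21 / 10 * \<eta> * (3 * L\<^sup>2 * (101 / 100 * M + \<eta>\<^sup>2 * s2))"
    using Cx'M M \<eta> by (intro mult_left_mono) auto
  also have "\<dots> = 63 / 10 * 101 / 100 * (\<eta> * L\<^sup>2 * M) + 63 / 10 * ((L * \<eta>)\<^sup>2 * (\<eta> * s2))"
    by (simp add: power2_eq_square algebra_simps)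
  also have "\<dots> \<le> 63 / 10 * 101 / 100 * (L / 20 * M) + 63 / 10 * ((1 / 20)\<^sup>2 * (\<eta> * s2))"
    using L2 M L\<eta> L \<eta> nonneg by (intro add_mono mult_left_mono mult_right_mono power_mono) auto
  finally have t1: "c * DD \<le> 6363 / 20000 * (L * M) + 63 / 4000 * (\<eta> * s2)"
    by (simp add: power2_eq_square)
  have t2: "L * Cx' \<le> 1 / 100 * (L * M)" using mult_left_mono[OF Cx'M, of L] L by simp
  have "2 * L * R * (\<eta>\<^sup>2 * Cs) \<le> 2 * L * (1 / 200) * M"
    using L R R1 M nonneg by (intro mult_mono) auto
  then have t3: "2 * L * R * (\<eta>\<^sup>2 * Cs) \<le> 1 / 100 * (L * M)" by simp
  have "\<eta> * L\<^sup>2 * Cx \<le> L / 20 * M" using L2 M L nonneg \<eta> by (intro mult_mono) auto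
  then have t4: "\<eta> * (L\<^sup>2 * Cx + U) \<le> 1 / 20 * (L * M) + \<eta> * U" by (simp add: algebra_simps)
  have "\<eta> / 2 * (1 - L * \<eta>) * s2 \<ge> \<eta> / 2 * (1 - 1 / 20) * s2"
    using L\<eta> \<eta> nonneg by (intro mult_right_mono mult_left_mono) auto
  then have t5: "\<eta> / 2 * (1 - L * \<eta>) * s2 \<ge> 19 / 40 * (\<eta> * s2)" by simp
  have s20: "\<eta> * s2 \<ge> 0" using \<eta> nonneg by simp
  \<comment> \<open>Origin of \<alpha>: with \<open>2 * \<eta> / p\<close> the term
    \<open>\<eta> * U\<close> is \<open>p / 2\<close> times \<open>\<alpha> * U\<close>, and the
    factor \<open>1 - p / 2\<close> is left.\<close>
  have t6: "(1 - p) * (\<alpha> * U) + \<eta> * U \<le> (1 - \<mu> * \<eta>) * (\<alpha> * U)"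
  proof -
    have "\<eta> * U = p / 2 * (\<alpha> * U)" using p by (simp add: \<alpha>_def)
    then have "(1 - p) * (\<alpha> * U) + \<eta> * U = (1 - p / 2) * (\<alpha> * U)" by (simp add: algebra_simps)
    also have "\<dots> \<le> (1 - \<mu> * \<eta>) * (\<alpha> * U)" using \<mu>\<eta> \<alpha>0 nonneg by (intro mult_right_mono) auto
    finally show ?thesis .
  qed
  \<comment> \<open>Origin of \<beta>: the factor 8 makes the cost of a reset,
    \<open>4 * p * L * R * \<eta>^2 * n\<close>, equal to \<open>p / 2 * \<beta>\<close>.\<close>
  have t7: "((1 - p) * \<beta> + 4 * p * L * R * \<eta>\<^sup>2 * real n) * V \<le> (1 - \<mu> * \<eta>) * (\<beta> * V)"
  proof -
    have "((1 - p) * \<beta> + 4 * p * L * R * \<eta>\<^sup>2 * real n) * V = (1 - p / 2) * (\<beta> * V)"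
      by (simp add: \<beta>_def algebra_simps)
    also have "\<dots> \<le> (1 - \<mu> * \<eta>) * (\<beta> * V)" using \<mu>\<eta> \<beta>0 nonneg by (intro mult_right_mono) auto
    finally show ?thesis .
  qed
  \<comment> \<open>\<open>\<mu> * \<eta> \<le> p / 2\<close> leaves at least one half, and the
    collected weights of \<open>L * M\<close> stay below that.\<close>
  have "(1 / 2) * (L * M) \<le> (1 - \<mu> * \<eta>) * (L * M)"
    using \<mu>\<eta> p L M by (intro mult_right_mono) auto
  moreover have "(6363 / 20000 + 1 / 100 + 1 / 100 + 1 / 20) * (L * M) \<le> (1 / 2) * (L * M)"
    using L M by (intro mult_right_mono) auto
  ultimately have t8: "(6363 / 20000 + 1 / 100 + 1 / 100 + 1 / 20) * (L * M) \<le> (1 - \<mu> * \<eta>) * (L * M)"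
    by (rule order_trans[rotated])
  have "?rhs = (1 - \<mu> * \<eta>) * F + (1 - \<mu> * \<eta>) * (\<alpha> * U) + (1 - \<mu> * \<eta>) * (\<beta> * V) + (1 - \<mu> * \<eta>) * (L * M)"
    by (simp only: M_def distrib_left)
  then show ?thesis unfolding lhs using D1 t1 t2 t3 t4 t5 t6 t7 t8 s20 by (simp only: distrib_right)
qed

section \<open>Deviations of the rows from their mean\<close>

lemma dev_nonneg [simp]: "0 \<le> dev n d A"
  unfolding dev_def by (intro sum_nonneg) auto

lemma dev_le_sum_squares:
  assumes n: "n \<ge> 1"
  shows "dev n d A \<le> (\<Sum>j<d. \<Sum>i<n. (A $$ (i, j))\<^sup>2)"
  unfolding dev_def
proof (rule sum_mono)
  fix j
  define m where "m = col_sum n A j / real n"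
  have "(\<Sum>i<n. (A $$ (i, j) - m)\<^sup>2) = (\<Sum>i<n. (A $$ (i, j))\<^sup>2 - 2 * m * A $$ (i, j) + m\<^sup>2)"
    by (intro sum.cong refl) (simp add: power2_diff)
  also have "\<dots> = (\<Sum>i<n. (A $$ (i, j))\<^sup>2) - 2 * m * col_sum n A j + real n * m\<^sup>2"
    by (simp add: sum.distrib sum_subtractf sum_distrib_left[symmetric] col_sum_def)
  also have "col_sum n A j = real n * m" using n by (simp add: m_def)
  also have "(\<Sum>i<n. (A $$ (i, j))\<^sup>2) - 2 * m * (real n * m) + real n * m\<^sup>2
      = (\<Sum>i<n. (A $$ (i, j))\<^sup>2) - real n * m\<^sup>2" by (simp add: power2_eq_square)
  finally show "(\<Sum>i<n. (A $$ (i, j) - col_sum n A j / real n)\<^sup>2) \<le> (\<Sum>i<n. (A $$ (i, j))\<^sup>2)"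
    by (simp add: m_def[symmetric])
qed

lemma col_sum_add_scaled:
  assumes "\<And>i. i < n \<Longrightarrow> A $$ (i, j) = B $$ (i, j) + c * C $$ (i, j)"
  shows "col_sum n A j = col_sum n B j + c * col_sum n C j"
  using assms by (simp add: col_sum_def sum.distrib sum_distrib_left)

lemma dev_add_scaled_le:
  assumes "\<And>i j. i < n \<Longrightarrow> j < d \<Longrightarrow> A $$ (i, j) = B $$ (i, j) + c * C $$ (i, j)"
  shows "dev n d A \<le> 2 * (dev n d B + c\<^sup>2 * dev n d C)"
proof -
  have "(A $$ (i, j) - col_sum n A j / real n)\<^sup>2 \<le> 2 * (B $$ (i, j) - col_sum n B j / real n)\<^sup>2
      + 2 * (c\<^sup>2 * (C $$ (i, j) - col_sum n C j / real n)\<^sup>2)" if "i < n" "j < d" for i j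
  proof -
    have "A $$ (i, j) - col_sum n A j / real n
        = (B $$ (i, j) - col_sum n B j / real n) + c * (C $$ (i, j) - col_sum n C j / real n)"
      using that assms col_sum_add_scaled[of n A j B c C]
      by (simp add: add_divide_distrib algebra_simps)
    then show ?thesis using square_sum2_le by (metis power_mult_distrib)
  qed
  then have "dev n d A \<le> (\<Sum>j<d. \<Sum>i<n. 2 * (B $$ (i, j) - col_sum n B j / real n)\<^sup>2
      + 2 * (c\<^sup>2 * (C $$ (i, j) - col_sum n C j / real n)\<^sup>2))"
    unfolding dev_def by (intro sum_mono) auto
  also have "\<dots> = 2 * (dev n d B + c\<^sup>2 * dev n d C)"
    by (simp add: dev_def sum.distrib sum_distrib_left)
  finally show ?thesis .
qed

lemma row_mean_carrier [simp]: "X \<in> carrier_mat n d \<Longrightarrow> row_mean X \<in> carrier_vec d"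
  by (simp add: row_mean_def)

lemma row_mean_index:
  assumes "X \<in> carrier_mat n d" "j < d"
  shows "row_mean X $ j = col_sum n X j / real n"
  using assms by (simp add: row_mean_def col_sum_def)

lemma dev_eq_sum_rows:
  assumes "X \<in> carrier_mat n d"
  shows "dev n d X = (\<Sum>i<n. \<Sum>j<d. (X $$ (i, j) - row_mean X $ j)\<^sup>2)"
  unfolding dev_def by (subst sum.swap) (use assms in \<open>auto simp: row_mean_index intro!: sum.cong\<close>)

text \<open>Of the parameters only the inequalities used by one step are assumed; the formulas for
  them enter in \<open>drone_complexity\<close>. \<open>bp\<close> bounds \<open>(1 - p) / b\<close>
  by \<open>p\<close>, and \<open>\<rho>\<close> says that gossip outweighs a factor
  \<open>n^2\<close>.\<close>

locale drone_run =
  fixes n d b K :: nat and fs :: "nat \<Rightarrow> real vec \<Rightarrow> real" and L \<mu> \<eta> p :: real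
    and E :: "(nat \<times> nat) set" and W :: "real mat" and x0 :: "real vec"
  assumes n: "n \<ge> 1" and L: "L > 0" and \<mu>: "\<mu> > 0"
    and diff: "\<And>i. i < n \<Longrightarrow> differentiable_vec d (fs i)"
    and bdd: "bdd_below (avg_fun n fs ` carrier_vec d)"
    and smooth: "mean_squared_smooth n d fs L"
    and PL: "PL_condition d (avg_fun n fs) \<mu>"
    and W: "mixing_matrix n E W" and l2: "lambda2 W < 1"
    and x0: "x0 \<in> carrier_vec d"
    and b: "b \<ge> 1" and \<eta>: "\<eta> > 0" and p: "0 < p" "p \<le> 1" and bp: "1 - p \<le> p * real b"
    and L\<eta>: "20 * (L * \<eta>) \<le> 1" and \<mu>\<eta>: "2 * (\<mu> * \<eta>) \<le> p"
    and \<rho>: "(real n)\<^sup>2 * (sqrt 14 * (1 - (1 - 1 / sqrt 2) * sqrt (1 - lambda2 W)) ^ K)\<^sup>2 \<le> 1 / 200"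
begin

abbreviation "f \<equiv> avg_fun n fs"
abbreviation "g i x \<equiv> gradient d (fs i) x"
abbreviation "N X \<equiv> nabla_F n d fs X"

definition "R = (sqrt 14 * (1 - (1 - 1 / sqrt 2) * sqrt (1 - lambda2 W)) ^ K)\<^sup>2"

lemma R: "R \<ge> 0" "(real n)\<^sup>2 * R \<le> 1 / 200"
  using \<rho> by (auto simp: R_def)

lemma Wc: "W \<in> carrier_mat n n"
  using W by (simp add: mixing_matrix_def)

lemma g_carrier [simp]: "i < n \<Longrightarrow> x \<in> carrier_vec d \<Longrightarrow> g i x \<in> carrier_vec d"
  using gradient_carrier diff by blast

lemma N_carrier [simp]: "N X \<in> carrier_mat n d"
  by (simp add: nabla_F_def)

lemma N_index: "i < n \<Longrightarrow> j < d \<Longrightarrow> N X $$ (i, j) = g i (row X i) $ j"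
  by (simp add: nabla_F_def)

lemma has_gradient_f:
  assumes x: "x \<in> carrier_vec d"
  shows "has_gradient d f x (vec d (\<lambda>j. (\<Sum>i<n. g i x $ j) / real n))"
  by (rule has_gradient_avg_fun[OF x diff])

lemma gradient_f:
  assumes x: "x \<in> carrier_vec d"
  shows "gradient d f x = vec d (\<lambda>j. (\<Sum>i<n. g i x $ j) / real n)"
  by (rule gradient_eqI[OF x has_gradient_f[OF x]])

lemma diff_f: "differentiable_vec d f"
  unfolding differentiable_vec_def using has_gradient_f by blast

lemma smooth_sum:
  assumes x: "x \<in> carrier_vec d" and y: "y \<in> carrier_vec d"
  shows "(\<Sum>i<n. \<Sum>j<d. (g i x $ j - g i y $ j)\<^sup>2) \<le> real n * (L\<^sup>2 * (\<Sum>j<d. (x $ j - y $ j)\<^sup>2))"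
proof -
  have "(\<Sum>i<n. (vec_norm (g i x - g i y))\<^sup>2) / real n \<le> L\<^sup>2 * (vec_norm (x - y))\<^sup>2"
    using smooth x y by (auto simp: mean_squared_smooth_def)
  moreover have "(vec_norm (x - y))\<^sup>2 = (\<Sum>j<d. (x $ j - y $ j)\<^sup>2)"
    using x y by (subst vec_norm_sq[of _ d]) auto
  moreover have "(vec_norm (g i x - g i y))\<^sup>2 = (\<Sum>j<d. (g i x $ j - g i y $ j)\<^sup>2)" if "i < n" for i
    using g_carrier[OF that x] g_carrier[OF that y] by (subst vec_norm_sq[of _ d]) auto
  ultimately show ?thesis using n by (simp add: field_simps)
qed

(* Mean-squared smoothness only compares all agents at a common pair of points; each single agent
   is merely (sqrt n * L)-smooth, and summing over the agents the factor n stays. *)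
lemma smooth_rows:
  assumes X: "X \<in> carrier_mat n d" and y: "y \<in> carrier_vec d"
  shows "(\<Sum>i<n. \<Sum>j<d. (g i (row X i) $ j - g i y $ j)\<^sup>2)
    \<le> real n * (L\<^sup>2 * (\<Sum>i<n. \<Sum>j<d. (X $$ (i, j) - y $ j)\<^sup>2))"
proof -
  have "(\<Sum>j<d. (g i (row X i) $ j - g i y $ j)\<^sup>2) \<le> real n * (L\<^sup>2 * (\<Sum>j<d. (X $$ (i, j) - y $ j)\<^sup>2))"
    if i: "i < n" for i
  proof -
    have "(\<Sum>j<d. (g i (row X i) $ j - g i y $ j)\<^sup>2) \<le> (\<Sum>k<n. \<Sum>j<d. (g k (row X i) $ j - g k y $ j)\<^sup>2)"
      using i by (intro member_le_sum) (auto intro: sum_nonneg)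
    also have "\<dots> \<le> real n * (L\<^sup>2 * (\<Sum>j<d. (row X i $ j - y $ j)\<^sup>2))"
      by (rule smooth_sum) (use X i y in \<open>auto intro: row_carrier_vec\<close>)
    also have "(\<Sum>j<d. (row X i $ j - y $ j)\<^sup>2) = (\<Sum>j<d. (X $$ (i, j) - y $ j)\<^sup>2)"
      using X i by (intro sum.cong) auto
    finally show ?thesis .
  qed
  then have "(\<Sum>i<n. \<Sum>j<d. (g i (row X i) $ j - g i y $ j)\<^sup>2)
      \<le> (\<Sum>i<n. real n * (L\<^sup>2 * (\<Sum>j<d. (X $$ (i, j) - y $ j)\<^sup>2)))" by (intro sum_mono) auto
  then show ?thesis by (simp add: sum_distrib_left)
qed

text \<open>The average does not lose the factor of a single agent: by Jensen the squared change of
  the mean gradient is at most the mean squared change, which is what mean-squared smoothness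
  bounds.\<close>

lemma gradient_f_lipschitz:
  assumes x: "x \<in> carrier_vec d" and y: "y \<in> carrier_vec d"
  shows "vec_norm (gradient d f x - gradient d f y) \<le> L * vec_norm (x - y)"
proof -
  have "(vec_norm (gradient d f x - gradient d f y))\<^sup>2
      = (\<Sum>j<d. ((\<Sum>i<n. g i x $ j - g i y $ j) / real n)\<^sup>2)"
    using x y by (subst vec_norm_sq[of _ d])
      (auto simp: gradient_f sum_subtractf diff_divide_distrib intro!: sum.cong)
  also have "\<dots> \<le> (\<Sum>j<d. (\<Sum>i<n. (g i x $ j - g i y $ j)\<^sup>2) / real n)"
    by (intro sum_mono square_mean_le)
  also have "\<dots> = (\<Sum>i<n. \<Sum>j<d. (g i x $ j - g i y $ j)\<^sup>2) / real n"
    by (subst sum.swap) (simp add: sum_divide_distrib)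
  also have "\<dots> \<le> L\<^sup>2 * (\<Sum>j<d. (x $ j - y $ j)\<^sup>2)"
    using smooth_sum[OF x y] n by (simp add: field_simps)
  also have "(\<Sum>j<d. (x $ j - y $ j)\<^sup>2) = (vec_norm (x - y))\<^sup>2"
    using x y by (subst vec_norm_sq[of _ d]) auto
  finally show ?thesis using L by (simp add: power_mult_distrib[symmetric] power2_le_iff_abs_le)
qed

lemma descent:
  assumes "x \<in> carrier_vec d" "h \<in> carrier_vec d"
  shows "f (x + h) \<le> f x + gradient d f x \<bullet> h + L / 2 * (\<Sum>j<d. (h $ j)\<^sup>2)"
  using smooth_descent[OF diff_f gradient_f_lipschitz assms] vec_norm_sq[OF assms(2)] by simp

section \<open>Lyapunov terms of a state and descent of the mean iterate\<close>

definition "U s = (\<Sum>j<d. ((col_sum n (itG s) j - col_sum n (N (itX s)) j) / real n)\<^sup>2)"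
definition "V s = (\<Sum>j<d. \<Sum>i<n. (itG s $$ (i, j) - N (itX s) $$ (i, j))\<^sup>2) / real n"
text \<open>The Lyapunov function of a single state, before taking expectations, so that a step can
  be analysed conditionally on the current state; \<open>R\<close> is the square of \<rho>.\<close>

definition "\<Psi> s = f (row_mean (itX s)) - inf_value d f + 2 * \<eta> / p * U s
  + 8 * L * R * real n * \<eta>\<^sup>2 * V s + L * (dev n d (itX s) + \<eta>\<^sup>2 * dev n d (itS s))"

definition "valid_state s \<longleftrightarrow> itX s \<in> carrier_mat n d \<and> itS s \<in> carrier_mat n d \<and> itG s \<in> carrier_mat n d
  \<and> (\<forall>j<d. col_sum n (itS s) j = col_sum n (itG s) j)"

lemma U_nonneg: "U s \<ge> 0" unfolding U_def by (intro sum_nonneg) auto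
lemma V_nonneg: "V s \<ge> 0" unfolding V_def by (intro divide_nonneg_nonneg sum_nonneg) auto

lemma n_V: "real n * V s = (\<Sum>j<d. \<Sum>i<n. (itG s $$ (i, j) - N (itX s) $$ (i, j))\<^sup>2)"
  using n by (simp add: V_def)

lemma f_ge_inf: "x \<in> carrier_vec d \<Longrightarrow> inf_value d f \<le> f x"
  unfolding inf_value_def using bdd by (intro cInf_lower) auto

definition "X1 s = acc_gossip (itX s - \<eta> \<cdot>\<^sub>m itS s) W K"
definition "smean s = vec d (\<lambda>j. col_sum n (itS s) j / real n)"
definition "s2 s = (\<Sum>j<d. (smean s $ j)\<^sup>2)"

lemma smean_carrier [simp]: "smean s \<in> carrier_vec d"
  by (simp add: smean_def)

lemma X1_carrier:
  assumes "valid_state s"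
  shows "X1 s \<in> carrier_mat n d"
  unfolding X1_def using assms Wc
  by (intro acc_gossip_carrier) (auto simp: valid_state_def minus_carrier_mat)

lemma row_mean_X1:
  assumes s: "valid_state s"
  shows "row_mean (X1 s) = row_mean (itX s) + (- \<eta>) \<cdot>\<^sub>v smean s"
proof (rule eq_vecI)
  have X: "itX s \<in> carrier_mat n d" and S: "itS s \<in> carrier_mat n d"
    using s by (auto simp: valid_state_def)
  have XS: "itX s - \<eta> \<cdot>\<^sub>m itS s \<in> carrier_mat n d" using S by (simp add: minus_carrier_mat)
  fix j assume "j < dim_vec (row_mean (itX s) + (- \<eta>) \<cdot>\<^sub>v smean s)"
  then have j: "j < d" by (simp add: smean_def)
  have "col_sum n (X1 s) j = col_sum n (itX s - \<eta> \<cdot>\<^sub>m itS s) j"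
    unfolding X1_def by (rule col_sum_acc_gossip[OF W XS j])
  also have "\<dots> = col_sum n (itX s) j + (- \<eta>) * col_sum n (itS s) j"
    by (rule col_sum_add_scaled) (use X S j in auto)
  finally show "row_mean (X1 s) $ j = (row_mean (itX s) + (- \<eta>) \<cdot>\<^sub>v smean s) $ j"
    using j X X1_carrier[OF s] by (simp add: row_mean_index smean_def diff_divide_distrib)
qed (use X1_carrier[OF s] in \<open>simp add: row_mean_def smean_def\<close>)

lemma step_descent:
  assumes s: "valid_state s"
  shows "f (row_mean (X1 s)) - inf_value d f
    \<le> (1 - \<mu> * \<eta>) * (f (row_mean (itX s)) - inf_value d f) - \<eta> / 2 * (1 - L * \<eta>) * s2 s
      + \<eta> * (L\<^sup>2 * dev n d (itX s) + U s)"
proof -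
  define X where "X = itX s"
  define x where "x = row_mean X"
  define G where "G j = (\<Sum>i<n. g i x $ j) / real n" for j
  define sb where "sb j = smean s $ j" for j
  have X: "X \<in> carrier_mat n d" using s by (auto simp: valid_state_def X_def)
  have sb: "sb j = col_sum n (itG s) j / real n" if "j < d" for j
    using s that by (simp add: valid_state_def sb_def smean_def)
  have x: "x \<in> carrier_vec d" using X by (simp add: x_def)
  define h where "h = (- \<eta>) \<cdot>\<^sub>v smean s"
  have h: "h \<in> carrier_vec d" by (simp add: h_def)
  have hj: "h $ j = - (\<eta> * sb j)" if "j < d" for j
    using that by (simp add: h_def sb_def smean_def)
  have "f (row_mean (X1 s)) \<le> f x + gradient d f x \<bullet> h + L / 2 * (\<Sum>j<d. (h $ j)\<^sup>2)"
    using descent[OF x h] by (simp add: row_mean_X1[OF s] x_def X_def h_def)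
  also have "gradient d f x \<bullet> h = (\<Sum>j<d. - \<eta> * (G j * sb j))"
    by (subst scalar_prod_sum[of _ d]) (use h in \<open>auto simp: hj gradient_f[OF x] G_def intro!: sum.cong\<close>)
  also have "(\<Sum>j<d. (h $ j)\<^sup>2) = \<eta>\<^sup>2 * s2 s"
    by (simp add: hj s2_def sb_def sum_distrib_left power_mult_distrib[symmetric])
  \<comment> \<open>Polarization: the inner product becomes minus both squares plus the square of
    the error \<open>G - sb\<close>. The exact gradient can then meet the Polyak-Lojasiewicz
    inequality, and \<open>sb\<close> survives as \<open>s2\<close>.\<close>
  also have "(\<Sum>j<d. - \<eta> * (G j * sb j))
      = (\<Sum>j<d. - \<eta> / 2 * (G j)\<^sup>2 - \<eta> / 2 * (sb j)\<^sup>2 + \<eta> / 2 * (G j - sb j)\<^sup>2)"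
    by (intro sum.cong refl) (simp add: power2_diff field_simps)
  also have "\<dots> = \<eta> / 2 * (\<Sum>j<d. (G j - sb j)\<^sup>2) - \<eta> / 2 * (\<Sum>j<d. (G j)\<^sup>2) - \<eta> / 2 * s2 s"
    by (simp add: sum.distrib sum_subtractf sum_distrib_left s2_def sb_def sum_negf)
  finally have "f (row_mean (X1 s)) \<le> f x + (\<eta> / 2 * (\<Sum>j<d. (G j - sb j)\<^sup>2)
      - \<eta> / 2 * (\<Sum>j<d. (G j)\<^sup>2) - \<eta> / 2 * s2 s) + L / 2 * (\<eta>\<^sup>2 * s2 s)" .
  moreover have "\<eta> / 2 * (1 - L * \<eta>) * s2 s = \<eta> / 2 * s2 s - L / 2 * (\<eta>\<^sup>2 * s2 s)"
    by (simp add: power2_eq_square field_simps)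
  ultimately have main: "f (row_mean (X1 s)) \<le> f x - \<eta> / 2 * (\<Sum>j<d. (G j)\<^sup>2)
      - \<eta> / 2 * (1 - L * \<eta>) * s2 s + \<eta> / 2 * (\<Sum>j<d. (G j - sb j)\<^sup>2)"
    by linarith
  have "f x - inf_value d f \<le> 1 / (2 * \<mu>) * (vec_norm (gradient d f x))\<^sup>2"
    by (rule PL[unfolded PL_condition_def, rule_format, OF x])
  also have "(vec_norm (gradient d f x))\<^sup>2 = (\<Sum>j<d. (G j)\<^sup>2)"
    by (subst vec_norm_sq[of _ d]) (auto simp: gradient_f[OF x] G_def)
  finally have "2 * \<mu> * (f x - inf_value d f) \<le> (\<Sum>j<d. (G j)\<^sup>2)" using \<mu> by (simp add: field_simps)
  then have pl: "\<eta> / 2 * (\<Sum>j<d. (G j)\<^sup>2) \<ge> \<eta> / 2 * (2 * \<mu> * (f x - inf_value d f))"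
    using \<eta> by (intro mult_left_mono) auto
  \<comment> \<open>The mean of the local gradients, each taken at the agent's own row; it separates
    the consensus error \<open>G - a\<close> from the estimation error \<open>a - sb\<close>, which
    is \<open>U\<close>.\<close>
  define a where "a j = col_sum n (N X) j / real n" for j
  have "(\<Sum>j<d. (G j - sb j)\<^sup>2) \<le> (\<Sum>j<d. 2 * (G j - a j)\<^sup>2 + 2 * (a j - sb j)\<^sup>2)"
  proof (rule sum_mono)
    fix j
    show "(G j - sb j)\<^sup>2 \<le> 2 * (G j - a j)\<^sup>2 + 2 * (a j - sb j)\<^sup>2"
      using square_sum2_le[of "G j - a j" "a j - sb j"] by simp
  qed
  also have "\<dots> = 2 * (\<Sum>j<d. (G j - a j)\<^sup>2) + 2 * (\<Sum>j<d. (a j - sb j)\<^sup>2)"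
    by (simp add: sum.distrib sum_distrib_left)
  also have "(\<Sum>j<d. (a j - sb j)\<^sup>2) = U s"
    unfolding U_def by (intro sum.cong refl)
      (simp add: a_def sb X_def diff_divide_distrib power2_commute)
  \<comment> \<open>Jensen contributes a \<open>1 / n\<close> that cancels the factor
    \<open>n\<close> of \<open>smooth_rows\<close>.\<close>
  also have "(\<Sum>j<d. (G j - a j)\<^sup>2) \<le> (\<Sum>j<d. (\<Sum>i<n. (g i (row X i) $ j - g i x $ j)\<^sup>2) / real n)"
  proof (rule sum_mono)
    fix j assume "j \<in> {..<d}"
    then have "(G j - a j)\<^sup>2 = ((\<Sum>i<n. g i (row X i) $ j - g i x $ j) / real n)\<^sup>2"
      by (simp add: G_def a_def col_sum_def N_index sum_subtractf diff_divide_distrib power2_commute)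
    also have "\<dots> \<le> (\<Sum>i<n. (g i (row X i) $ j - g i x $ j)\<^sup>2) / real n" by (rule square_mean_le)
    finally show "(G j - a j)\<^sup>2 \<le> (\<Sum>i<n. (g i (row X i) $ j - g i x $ j)\<^sup>2) / real n" .
  qed
  also have "\<dots> = (\<Sum>i<n. \<Sum>j<d. (g i (row X i) $ j - g i x $ j)\<^sup>2) / real n"
    by (subst sum.swap) (simp add: sum_divide_distrib)
  also have "\<dots> \<le> L\<^sup>2 * dev n d X"
    using smooth_rows[OF X x] n unfolding dev_eq_sum_rows[OF X] x_def by (simp add: field_simps)
  finally have "\<eta> / 2 * (\<Sum>j<d. (G j - sb j)\<^sup>2) \<le> \<eta> / 2 * (2 * (L\<^sup>2 * dev n d X) + 2 * U s)"
    using \<eta> by (intro mult_left_mono) auto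
  then show ?thesis using main pl unfolding x_def X_def by (simp add: algebra_simps)
qed

end

lemma index_add_smult_minus:
  fixes c :: real
  assumes "v \<in> carrier_vec d" "w \<in> carrier_vec d" "j < d"
  shows "(u + c \<cdot>\<^sub>v (v - w)) $ j = u $ j + c * (v $ j - w $ j)"
  using assms by simp

section \<open>One random update of a state\<close>

context drone_run
begin

abbreviation "upd \<zeta> \<xi> s \<equiv> drone_update n d fs W K b \<eta> (1 / real n) \<zeta> \<xi> s"
abbreviation "M \<equiv> multinomial_pmf n b (1 / real n)"

definition "\<Delta> s i j = N (X1 s) $$ (i, j) - N (itX s) $$ (i, j)"
definition "DD s = (\<Sum>j<d. \<Sum>i<n. (\<Delta> s i j)\<^sup>2) / real n"

lemma DD_nonneg: "DD s \<ge> 0"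
  unfolding DD_def by (intro divide_nonneg_nonneg sum_nonneg) auto

lemma n_DD: "real n * DD s = (\<Sum>j<d. \<Sum>i<n. (\<Delta> s i j)\<^sup>2)"
  using n by (simp add: DD_def)

text \<open>The change is routed over the two means: new rows to new mean, new mean to old mean, old
  mean to old rows. Each outer leg costs a deviation, the \<open>n\<close> of
  \<open>smooth_rows\<close> being cancelled by the \<open>1 / n\<close> in \<open>DD\<close>; the
  middle leg has length \<eta> times the norm of the mean of \<open>S\<close>.\<close>

lemma DD_le:
  assumes s: "valid_state s"
  shows "DD s \<le> 3 * L\<^sup>2 * (dev n d (X1 s) + dev n d (itX s) + \<eta>\<^sup>2 * s2 s)"
proof -
  define X X' where "X = itX s" and "X' = X1 s"
  define x x' where "x = row_mean X" and "x' = row_mean X'"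
  have X: "X \<in> carrier_mat n d" and X': "X' \<in> carrier_mat n d"
    using s X1_carrier[OF s] by (auto simp: valid_state_def X_def X'_def)
  have x: "x \<in> carrier_vec d" "x' \<in> carrier_vec d" using X X' by (auto simp: x_def x'_def)
  let ?T1 = "\<Sum>i<n. \<Sum>j<d. (g i (row X' i) $ j - g i x' $ j)\<^sup>2"
  let ?T2 = "\<Sum>i<n. \<Sum>j<d. (g i x' $ j - g i x $ j)\<^sup>2"
  let ?T3 = "\<Sum>i<n. \<Sum>j<d. (g i (row X i) $ j - g i x $ j)\<^sup>2"
  have "real n * DD s = (\<Sum>i<n. \<Sum>j<d. (\<Delta> s i j)\<^sup>2)"
    unfolding n_DD by (rule sum.swap)
  also have "\<dots> \<le> (\<Sum>i<n. \<Sum>j<d. 3 * (g i (row X' i) $ j - g i x' $ j)\<^sup>2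
      + 3 * (g i x' $ j - g i x $ j)\<^sup>2 + 3 * (g i (row X i) $ j - g i x $ j)\<^sup>2)"
  proof (intro sum_mono)
    fix i j assume "i \<in> {..<n}" "j \<in> {..<d}"
    then have "\<Delta> s i j = (g i (row X' i) $ j - g i x' $ j) + (g i x' $ j - g i x $ j)
        + (g i x $ j - g i (row X i) $ j)"
      by (simp add: \<Delta>_def N_index X_def X'_def)
    then show "(\<Delta> s i j)\<^sup>2 \<le> 3 * (g i (row X' i) $ j - g i x' $ j)\<^sup>2
      + 3 * (g i x' $ j - g i x $ j)\<^sup>2 + 3 * (g i (row X i) $ j - g i x $ j)\<^sup>2"
      using square_sum3_le by (metis power2_commute)
  qed
  also have "\<dots> = 3 * ?T1 + 3 * ?T2 + 3 * ?T3" by (simp add: sum.distrib sum_distrib_left)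
  also have "\<dots> \<le> 3 * (real n * (L\<^sup>2 * dev n d X')) + 3 * (real n * (L\<^sup>2 * (\<eta>\<^sup>2 * s2 s)))
      + 3 * (real n * (L\<^sup>2 * dev n d X))"
  proof -
    have "(\<Sum>j<d. (x' $ j - x $ j)\<^sup>2) = \<eta>\<^sup>2 * s2 s"
      unfolding s2_def sum_distrib_left
    proof (intro sum.cong refl)
      fix j assume j: "j \<in> {..<d}"
      have "x' $ j = x $ j - \<eta> * smean s $ j"
        using j X by (simp add: x'_def X'_def row_mean_X1[OF s] x_def X_def smean_def)
      then show "(x' $ j - x $ j)\<^sup>2 = \<eta>\<^sup>2 * (smean s $ j)\<^sup>2" by (simp add: power_mult_distrib)
    qed
    then show ?thesis
      using smooth_rows[OF X' x(2)] smooth_sum[OF x(2) x(1)] smooth_rows[OF X x(1)]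
      unfolding dev_eq_sum_rows[OF X] dev_eq_sum_rows[OF X'] x_def x'_def by simp
  qed
  also have "\<dots> = real n * (3 * L\<^sup>2 * (dev n d X' + dev n d X + \<eta>\<^sup>2 * s2 s))" by (simp add: algebra_simps)
  finally show ?thesis using n by (simp add: X_def X'_def)
qed

lemma dev_X1_le:
  assumes s: "valid_state s"
  shows "dev n d (X1 s) \<le> 2 * R * (dev n d (itX s) + \<eta>\<^sup>2 * dev n d (itS s))"
proof -
  have X: "itX s \<in> carrier_mat n d" and S: "itS s \<in> carrier_mat n d"
    using s by (auto simp: valid_state_def)
  have XS: "itX s - \<eta> \<cdot>\<^sub>m itS s \<in> carrier_mat n d" using S by (simp add: minus_carrier_mat)
  have "dev n d (X1 s) \<le> R * dev n d (itX s - \<eta> \<cdot>\<^sub>m itS s)"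
    unfolding X1_def R_def by (rule dev_acc_gossip_le[OF W n l2 XS])
  also have "\<dots> \<le> R * (2 * (dev n d (itX s) + (- \<eta>)\<^sup>2 * dev n d (itS s)))"
    by (intro mult_left_mono dev_add_scaled_le) (use X S R in auto)
  finally show ?thesis by (simp add: algebra_simps)
qed

lemma itX_upd [simp]: "itX (upd \<zeta> \<xi> s) = X1 s"
  by (simp add: drone_update_def Let_def X1_def)

lemma itG_upd_carrier: "itG (upd \<zeta> \<xi> s) \<in> carrier_mat n d"
  by (simp add: drone_update_def Let_def)

lemma itS_upd: "itS (upd \<zeta> \<xi> s) = acc_gossip (itS s + itG (upd \<zeta> \<xi> s) - itG s) W K"
  by (simp add: drone_update_def Let_def)

lemma itG_upd:
  assumes s: "valid_state s" and i: "i < n" and j: "j < d"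
  shows "itG (upd \<zeta> \<xi> s) $$ (i, j) = (if \<zeta> then N (X1 s) $$ (i, j)
    else itG s $$ (i, j) + real (\<xi> i) / (real b * (1 / real n)) * \<Delta> s i j)"
proof -
  have c: "row (X1 s) i \<in> carrier_vec d" "row (itX s) i \<in> carrier_vec d" "itG s \<in> carrier_mat n d"
    using row_carrier_vec[OF i X1_carrier[OF s]] row_carrier_vec[OF i, of "itX s" d] s
    by (auto simp: valid_state_def)
  show ?thesis
    using i j c(3) index_add_smult_minus[OF g_carrier[OF i c(1)] g_carrier[OF i c(2)] j]
    by (simp add: drone_update_def Let_def X1_def[symmetric] N_index \<Delta>_def)
qed

text \<open>Gossip keeps column sums, so \<open>S\<close> gains exactly the column sums of the
  change of \<open>G\<close>, and the equality of the two persists.\<close>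

lemma valid_state_upd:
  assumes s: "valid_state s"
  shows "valid_state (upd \<zeta> \<xi> s)"
proof -
  let ?G = "itG (upd \<zeta> \<xi> s)"
  have S: "itS s \<in> carrier_mat n d" and G: "itG s \<in> carrier_mat n d"
    and SG: "\<And>j. j < d \<Longrightarrow> col_sum n (itS s) j = col_sum n (itG s) j"
    using s by (auto simp: valid_state_def)
  have T: "itS s + ?G - itG s \<in> carrier_mat n d" using G by (simp add: minus_carrier_mat)
  have "col_sum n (itS (upd \<zeta> \<xi> s)) j = col_sum n ?G j" if j: "j < d" for j
  proof -
    have "col_sum n (itS (upd \<zeta> \<xi> s)) j = col_sum n (itS s + ?G - itG s) j"
      unfolding itS_upd by (rule col_sum_acc_gossip[OF W T j])
    also have "\<dots> = col_sum n (itS s + ?G) j + (- 1) * col_sum n (itG s) j"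
      by (rule col_sum_add_scaled) (use S G j in auto)
    also have "col_sum n (itS s + ?G) j = col_sum n (itS s) j + 1 * col_sum n ?G j"
      by (rule col_sum_add_scaled) (use S itG_upd_carrier[of \<zeta> \<xi> s] j in auto)
    finally show ?thesis using SG[OF j] by simp
  qed
  then show ?thesis using T X1_carrier[OF s] Wc by (simp add: valid_state_def itS_upd itG_upd_carrier)
qed

definition "GD \<zeta> \<xi> s = (\<Sum>j<d. \<Sum>i<n. (itG (upd \<zeta> \<xi> s) $$ (i, j) - itG s $$ (i, j))\<^sup>2)"

lemma dev_itS_upd_le:
  assumes s: "valid_state s"
  shows "dev n d (itS (upd \<zeta> \<xi> s)) \<le> 2 * R * (dev n d (itS s) + GD \<zeta> \<xi> s)"
proof -
  let ?G = "itG (upd \<zeta> \<xi> s)"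
  have S: "itS s \<in> carrier_mat n d" and G: "itG s \<in> carrier_mat n d"
    using s by (auto simp: valid_state_def)
  have T: "itS s + ?G - itG s \<in> carrier_mat n d" using G by (simp add: minus_carrier_mat)
  have G': "?G \<in> carrier_mat n d" by (rule itG_upd_carrier)
  have "dev n d (itS (upd \<zeta> \<xi> s)) \<le> R * dev n d (itS s + ?G - itG s)"
    unfolding itS_upd R_def by (rule dev_acc_gossip_le[OF W n l2 T])
  also have "\<dots> \<le> R * (2 * (dev n d (itS s) + 1\<^sup>2 * dev n d (?G - itG s)))"
    by (intro mult_left_mono dev_add_scaled_le) (use S G G' R in auto)
  also have "\<dots> \<le> R * (2 * (dev n d (itS s) + 1\<^sup>2 * GD \<zeta> \<xi> s))"
  proof -
    have "dev n d (?G - itG s) \<le> (\<Sum>j<d. \<Sum>i<n. ((?G - itG s) $$ (i, j))\<^sup>2)"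
      by (rule dev_le_sum_squares[OF n])
    also have "\<dots> = GD \<zeta> \<xi> s"
      unfolding GD_def by (intro sum.cong refl) (use G in auto)
    finally show ?thesis using R by (intro mult_left_mono add_mono) auto
  qed
  finally show ?thesis by (simp add: algebra_simps)
qed

text \<open>A reset clears both errors, but it moves \<open>G\<close> by the old error in addition
  to \<open>\<Delta>\<close>. That jump enters the deviation of \<open>S\<close> and is the reason
  for having \<open>V\<close> in the Lyapunov function.\<close>

lemma upd_True:
  assumes s: "valid_state s"
  shows "U (upd True \<xi> s) = 0" "V (upd True \<xi> s) = 0"
    "GD True \<xi> s \<le> 2 * (real n * DD s) + 2 * (real n * V s)"
proof -
  show "U (upd True \<xi> s) = 0" "V (upd True \<xi> s) = 0"
    by (simp_all add: U_def V_def col_sum_def itG_upd[OF s])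
  have "GD True \<xi> s \<le> (\<Sum>j<d. \<Sum>i<n. 2 * (\<Delta> s i j)\<^sup>2 + 2 * (itG s $$ (i, j) - N (itX s) $$ (i, j))\<^sup>2)"
    unfolding GD_def
  proof (intro sum_mono)
    fix i j assume "i \<in> {..<n}" "j \<in> {..<d}"
    then have "itG (upd True \<xi> s) $$ (i, j) - itG s $$ (i, j)
        = \<Delta> s i j + (N (itX s) $$ (i, j) - itG s $$ (i, j))"
      by (simp add: itG_upd[OF s] \<Delta>_def)
    then show "(itG (upd True \<xi> s) $$ (i, j) - itG s $$ (i, j))\<^sup>2
        \<le> 2 * (\<Delta> s i j)\<^sup>2 + 2 * (itG s $$ (i, j) - N (itX s) $$ (i, j))\<^sup>2"
      using square_sum2_le by (metis power2_commute)
  qed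
  also have "\<dots> = 2 * (real n * DD s) + 2 * (real n * V s)"
    by (simp only: n_DD n_V sum.distrib sum_distrib_left)
  finally show "GD True \<xi> s \<le> 2 * (real n * DD s) + 2 * (real n * V s)" .
qed

lemma finite_M: "finite (set_pmf M)"
  by (rule finite_multinomial[OF n])

lemma expectation_sum_M:
  fixes u :: "'a \<Rightarrow> (nat \<Rightarrow> nat) \<Rightarrow> real"
  shows "measure_pmf.expectation M (\<lambda>\<xi>. \<Sum>k\<in>A. u k \<xi>) = (\<Sum>k\<in>A. measure_pmf.expectation M (u k))"
  by (rule Bochner_Integration.integral_sum) (rule integrable_measure_pmf_finite[OF finite_M])

text \<open>The increment of one agent is a mini-batch average too: of the function with value
  \<open>n * c\<close> at \<open>i\<close> and 0 elsewhere. Its mean is \<open>c\<close> and its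
  second moment \<open>n * c^2\<close>, hence the factor \<open>n / b\<close>.\<close>

lemma random_entry:
  assumes i: "i < n"
  shows "measure_pmf.expectation M (\<lambda>\<xi>. (a + (real (\<xi> i) / (real b * (1 / real n)) * c - c))\<^sup>2)
    \<le> a\<^sup>2 + real n / real b * c\<^sup>2"
proof -
  define h where "h k = (if k = i then real n * c else 0)" for k
  have 1: "(\<Sum>k<n. real (\<xi> k) * h k) / real b - (\<Sum>k<n. h k) / real n
      = real (\<xi> i) / (real b * (1 / real n)) * c - c" for \<xi>
    using i n by (simp add: h_def if_distrib[of "\<lambda>x. _ * x"] cong: if_cong)
  have 2: "(\<Sum>k<n. (h k)\<^sup>2) / (real b * real n) = real n / real b * c\<^sup>2"
  proof -
    have "(\<Sum>k<n. (h k)\<^sup>2) = (real n * c)\<^sup>2"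
      using i by (simp add: h_def if_distrib[of "\<lambda>x. x\<^sup>2"] cong: if_cong)
    then show ?thesis using n b by (simp add: power2_eq_square field_simps)
  qed
  show ?thesis using multinomial_second_moment[OF n b, of a h] unfolding 1 2 .
qed

text \<open>Averaged over the agents, the increments form one mini-batch average of
  \<open>\<Delta>\<close>. The noise is therefore \<open>DD / b\<close>, a factor \<open>n\<close>
  below that of the separate rows in \<open>expectation_V_False\<close>.\<close>

lemma expectation_U_False:
  assumes s: "valid_state s"
  shows "measure_pmf.expectation M (\<lambda>\<xi>. U (upd False \<xi> s)) \<le> U s + DD s / real b"
proof -
  define a where "a j = (col_sum n (itG s) j - col_sum n (N (itX s)) j) / real n" for j
  have eq: "(col_sum n (itG (upd False \<xi> s)) j - col_sum n (N (X1 s)) j) / real n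
      = a j + ((\<Sum>i<n. real (\<xi> i) * \<Delta> s i j) / real b - (\<Sum>i<n. \<Delta> s i j) / real n)"
    if j: "j < d" for j \<xi>
  proof -
    have "col_sum n (itG (upd False \<xi> s)) j
        = col_sum n (itG s) j + real n / real b * (\<Sum>i<n. real (\<xi> i) * \<Delta> s i j)"
      using j by (simp add: col_sum_def itG_upd[OF s] sum.distrib sum_distrib_left ac_simps)
    moreover have "col_sum n (N (X1 s)) j = col_sum n (N (itX s)) j + (\<Sum>i<n. \<Delta> s i j)"
      by (simp add: col_sum_def \<Delta>_def sum_subtractf)
    moreover have "(x + real n / real b * Z - (y + D)) / real n
        = (x - y) / real n + (Z / real b - D / real n)" for x y Z D :: real
      using n b by (simp add: field_simps)
    ultimately show ?thesis unfolding a_def by presburger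
  qed
  have "measure_pmf.expectation M (\<lambda>\<xi>. U (upd False \<xi> s))
      = (\<Sum>j<d. measure_pmf.expectation M (\<lambda>\<xi>. (a j + ((\<Sum>i<n. real (\<xi> i) * \<Delta> s i j) / real b
          - (\<Sum>i<n. \<Delta> s i j) / real n))\<^sup>2))"
    unfolding U_def itX_upd expectation_sum_M by (intro sum.cong refl) (simp add: eq)
  also have "\<dots> \<le> (\<Sum>j<d. (a j)\<^sup>2 + (\<Sum>i<n. (\<Delta> s i j)\<^sup>2) / (real b * real n))"
    by (intro sum_mono multinomial_second_moment[OF n b])
  also have "\<dots> = U s + DD s / real b"
    by (simp add: U_def a_def DD_def sum.distrib sum_divide_distrib mult.commute)
  finally show ?thesis .
qed

lemma expectation_V_False:
  assumes s: "valid_state s"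
  shows "measure_pmf.expectation M (\<lambda>\<xi>. V (upd False \<xi> s)) \<le> V s + real n / real b * DD s"
proof -
  define a where "a i j = itG s $$ (i, j) - N (itX s) $$ (i, j)" for i j
  have "measure_pmf.expectation M (\<lambda>\<xi>. V (upd False \<xi> s))
      = (\<Sum>j<d. \<Sum>i<n. measure_pmf.expectation M
          (\<lambda>\<xi>. (a i j + (real (\<xi> i) / (real b * (1 / real n)) * \<Delta> s i j - \<Delta> s i j))\<^sup>2)) / real n"
    unfolding V_def itX_upd integral_divide_zero expectation_sum_M
    by (intro arg_cong[of _ _ "\<lambda>x. x / real n"] sum.cong refl Bochner_Integration.integral_cong)
       (simp add: itG_upd[OF s] a_def \<Delta>_def algebra_simps)
  also have "\<dots> \<le> (\<Sum>j<d. \<Sum>i<n. (a i j)\<^sup>2 + real n / real b * (\<Delta> s i j)\<^sup>2) / real n"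
    by (intro divide_right_mono sum_mono random_entry) auto
  also have "\<dots> = V s + real n / real b * DD s"
    by (simp add: V_def a_def DD_def sum.distrib sum_distrib_left add_divide_distrib)
  finally show ?thesis .
qed

text \<open>The increment of \<open>G\<close> has mean \<open>\<Delta>\<close>; the squared mean
  gives the summand 1 and the variance the summand \<open>n / b\<close>.\<close>

lemma expectation_GD_False:
  assumes s: "valid_state s"
  shows "measure_pmf.expectation M (\<lambda>\<xi>. GD False \<xi> s) \<le> (1 + real n / real b) * (real n * DD s)"
proof -
  have "measure_pmf.expectation M (\<lambda>\<xi>. GD False \<xi> s)
      = (\<Sum>j<d. \<Sum>i<n. measure_pmf.expectation M
          (\<lambda>\<xi>. (\<Delta> s i j + (real (\<xi> i) / (real b * (1 / real n)) * \<Delta> s i j - \<Delta> s i j))\<^sup>2))"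
    unfolding GD_def expectation_sum_M
    by (intro sum.cong refl Bochner_Integration.integral_cong) (simp add: itG_upd[OF s])
  also have "\<dots> \<le> (\<Sum>j<d. \<Sum>i<n. (\<Delta> s i j)\<^sup>2 + real n / real b * (\<Delta> s i j)\<^sup>2)"
    by (intro sum_mono random_entry) auto
  also have "\<dots> = (1 + real n / real b) * (real n * DD s)"
    by (simp only: n_DD sum.distrib sum_distrib_left distrib_right mult_1)
  finally show ?thesis .
qed

definition "step s = bind_pmf (bernoulli_pmf p) (\<lambda>\<zeta>. bind_pmf M (\<lambda>\<xi>. return_pmf (upd \<zeta> \<xi> s)))"

lemma expectation_step:
  fixes \<phi> :: "drone_state \<Rightarrow> real"
  shows "measure_pmf.expectation (step s) \<phi> = p * measure_pmf.expectation M (\<lambda>\<xi>. \<phi> (upd True \<xi> s))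
    + (1 - p) * measure_pmf.expectation M (\<lambda>\<xi>. \<phi> (upd False \<xi> s))"
proof -
  have "measure_pmf.expectation (step s) \<phi> = measure_pmf.expectation (bernoulli_pmf p)
      (\<lambda>\<zeta>. measure_pmf.expectation M (\<lambda>\<xi>. \<phi> (upd \<zeta> \<xi> s)))"
    unfolding step_def using finite_M
    by (simp add: expectation_bind_finite finite_subset[OF subset_UNIV])
  then show ?thesis using p by (simp add: expectation_bernoulli)
qed

lemma expectation_step_\<Psi>:
  assumes s: "valid_state s"
  shows "measure_pmf.expectation (step s) \<Psi> \<le> (1 - \<mu> * \<eta>) * \<Psi> s"
proof -
  let ?F = "\<lambda>x. f (row_mean x) - inf_value d f"
  let ?a = "2 * \<eta> / p" and ?b = "8 * L * R * real n * \<eta>\<^sup>2"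
  let ?E = "measure_pmf.expectation M"
  \<comment> \<open>Bounding the deviation of the new \<open>S\<close> first makes the estimate
    linear in \<open>U\<close>, \<open>V\<close> and \<open>GD\<close>, so only their expectations
    are needed.\<close>
  have \<Psi>_le: "\<Psi> (upd \<zeta> \<xi> s) \<le> ?F (X1 s) + ?a * U (upd \<zeta> \<xi> s) + ?b * V (upd \<zeta> \<xi> s)
      + L * (dev n d (X1 s) + \<eta>\<^sup>2 * (2 * R * (dev n d (itS s) + GD \<zeta> \<xi> s)))" for \<zeta> \<xi>
    unfolding \<Psi>_def itX_upd using dev_itS_upd_le[OF s, of \<zeta> \<xi>] L
    by (intro add_mono mult_left_mono order_refl) auto
  have "?E (\<lambda>\<xi>. \<Psi> (upd True \<xi> s)) \<le> ?E (\<lambda>_. ?F (X1 s)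
      + L * (dev n d (X1 s) + \<eta>\<^sup>2 * (2 * R * (dev n d (itS s) + (2 * (real n * DD s) + 2 * (real n * V s))))))"
  proof (rule expectation_mono_finite[OF finite_M])
    fix \<xi>
    have "L * (dev n d (X1 s) + \<eta>\<^sup>2 * (2 * R * (dev n d (itS s) + GD True \<xi> s)))
        \<le> L * (dev n d (X1 s) + \<eta>\<^sup>2 * (2 * R * (dev n d (itS s) + (2 * (real n * DD s) + 2 * (real n * V s)))))"
      using upd_True(3)[OF s, of \<xi>] L R(1) by (intro add_mono mult_left_mono order_refl) auto
    then show "\<Psi> (upd True \<xi> s) \<le> ?F (X1 s) + L * (dev n d (X1 s) + \<eta>\<^sup>2 * (2 * R *
        (dev n d (itS s) + (2 * (real n * DD s) + 2 * (real n * V s)))))"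
      using \<Psi>_le[of True \<xi>] upd_True[OF s, of \<xi>] by simp
  qed
  then have T: "?E (\<lambda>\<xi>. \<Psi> (upd True \<xi> s)) \<le> ?F (X1 s)
      + L * (dev n d (X1 s) + \<eta>\<^sup>2 * (2 * R * (dev n d (itS s) + (2 * (real n * DD s) + 2 * (real n * V s)))))"
    by simp
  have int: "integrable (measure_pmf M) u" for u :: "_ \<Rightarrow> real"
    by (rule integrable_measure_pmf_finite[OF finite_M])
  have "?E (\<lambda>\<xi>. \<Psi> (upd False \<xi> s)) \<le> ?E (\<lambda>\<xi>. ?F (X1 s) + ?a * U (upd False \<xi> s) + ?b * V (upd False \<xi> s)
      + L * (dev n d (X1 s) + \<eta>\<^sup>2 * (2 * R * (dev n d (itS s) + GD False \<xi> s))))"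
    by (rule expectation_mono_finite[OF finite_M]) (rule \<Psi>_le)
  also have "\<dots> = ?F (X1 s) + ?a * ?E (\<lambda>\<xi>. U (upd False \<xi> s)) + ?b * ?E (\<lambda>\<xi>. V (upd False \<xi> s))
      + L * (dev n d (X1 s) + \<eta>\<^sup>2 * (2 * R * (dev n d (itS s) + ?E (\<lambda>\<xi>. GD False \<xi> s))))"
    by (simp add: int)
  also have "\<dots> \<le> ?F (X1 s) + ?a * (U s + DD s / real b) + ?b * (V s + real n / real b * DD s)
      + L * (dev n d (X1 s) + \<eta>\<^sup>2 * (2 * R * (dev n d (itS s) + (1 + real n / real b) * (real n * DD s))))"
    using expectation_U_False[OF s] expectation_V_False[OF s] expectation_GD_False[OF s] L R(1) \<eta> p
    by (intro add_mono mult_left_mono order_refl) auto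
  finally have Fa: "?E (\<lambda>\<xi>. \<Psi> (upd False \<xi> s)) \<le> \<dots>" .
  have "measure_pmf.expectation (step s) \<Psi> \<le> p * (?F (X1 s)
      + L * (dev n d (X1 s) + \<eta>\<^sup>2 * (2 * R * (dev n d (itS s) + (2 * (real n * DD s) + 2 * (real n * V s))))))
    + (1 - p) * (?F (X1 s) + ?a * (U s + DD s / real b) + ?b * (V s + real n / real b * DD s)
      + L * (dev n d (X1 s) + \<eta>\<^sup>2 * (2 * R * (dev n d (itS s) + (1 + real n / real b) * (real n * DD s)))))"
    unfolding expectation_step using T Fa p by (intro add_mono mult_left_mono) auto
  also have "\<dots> \<le> (1 - \<mu> * \<eta>) * (?F (itX s) + ?a * U s + ?b * V s + L * (dev n d (itX s) + \<eta>\<^sup>2 * dev n d (itS s)))"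
    by (rule drone_step_arith[OF n b L \<mu> \<eta> p bp L\<eta> \<mu>\<eta> R U_nonneg V_nonneg dev_nonneg dev_nonneg DD_nonneg _
      step_descent[OF s] DD_le[OF s] dev_X1_le[OF s]])
      (simp add: s2_def sum_nonneg)
  finally show ?thesis unfolding \<Psi>_def .
qed

end

section \<open>Runs of the algorithm\<close>

lemma frob_norm_sq:
  assumes "A \<in> carrier_mat n d"
  shows "(frob_norm A)\<^sup>2 = (\<Sum>i<n. \<Sum>j<d. (A $$ (i, j))\<^sup>2)"
  using assms unfolding frob_norm_def by (subst real_sqrt_pow2) (auto intro!: sum_nonneg)

lemma const_rows_carrier: "v \<in> carrier_vec d \<Longrightarrow> const_rows n v \<in> carrier_mat n d"
  by (auto simp: const_rows_def)

lemma frob_norm_centered: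
  assumes X: "X \<in> carrier_mat n d"
  shows "(frob_norm (X - const_rows n (row_mean X)))\<^sup>2 = dev n d X"
proof -
  have c: "const_rows n (row_mean X) \<in> carrier_mat n d"
    using X by (intro const_rows_carrier) simp
  have "(frob_norm (X - const_rows n (row_mean X)))\<^sup>2
      = (\<Sum>i<n. \<Sum>j<d. ((X - const_rows n (row_mean X)) $$ (i, j))\<^sup>2)"
    by (rule frob_norm_sq) (use c in \<open>simp add: minus_carrier_mat\<close>)
  also have "\<dots> = dev n d X"
    unfolding dev_eq_sum_rows[OF X]
    by (intro sum.cong refl) (use X c in \<open>auto simp: const_rows_def row_mean_def\<close>)
  finally show ?thesis .
qed

text \<open>Keeps the base of the power in \<rho> between 0 and 1. With at least two agents, some
  eigenvalue of index other than \<open>i0\<close> lies between 0 and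
  \<open>lambda2 W\<close>.\<close>

lemma lambda2_nonneg:
  assumes W: "mixing_matrix n E W" and n: "n \<ge> 1" and l2: "lambda2 W < 1"
  shows "lambda2 W \<ge> 0"
proof (cases "n = 1")
  case True
  then show ?thesis using W by (auto simp: lambda2_def mixing_matrix_def)
next
  case False
  obtain u :: "nat \<Rightarrow> nat \<Rightarrow> real" and lam i0
    where lam: "\<And>i. i < n \<Longrightarrow> i \<noteq> i0 \<Longrightarrow> 0 \<le> lam i \<and> lam i \<le> lambda2 W"
    by (rule mixing_matrix_eigenbasis[OF W n l2]) blast
  have "(if i0 = 0 then 1 else 0) < n" "(if i0 = 0 then 1 else 0) \<noteq> i0" using n False by auto
  then show ?thesis using lam by force
qed

context drone_run
begin

abbreviation "run \<equiv> drone n d fs W x0 b \<eta> p (1 / real n) K"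
abbreviation "start \<equiv> drone_init n d fs x0"

lemma run_Suc: "run (Suc t) = bind_pmf (run t) step"
  by (simp add: step_def[abs_def])

lemma valid_start: "valid_state start"
  using const_rows_carrier[OF x0]
  by (auto simp: valid_state_def drone_init_def Let_def)

lemma set_step: "s' \<in> set_pmf (step s) \<Longrightarrow> \<exists>\<zeta> \<xi>. \<xi> \<in> set_pmf M \<and> s' = upd \<zeta> \<xi> s"
  by (auto simp: step_def)

lemma valid_run: "s \<in> set_pmf (run t) \<Longrightarrow> valid_state s"
proof (induction t arbitrary: s)
  case 0
  then show ?case using valid_start by simp
next
  case (Suc t)
  then show ?case unfolding run_Suc using set_step valid_state_upd by fastforce
qed

lemma finite_step: "finite (set_pmf (step s))"
proof -
  have "set_pmf (step s) \<subseteq> (\<lambda>(\<zeta>, \<xi>). upd \<zeta> \<xi> s) ` (UNIV \<times> set_pmf M)"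
    using set_step by fastforce
  then show ?thesis by (rule finite_subset) (use finite_M in simp)
qed

lemma finite_run: "finite (set_pmf (run t))"
proof (induction t)
  case (Suc t)
  then show ?case unfolding run_Suc using finite_step by simp
qed simp

lemma expectation_run_Suc:
  fixes \<phi> :: "drone_state \<Rightarrow> real"
  shows "measure_pmf.expectation (run (Suc t)) \<phi>
    = measure_pmf.expectation (run t) (\<lambda>s. measure_pmf.expectation (step s) \<phi>)"
  unfolding run_Suc by (rule expectation_bind_finite[OF finite_run finite_step])

lemma expectation_run_\<Psi>:
  "measure_pmf.expectation (run t) \<Psi> \<le> (1 - \<mu> * \<eta>) ^ t * \<Psi> start"
proof (induction t)
  case 0
  then show ?case by simp
next
  case (Suc t)
  have "measure_pmf.expectation (run (Suc t)) \<Psi>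
      \<le> measure_pmf.expectation (run t) (\<lambda>s. (1 - \<mu> * \<eta>) * \<Psi> s)"
    unfolding expectation_run_Suc
    by (intro expectation_mono_finite[OF finite_run] expectation_step_\<Psi> valid_run)
  also have "\<dots> = (1 - \<mu> * \<eta>) * measure_pmf.expectation (run t) \<Psi>" by simp
  also have "\<dots> \<le> (1 - \<mu> * \<eta>) * ((1 - \<mu> * \<eta>) ^ t * \<Psi> start)"
    using Suc \<mu>\<eta> p by (intro mult_left_mono) auto
  finally show ?case by (simp add: mult.assoc)
qed

lemma \<Psi>_nonneg:
  assumes s: "valid_state s"
  shows "\<Psi> s \<ge> 0"
proof -
  have "f (row_mean (itX s)) - inf_value d f \<ge> 0"
    using f_ge_inf[of "row_mean (itX s)"] s by (auto simp: valid_state_def)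
  moreover have "2 * \<eta> / p * U s \<ge> 0" 
    using \<eta> p U_nonneg by (intro mult_nonneg_nonneg divide_nonneg_nonneg) auto
  moreover have "8 * L * R * real n * \<eta>\<^sup>2 * V s \<ge> 0" 
    using L R(1) V_nonneg by (intro mult_nonneg_nonneg) auto
  moreover have "L * (dev n d (itX s) + \<eta>\<^sup>2 * dev n d (itS s)) \<ge> 0" using L by simp
  ultimately show ?thesis unfolding \<Psi>_def by linarith
qed

text \<open>The initial state is deterministic, so the expectations are plain values; time 0 is the
  only time at which the theorem evaluates the Lyapunov function.\<close>

lemma drone_Lyapunov_0: "drone_Lyapunov n d fs L W x0 b \<eta> p (1 / real n) K 0 = \<Psi> start"
proof -
  let ?s = start
  have X: "itX ?s \<in> carrier_mat n d" and S: "itS ?s \<in> carrier_mat n d" and G: "itG ?s \<in> carrier_mat n d"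
    using valid_start by (auto simp: valid_state_def)
  have GN: "itG ?s - N (itX ?s) \<in> carrier_mat n d" by (simp add: minus_carrier_mat)
  have ij: "(itG ?s - N (itX ?s)) $$ (i, j) = itG ?s $$ (i, j) - N (itX ?s) $$ (i, j)"
    if "i < n" "j < d" for i j
    using that carrier_matD[OF G] carrier_matD[OF N_carrier[of "itX ?s"]] by simp
  have "(vec_norm (row_mean (itG ?s - N (itX ?s))))\<^sup>2 = U ?s"
    unfolding U_def
  proof (subst vec_norm_sq[OF row_mean_carrier[OF GN]], intro sum.cong refl)
    fix j assume "j \<in> {..<d}"
    then show "(row_mean (itG ?s - N (itX ?s)) $ j)\<^sup>2
        = ((col_sum n (itG ?s) j - col_sum n (N (itX ?s)) j) / real n)\<^sup>2"
      using row_mean_index[OF GN] by (simp add: col_sum_def ij sum_subtractf)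
  qed
  moreover have "1 / real n * (frob_norm (itG ?s - N (itX ?s)))\<^sup>2 = V ?s"
    unfolding frob_norm_sq[OF GN] V_def by (subst sum.swap) (simp add: ij)
  ultimately show ?thesis
    unfolding drone_Lyapunov_def Let_def \<Psi>_def R_def
    by (simp add: frob_norm_centered[OF X] frob_norm_centered[OF S])
qed

lemma average_rows_le:
  assumes s: "valid_state s"
  shows "(\<Sum>i<n. f (row (itX s) i) - inf_value d f) / real n \<le> \<Psi> s"
proof -
  define X x where "X = itX s" and "x = row_mean X"
  have X: "X \<in> carrier_mat n d" using s by (simp add: X_def valid_state_def)
  have x: "x \<in> carrier_vec d" using X by (simp add: x_def)
  define h where "h i = row X i - x" for i
  have r: "row X i \<in> carrier_vec d" if "i < n" for i using row_carrier_vec[OF that X] .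
  have h: "h i \<in> carrier_vec d" if "i < n" for i using r[OF that] x by (simp add: h_def)
  have hj: "h i $ j = X $$ (i, j) - x $ j" if "i < n" "j < d" for i j
    using that X x by (simp add: h_def)
  have "f (row X i) \<le> f x + gradient d f x \<bullet> h i + L / 2 * (\<Sum>j<d. (h i $ j)\<^sup>2)" if i: "i < n" for i
  proof -
    have "x + h i = row X i" using r[OF i] x X by (intro eq_vecI) (auto simp: h_def)
    then show ?thesis using descent[OF x h[OF i]] by simp
  qed
  then have "(\<Sum>i<n. f (row X i) - inf_value d f)
      \<le> (\<Sum>i<n. (f x - inf_value d f) + gradient d f x \<bullet> h i + L / 2 * (\<Sum>j<d. (h i $ j)\<^sup>2))"
    by (intro sum_mono) (auto simp: algebra_simps)
  also have "\<dots> = real n * (f x - inf_value d f) + (\<Sum>i<n. gradient d f x \<bullet> h i)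
      + L / 2 * (\<Sum>i<n. \<Sum>j<d. (h i $ j)\<^sup>2)"
    by (simp add: sum.distrib sum_distrib_left)
  also have "(\<Sum>i<n. gradient d f x \<bullet> h i) = 0"
  proof -
    have "(\<Sum>i<n. gradient d f x \<bullet> h i) = (\<Sum>i<n. \<Sum>j<d. gradient d f x $ j * (X $$ (i, j) - x $ j))"
    proof (intro sum.cong refl)
      fix i assume "i \<in> {..<n}"
      then show "gradient d f x \<bullet> h i = (\<Sum>j<d. gradient d f x $ j * (X $$ (i, j) - x $ j))"
        using h[of i] by (simp add: scalar_prod_sum[of _ d] hj)
    qed
    also have "\<dots> = (\<Sum>j<d. gradient d f x $ j * (\<Sum>i<n. X $$ (i, j) - x $ j))"
      by (subst sum.swap) (simp add: sum_distrib_left)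
    also have "\<dots> = 0"
    proof (intro sum.neutral ballI)
      fix j assume "j \<in> {..<d}"
      then have "(\<Sum>i<n. X $$ (i, j) - x $ j) = 0"
        using n X by (simp add: sum_subtractf x_def row_mean_index col_sum_def)
      then show "gradient d f x $ j * (\<Sum>i<n. X $$ (i, j) - x $ j) = 0" by simp
    qed
    finally show ?thesis .
  qed
  also have "(\<Sum>i<n. \<Sum>j<d. (h i $ j)\<^sup>2) = dev n d X"
    unfolding dev_eq_sum_rows[OF X] x_def[symmetric] by (intro sum.cong refl) (simp add: hj)
  finally have "(\<Sum>i<n. f (row X i) - inf_value d f) / real n
      \<le> (real n * (f x - inf_value d f) + L / 2 * dev n d X) / real n"
    by (intro divide_right_mono) auto
  also have "\<dots> = (f x - inf_value d f) + (L / 2 * dev n d X) / real n"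
    using n by (simp add: add_divide_distrib)
  also have "(L / 2 * dev n d X) / real n \<le> L * dev n d X"
  proof -
    have "(L / 2 * dev n d X) / real n \<le> (L / 2 * dev n d X) / 1"
      using n L by (intro divide_left_mono) auto
    then show ?thesis using L dev_nonneg[of n d X]
      by (smt (verit) divide_le_eq_1_pos field_sum_of_halves mult_nonneg_nonneg div_by_1 mult_right_mono)
  qed
  finally have "(\<Sum>i<n. f (row X i) - inf_value d f) / real n \<le> (f x - inf_value d f) + L * dev n d X"
    by simp
  moreover have "2 * \<eta> / p * U s \<ge> 0" 
    using \<eta> p U_nonneg by (intro mult_nonneg_nonneg divide_nonneg_nonneg) auto
  moreover have "8 * L * R * real n * \<eta>\<^sup>2 * V s \<ge> 0" 
    using L R(1) V_nonneg by (intro mult_nonneg_nonneg) auto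
  moreover have "L * (\<eta>\<^sup>2 * dev n d (itS s)) \<ge> 0" using L by simp
  ultimately show ?thesis unfolding \<Psi>_def X_def x_def distrib_left by linarith
qed

lemma expectation_output_le:
  "measure_pmf.expectation (drone_output n d fs W x0 b \<eta> p (1 / real n) K t)
     (\<lambda>x. f x - inf_value d f) \<le> (1 - \<mu> * \<eta>) ^ t * \<Psi> start"
proof -
  have fin: "finite (set_pmf (pmf_of_set {..<n}))" using n by (simp add: set_pmf_uniform)
  have "measure_pmf.expectation (drone_output n d fs W x0 b \<eta> p (1 / real n) K t) (\<lambda>x. f x - inf_value d f)
      = measure_pmf.expectation (run t)
          (\<lambda>s. measure_pmf.expectation (pmf_of_set {..<n}) (\<lambda>i. f (row (itX s) i) - inf_value d f))"
    unfolding drone_output_def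
    by (subst expectation_bind_finite[OF finite_run]) (use fin in \<open>auto simp: expectation_bind_finite\<close>)
  also have "\<dots> \<le> measure_pmf.expectation (run t) \<Psi>"
  proof (rule expectation_mono_finite[OF finite_run])
    fix s assume "s \<in> set_pmf (run t)"
    then have "(\<Sum>i<n. f (row (itX s) i) - inf_value d f) / real n \<le> \<Psi> s"
      by (intro average_rows_le valid_run)
    moreover have "measure_pmf.expectation (pmf_of_set {..<n}) (\<lambda>i. f (row (itX s) i) - inf_value d f)
        = (\<Sum>i<n. f (row (itX s) i) - inf_value d f) / real n"
      using n by (subst integral_pmf_of_set) (auto simp: lessThan_empty_iff)
    ultimately show "measure_pmf.expectation (pmf_of_set {..<n}) (\<lambda>i. f (row (itX s) i) - inf_value d f) \<le> \<Psi> s"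
      by simp
  qed
  also have "\<dots> \<le> (1 - \<mu> * \<eta>) ^ t * \<Psi> start" by (rule expectation_run_\<Psi>)
  finally show ?thesis .
qed

lemma output_accuracy:
  assumes \<epsilon>: "\<epsilon> > 0" and t: "real t \<ge> 1 / (\<mu> * \<eta>) * ln (\<Psi> start / \<epsilon>)"
  shows "measure_pmf.expectation (drone_output n d fs W x0 b \<eta> p (1 / real n) K t)
     (\<lambda>x. f x - inf_value d f) \<le> \<epsilon>"
proof -
  have "(1 - \<mu> * \<eta>) ^ t * \<Psi> start \<le> \<epsilon>"
  \<comment> \<open>For initial value 0 the logarithm says nothing useful about \<open>t\<close>,
    but the bound is 0 for every \<open>t\<close>.\<close>
  proof (cases "\<Psi> start = 0")
    case False
    then have pos: "\<Psi> start > 0" using \<Psi>_nonneg[OF valid_start] by simp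
    have "\<mu> * \<eta> > 0" using \<mu> \<eta> by simp
    then have "ln (\<Psi> start / \<epsilon>) \<le> \<mu> * \<eta> * real t" using t by (simp add: field_simps)
    then have "\<Psi> start / \<epsilon> \<le> exp (\<mu> * \<eta> * real t)" using pos \<epsilon> by (metis divide_pos_pos exp_le_cancel_iff exp_ln)
    have "(1 - \<mu> * \<eta>) ^ t \<le> exp (- (\<mu> * \<eta>)) ^ t"
      using \<mu>\<eta> p exp_ge_add_one_self[of "- (\<mu> * \<eta>)"] by (intro power_mono) auto
    also have "\<dots> = exp (- (\<mu> * \<eta> * real t))" by (simp add: exp_of_nat_mult[symmetric] mult.commute)
    finally have "(1 - \<mu> * \<eta>) ^ t * \<Psi> start \<le> exp (- (\<mu> * \<eta> * real t)) * (exp (\<mu> * \<eta> * real t) * \<epsilon>)"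
      using pos \<epsilon> \<open>\<Psi> start / \<epsilon> \<le> _\<close> by (intro mult_mono) (auto simp: field_simps)
    also have "\<dots> = \<epsilon>" by (simp add: exp_minus)
    finally show ?thesis .
  qed (use \<epsilon> in simp)
  then show ?thesis using expectation_output_le[of t] by simp
qed

section \<open>Costs of a run\<close>

lemma comm_rounds_run: "s \<in> set_pmf (run t) \<Longrightarrow> comm_rounds s = 2 * K * t"
proof (induction t arbitrary: s)
  case 0
  then show ?case by (simp add: drone_init_def Let_def)
next
  case (Suc t)
  then obtain s0 \<zeta> \<xi> where "s0 \<in> set_pmf (run t)" "s = upd \<zeta> \<xi> s0"
    unfolding run_Suc using set_step by fastforce
  then show ?case using Suc.IH[of s0] by (simp add: drone_update_def Let_def)
qed

text \<open>One unit for the initial gradients and at most two per iteration, since a sampled agent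
  evaluates its gradient at the new and at the old point.\<close>

lemma grad_time_run: "s \<in> set_pmf (run t) \<Longrightarrow> grad_time s \<le> 1 + 2 * t"
proof (induction t arbitrary: s)
  case 0
  then show ?case by (simp add: drone_init_def Let_def)
next
  case (Suc t)
  then obtain s0 \<zeta> \<xi> where s0: "s0 \<in> set_pmf (run t)" "s = upd \<zeta> \<xi> s0"
    unfolding run_Suc using set_step by fastforce
  have "Max ((\<lambda>i. if \<zeta> then 1 else if 0 < \<xi> i then 2 else 0 :: nat) ` {..<n}) \<le> 2"
  proof (rule Max.boundedI)
    have "{..<n} \<noteq> {}" using n by (simp add: lessThan_empty_iff)
    then show "(\<lambda>i. if \<zeta> then 1 else if 0 < \<xi> i then 2 else 0 :: nat) ` {..<n} \<noteq> {}"
      by (metis image_is_empty)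
  qed auto
  then show ?case using Suc.IH[OF s0(1)] s0(2) by (simp add: drone_update_def Let_def)
qed

lemma expectation_lfo_run:
  "measure_pmf.expectation (run t) (\<lambda>s. real (lfo_calls s))
    \<le> real n + real t * (p * real n + (1 - p) * (2 * real b))"
proof (induction t)
  case 0
  then show ?case by (simp add: drone_init_def Let_def)
next
  case (Suc t)
  have int: "integrable (measure_pmf (run t)) u" for u :: "_ \<Rightarrow> real"
    by (rule integrable_measure_pmf_finite[OF finite_run])
  have st: "measure_pmf.expectation (step s) (\<lambda>s. real (lfo_calls s))
      \<le> real (lfo_calls s) + (p * real n + (1 - p) * (2 * real b))" for s
  proof -
    have 1: "real (lfo_calls (upd True \<xi> s)) = real (lfo_calls s) + real n" for \<xi>
      by (simp add: drone_update_def Let_def)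
    have "measure_pmf.expectation M (\<lambda>\<xi>. real (lfo_calls (upd False \<xi> s)))
        \<le> measure_pmf.expectation M (\<lambda>\<xi>. real (lfo_calls s) + 2 * real b)"
    proof (rule expectation_mono_finite[OF finite_M])
      fix \<xi> assume \<xi>: "\<xi> \<in> set_pmf M"
      \<comment> \<open>At most \<open>b\<close> different agents occur among \<open>b\<close>
        draws, and each of them makes two calls.\<close>
      have "(\<Sum>i<n. if 0 < \<xi> i then 2 else 0) \<le> (\<Sum>i<n. 2 * \<xi> i)" by (intro sum_mono) auto
      also have "\<dots> = 2 * b" using sum_multinomial[OF n \<xi>] by (simp add: sum_distrib_left[symmetric])
      finally have "real (\<Sum>i<n. if 0 < \<xi> i then 2 else 0) \<le> 2 * real b"
        by (metis of_nat_le_iff of_nat_mult of_nat_numeral)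
      then show "real (lfo_calls (upd False \<xi> s)) \<le> real (lfo_calls s) + 2 * real b"
        by (simp add: drone_update_def Let_def del: of_nat_sum)
    qed
    then have 2: "measure_pmf.expectation M (\<lambda>\<xi>. real (lfo_calls (upd False \<xi> s)))
        \<le> real (lfo_calls s) + 2 * real b" by simp
    have "measure_pmf.expectation (step s) (\<lambda>s. real (lfo_calls s))
        \<le> p * (real (lfo_calls s) + real n) + (1 - p) * (real (lfo_calls s) + 2 * real b)"
      unfolding expectation_step using 2 p by (intro add_mono mult_left_mono) (auto simp: 1)
    also have "\<dots> = real (lfo_calls s) + (p * real n + (1 - p) * (2 * real b))" by (simp add: algebra_simps)
    finally show ?thesis .
  qed
  have "measure_pmf.expectation (run (Suc t)) (\<lambda>s. real (lfo_calls s))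
      \<le> measure_pmf.expectation (run t) (\<lambda>s. real (lfo_calls s) + (p * real n + (1 - p) * (2 * real b)))"
    unfolding expectation_run_Suc by (intro expectation_mono_finite[OF finite_run] st)
  also have "\<dots> = measure_pmf.expectation (run t) (\<lambda>s. real (lfo_calls s)) + (p * real n + (1 - p) * (2 * real b))"
    by (simp add: int)
  also have "\<dots> \<le> real n + real (Suc t) * (p * real n + (1 - p) * (2 * real b))"
    using Suc by (simp add: distrib_right)
  finally show ?case .
qed

end

section \<open>Parameters and complexity\<close>

text \<open>\<open>2800 = 14 * 200\<close> is what \<open>14 * exp (- 8) \<le> 1 / 200\<close> asks
  for. The quadratic Taylor bound at \<open>1 / 8\<close> equals \<open>145 / 128\<close>, and its
  64th power suffices.\<close>

lemma exp_8_ge: "exp (8 :: real) \<ge> 2800"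
proof -
  have "(145 / 128 :: real) \<le> exp (1 / 8)"
    using exp_lower_Taylor_quadratic[of "1 / 8"] by (simp add: power2_eq_square)
  then have "(145 / 128 :: real) ^ 64 \<le> exp (1 / 8) ^ 64" by (intro power_mono) auto
  also have "\<dots> = exp (8 :: real)" by (simp add: exp_of_nat_mult[symmetric])
  finally have "(145 / 128 :: real) ^ 64 \<le> exp 8" .
  moreover have "(2800 :: real) \<le> (145 / 128) ^ 64" by (simp add: power_divide)
  ultimately show ?thesis by linarith
qed

text \<open>The prefactor of \<open>K\<close> is the reciprocal of
  \<open>c = 1 - 1 / sqrt 2\<close>, so \<open>c * t * K \<ge> 4 + ln n\<close> and the power is at
  most \<open>exp (- 4) / n\<close>: the logarithm in \<open>K\<close> cancels \<open>n\<close>, and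
  the 4 supplies the small constant.\<close>

lemma gossip_rounds_suffice:
  fixes l2 \<gamma> :: real and n :: nat
  assumes n: "n \<ge> 1" and l2: "0 \<le> l2" and \<gamma>: "0 < \<gamma>" "1 - l2 \<ge> \<gamma>"
    and K: "real K \<ge> sqrt 2 * (4 + ln (real n)) / ((sqrt 2 - 1) * sqrt \<gamma>)"
  shows "(real n)\<^sup>2 * (sqrt 14 * (1 - (1 - 1 / sqrt 2) * sqrt (1 - l2)) ^ K)\<^sup>2 \<le> 1 / 200"
proof -
  define c where "c = 1 - 1 / sqrt (2 :: real)"
  have s2: "sqrt 2 > (1 :: real)" by simp
  then have c: "0 < c" "c < 1" by (simp_all add: c_def)
  have cinv: "sqrt 2 / (sqrt 2 - 1) = 1 / c" using s2 by (simp add: c_def field_simps)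
  define t where "t = sqrt (1 - l2)"
  have t: "sqrt \<gamma> \<le> t" "t \<le> 1" "0 < sqrt \<gamma>" using \<gamma> l2 by (auto simp: t_def)
  have "sqrt 2 * (4 + ln (real n)) / ((sqrt 2 - 1) * sqrt \<gamma>)
      = (sqrt 2 / (sqrt 2 - 1)) * ((4 + ln (real n)) / sqrt \<gamma>)" by simp
  then have "(1 / c) * ((4 + ln (real n)) / sqrt \<gamma>) \<le> real K" using K unfolding cinv by simp
  then have "4 + ln (real n) \<le> c * sqrt \<gamma> * real K" using c t by (simp add: field_simps)
  also have "\<dots> \<le> c * t * real K" using c t by (intro mult_right_mono mult_left_mono) auto
  finally have Kt: "4 + ln (real n) \<le> c * t * real K" .
  have t0: "0 \<le> t" using t by linarith
  have ct: "c * t \<le> 1" using c t(2) t0 by (intro mult_le_one) auto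
  have "(1 - c * t) ^ K \<le> exp (- (c * t)) ^ K"
    using ct exp_ge_add_one_self[of "- (c * t)"] by (intro power_mono) auto
  also have "\<dots> = exp (- (c * t * real K))" by (simp add: exp_of_nat_mult[symmetric] mult.commute)
  also have "\<dots> \<le> exp (- (4 + ln (real n)))" using Kt by simp
  also have "\<dots> = exp (- 4) / real n" using n by (simp add: exp_diff exp_minus divide_inverse exp_add)
  finally have "real n * (1 - c * t) ^ K \<le> exp (- 4)" using n by (simp add: field_simps)
  then have "(real n * (1 - c * t) ^ K)\<^sup>2 \<le> (exp (- 4))\<^sup>2" using ct by (intro power_mono) auto
  also have "(exp (- 4))\<^sup>2 = 1 / exp (8 :: real)"
    by (simp add: exp_minus power2_eq_square exp_add[symmetric] divide_inverse inverse_mult_distrib[symmetric])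
  also have "\<dots> \<le> 1 / 2800" using exp_8_ge by (intro divide_left_mono) auto
  finally have "(real n * (1 - c * t) ^ K)\<^sup>2 \<le> 1 / 2800" .
  then show ?thesis unfolding c_def[symmetric] t_def[symmetric] by (simp add: power_mult_distrib)
qed

text \<open>\<open>A\<close> stands for \<open>1 / (\<mu> * \<eta>)\<close> and \<open>l\<close> for
  \<open>ln (\<Phi>0 / \<epsilon>)\<close>. The 1 lost by rounding up is absorbed by
  \<open>c * e * (m + 1) \<ge> 1\<close>, which turns the 2 into a 3.\<close>

lemma iteration_count_le:
  fixes \<kappa> :: real and n :: nat
  assumes \<kappa>: "\<kappa> > 0" and e: "e \<ge> 1" and c: "c \<ge> 1" and ln: "l \<le> c * e"
    and A: "0 < A" "A \<le> 20 * \<kappa> + 2 * (m + 1)" and m: "0 < m"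
  shows "real (nat \<lceil>A * l\<rceil>) \<le> c * e * (20 * \<kappa> + 3 * (m + 1))"
proof -
  have "A * l \<le> A * (c * e)" using A ln by (intro mult_left_mono) auto
  also have "\<dots> \<le> (20 * \<kappa> + 2 * (m + 1)) * (c * e)" using A c e by (intro mult_right_mono) auto
  finally have 1: "A * l \<le> c * e * (20 * \<kappa> + 2 * (m + 1))" by (simp add: mult.commute)
  have cl: "1 \<le> c * e" using c e mult_mono[of 1 c 1 e] by simp
  have "1 * 1 \<le> c * e * (m + 1)" using cl m by (intro mult_mono) auto
  then have 2: "c * e * (20 * \<kappa> + 2 * (m + 1)) + 1 \<le> c * e * (20 * \<kappa> + 3 * (m + 1))"
    by (simp add: algebra_simps)
  \<comment> \<open>Covers a negative \<open>A * l\<close>, where \<open>nat\<close> truncates the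
    ceiling to 0.\<close>
  have "0 \<le> c * e * (20 * \<kappa> + 2 * (m + 1))" using c e \<kappa> m by (intro mult_nonneg_nonneg) auto
  then have "real (nat \<lceil>A * l\<rceil>) \<le> c * e * (20 * \<kappa> + 2 * (m + 1)) + 1" using 1 by linarith
  then show ?thesis using 2 by linarith
qed

text \<open>14 is \<open>7 / 2\<close>, from \<open>sqrt 2 / (sqrt 2 - 1)\<close>, times 4, from
  \<open>4 + ln n \<le> 4 * (1 + ln n)\<close>. Rounding up costs one more unit, since
  \<open>(1 + ln n) / sqrt \<gamma> \<ge> 1\<close>.\<close>

lemma gossip_count_le:
  fixes n :: nat
  assumes n: "n \<ge> 1" and \<gamma>: "0 < \<gamma>" "\<gamma> \<le> 1"
  shows "real (nat \<lceil>sqrt 2 * (4 + ln (real n)) / ((sqrt 2 - 1) * sqrt \<gamma>)\<rceil>)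
    \<le> 15 * ((1 + ln (real n)) / sqrt \<gamma>)"
proof -
  let ?l = "1 + ln (real n)"
  have l: "?l \<ge> 1" using n by simp
  have sg: "0 < sqrt \<gamma>" "sqrt \<gamma> \<le> 1" using \<gamma> by auto
  have s2: "(7 / 5 :: real) \<le> sqrt 2" by (rule real_le_rsqrt) (simp add: power2_eq_square)
  have "sqrt 2 / (sqrt 2 - 1) \<le> 7 / (2 :: real)" using s2 by (simp add: field_simps)
  moreover have "(4 + ln (real n)) / sqrt \<gamma> \<le> 4 * ?l / sqrt \<gamma>" using sg n by (intro divide_right_mono) auto
  ultimately have "(sqrt 2 / (sqrt 2 - 1)) * ((4 + ln (real n)) / sqrt \<gamma>) \<le> 7 / 2 * (4 * ?l / sqrt \<gamma>)"
    using s2 sg n by (intro mult_mono) auto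
  moreover have "7 / 2 * (4 * ?l / sqrt \<gamma>) = 14 * (?l / sqrt \<gamma>)" using sg by (simp add: field_simps)
  moreover have "sqrt 2 * (4 + ln (real n)) / ((sqrt 2 - 1) * sqrt \<gamma>)
      = (sqrt 2 / (sqrt 2 - 1)) * ((4 + ln (real n)) / sqrt \<gamma>)" by simp
  ultimately have 1: "sqrt 2 * (4 + ln (real n)) / ((sqrt 2 - 1) * sqrt \<gamma>) \<le> 14 * (?l / sqrt \<gamma>)"
    by metis
  have "1 * sqrt \<gamma> \<le> ?l" using l sg(2) by linarith
  then have "1 \<le> ?l / sqrt \<gamma>" by (simp only: pos_le_divide_eq[OF sg(1)])
  then show ?thesis using 1 by linarith
qed

text \<open>Iterations times expected calls per iteration. The balance explains the minimum in
  \<open>p\<close>: \<open>\<kappa> * n / (m + 1)\<close> is at most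
  \<open>\<kappa> * sqrt n\<close> if \<open>m = sqrt n\<close> and at most \<open>n\<close> if
  \<open>m = \<kappa>\<close>, while \<open>\<kappa> * m \<le> \<kappa> * sqrt n\<close> and
  \<open>m * m \<le> n\<close> hold in both cases.\<close>

lemma lfo_count_le:
  fixes \<kappa> :: real and n :: nat
  assumes n: "n \<ge> 1" and \<kappa>: "\<kappa> > 0" and m: "m = min (sqrt (real n)) \<kappa>"
  shows "(20 * \<kappa> + 3 * (m + 1)) * (real n / (m + 1) + 2 * m) \<le> 60 * (real n + \<kappa> * sqrt (real n))"
proof -
  have sn: "1 \<le> sqrt (real n)" using n by simp
  have nn: "sqrt (real n) * sqrt (real n) = real n" by simp
  have m0: "0 < m" using \<kappa> sn by (simp add: m)
  have mk: "m \<le> \<kappa>" "m \<le> sqrt (real n)" by (simp_all add: m)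
  have "\<kappa> * real n \<le> (real n + \<kappa> * sqrt (real n)) * (m + 1)"
  proof (cases "sqrt (real n) \<le> \<kappa>")
    case True
    then have "(real n + \<kappa> * sqrt (real n)) * (m + 1)
        = \<kappa> * real n + real n * (m + 1) + \<kappa> * sqrt (real n)"
      using nn by (simp add: m algebra_simps)
    then show ?thesis using m0 \<kappa> sn by simp
  next
    case False
    then have "(real n + \<kappa> * sqrt (real n)) * (m + 1)
        = \<kappa> * real n + real n + \<kappa> * sqrt (real n) * (m + 1)"
      by (simp add: m algebra_simps)
    then show ?thesis using m0 \<kappa> sn by simp
  qed
  then have a: "\<kappa> * (real n / (m + 1)) \<le> real n + \<kappa> * sqrt (real n)"
    using m0 by (simp add: pos_divide_le_eq)
  have b: "\<kappa> * m \<le> \<kappa> * sqrt (real n)" using mk \<kappa> by (intro mult_left_mono) auto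
  have c: "m * m \<le> real n" using mult_mono[OF mk(2) mk(2)] m0 nn sn by simp
  have "sqrt (real n) * 1 \<le> sqrt (real n) * sqrt (real n)" using sn by (intro mult_left_mono) auto
  then have d: "m \<le> real n" using mk nn by simp
  have "(20 * \<kappa> + 3 * (m + 1)) * (real n / (m + 1) + 2 * m)
      = 20 * (\<kappa> * (real n / (m + 1))) + 40 * (\<kappa> * m) + 3 * ((m + 1) * (real n / (m + 1))) + 6 * (m * m) + 6 * m"
    by (simp add: algebra_simps add_divide_distrib)
  also have "(m + 1) * (real n / (m + 1)) = real n" using m0 by simp
  finally have "(20 * \<kappa> + 3 * (m + 1)) * (real n / (m + 1) + 2 * m)
      = 20 * (\<kappa> * (real n / (m + 1))) + 40 * (\<kappa> * m) + 3 * real n + 6 * (m * m) + 6 * m" .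
  moreover have "20 * X + 40 * Y + 3 * N + 6 * Z + 6 * w \<le> 60 * (N + V)"
    if "X \<le> N + V" "Y \<le> V" "Z \<le> N" "w \<le> N" "0 \<le> N" for X Y Z w N V :: real
    using that by simp
  ultimately show ?thesis using a b c d by simp
qed

text \<open>\<open>c\<close> isolates the dependence on the initial value:
  \<open>ln (\<Phi>0 / \<epsilon>) \<le> c * ln (1 / \<epsilon>)\<close> as soon as
  \<open>ln (1 / \<epsilon>) \<ge> 1\<close>.\<close>

lemma drone_complexity:
  fixes n d b K T :: nat and fs :: "nat \<Rightarrow> real vec \<Rightarrow> real"
    and L \<mu> \<kappa> \<gamma> \<tau> \<epsilon> p q \<eta> \<Phi>0 c :: real and E :: "(nat \<times> nat) set" and W :: "real mat" and x0 :: "real vec"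
  assumes \<kappa>: "\<kappa> = L / \<mu>" and p_eq: "p = 1 / (min (sqrt (real n)) \<kappa> + 1)"
    and b_eq: "b = nat \<lceil>(1 - p) / p\<rceil>" and \<eta>_eq: "\<eta> = min (1 / (20 * L)) (p / (2 * \<mu>))"
    and q: "q = 1 / real n"
    and K: "K = nat \<lceil>sqrt 2 * (4 + ln (real n)) / ((sqrt 2 - 1) * sqrt \<gamma>)\<rceil>"
    and T: "T = nat \<lceil>1 / (\<mu> * \<eta>) * ln (drone_Lyapunov n d fs L W x0 b \<eta> p q K 0 / \<epsilon>)\<rceil>"
    and n: "n \<ge> 1" and L: "L > 0" and \<mu>: "\<mu> > 0" and \<gamma>: "0 < \<gamma>" "\<gamma> \<le> 1" and \<tau>: "\<tau> > 0"
    and \<epsilon>: "\<epsilon> > 0" and diff: "\<forall>i<n. differentiable_vec d (fs i)"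
    and bdd: "bdd_below (avg_fun n fs ` carrier_vec d)" and smooth: "mean_squared_smooth n d fs L"
    and PL: "PL_condition d (avg_fun n fs) \<mu>"
    and W: "mixing_matrix n E W" and gap: "1 - lambda2 W \<ge> \<gamma>" and x0: "x0 \<in> carrier_vec d"
    and \<Phi>0: "drone_Lyapunov n d fs L W x0 b \<eta> p q K 0 = \<Phi>0"
    and c: "c = 1 + \<bar>ln \<Phi>0\<bar>"
  shows "measure_pmf.expectation (drone_output n d fs W x0 b \<eta> p q K T)
      (\<lambda>x. avg_fun n fs x - inf_value d (avg_fun n fs)) \<le> \<epsilon> \<and>
    (\<epsilon> < exp (- 1) \<longrightarrow>
      (\<kappa> \<ge> 1 \<longrightarrow>
        (\<forall>s\<in>set_pmf (drone n d fs W x0 b \<eta> p q K T).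
           real (comm_rounds s) \<le> 1000 * c * ((1 + ln \<kappa>) * (1 + ln (real n))) ^ 1
             * (\<kappa> / sqrt \<gamma> * ln (1 / \<epsilon>)) \<and>
           run_time \<tau> s \<le> 1000 * c * ((1 + ln \<kappa>) * (1 + ln (real n))) ^ 1
             * (\<kappa> * (1 + \<tau> / sqrt \<gamma>) * ln (1 / \<epsilon>)))) \<and>
      measure_pmf.expectation (drone n d fs W x0 b \<eta> p q K T) (\<lambda>s. real (lfo_calls s))
        \<le> 1000 * c * ((real n + \<kappa> * sqrt (real n)) * ln (1 / \<epsilon>)))"
proof -
  define m where "m = min (sqrt (real n)) \<kappa>"
  have \<kappa>0: "\<kappa> > 0" using L \<mu> by (simp add: \<kappa>)
  have m: "m > 0" using \<kappa>0 n by (simp add: m_def)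
  have pm: "p = 1 / (m + 1)" by (simp add: p_eq m_def)
  have p01: "0 < p" "p \<le> 1" using m by (simp_all add: pm)
  have mp: "(1 - p) / p = m" using m by (simp add: pm field_simps)
  have bm: "b = nat \<lceil>m\<rceil>" by (simp add: b_eq mp)
  have b1: "b \<ge> 1" and bge: "m \<le> real b" and ble: "real b \<le> m + 1" using m unfolding bm by linarith+
  have "1 - p = p * m" using mp p01 by (simp add: field_simps)
  also have "\<dots> \<le> p * real b" using bge p01 by (intro mult_left_mono) auto
  finally have bp: "1 - p \<le> p * real b" .
  have \<eta>0: "\<eta> > 0" using L \<mu> p01 by (simp add: \<eta>_eq)
  have "\<eta> \<le> 1 / (20 * L)" "\<eta> \<le> p / (2 * \<mu>)" by (simp_all add: \<eta>_eq)
  then have L\<eta>: "20 * (L * \<eta>) \<le> 1" and \<mu>\<eta>: "2 * (\<mu> * \<eta>) \<le> p" using L \<mu> by (simp_all add: field_simps)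
  have l2: "lambda2 W < 1" using gap \<gamma> by linarith
  have Kge: "real K \<ge> sqrt 2 * (4 + ln (real n)) / ((sqrt 2 - 1) * sqrt \<gamma>)"
    unfolding K by (rule real_nat_ceiling_ge)
  have \<rho>: "(real n)\<^sup>2 * (sqrt 14 * (1 - (1 - 1 / sqrt 2) * sqrt (1 - lambda2 W)) ^ K)\<^sup>2 \<le> 1 / 200"
    by (rule gossip_rounds_suffice[OF n lambda2_nonneg[OF W n l2] \<gamma>(1) gap Kge])
  interpret drone_run n d b K fs L \<mu> \<eta> p E W x0
    by unfold_locales (use n L \<mu> diff bdd smooth PL W l2 x0 b1 \<eta>0 p01 bp L\<eta> \<mu>\<eta> \<rho> in auto)
  have \<Psi>: "\<Psi> start = \<Phi>0" using \<Phi>0 drone_Lyapunov_0 by (simp add: q)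
  have T': "T = nat \<lceil>1 / (\<mu> * \<eta>) * ln (\<Phi>0 / \<epsilon>)\<rceil>" by (simp only: T \<Phi>0)
  have out: "measure_pmf.expectation (drone_output n d fs W x0 b \<eta> p q K T)
      (\<lambda>x. avg_fun n fs x - inf_value d (avg_fun n fs)) \<le> \<epsilon>"
    unfolding q by (rule output_accuracy[OF \<epsilon>]) (simp only: \<Psi> T' real_nat_ceiling_ge)
  have c1: "c \<ge> 1" by (simp add: c)
  define e where "e = ln (1 / \<epsilon>)"
  have small: "(\<kappa> \<ge> 1 \<longrightarrow>
        (\<forall>s\<in>set_pmf (run T).
           real (comm_rounds s) \<le> 1000 * c * ((1 + ln \<kappa>) * (1 + ln (real n))) ^ 1 * (\<kappa> / sqrt \<gamma> * e) \<and>
           run_time \<tau> s \<le> 1000 * c * ((1 + ln \<kappa>) * (1 + ln (real n))) ^ 1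
             * (\<kappa> * (1 + \<tau> / sqrt \<gamma>) * e))) \<and>
      measure_pmf.expectation (run T) (\<lambda>s. real (lfo_calls s))
        \<le> 1000 * c * ((real n + \<kappa> * sqrt (real n)) * e)"
    if "\<epsilon> < exp (- 1)"
  proof -
    have "ln \<epsilon> < - 1" using that \<epsilon> by (metis exp_less_cancel_iff exp_ln)
    then have e1: "e \<ge> 1" using \<epsilon> by (simp add: e_def ln_div)
    have le: "ln (\<Phi>0 / \<epsilon>) \<le> c * e"
    proof (cases "\<Phi>0 = 0")
      \<comment> \<open>Here the convention \<open>ln 0 = 0\<close> applies.\<close>
      case True
      then show ?thesis using c1 e1 by simp
    next
      case False
      then have "\<Phi>0 > 0" using \<Psi>_nonneg[OF valid_start] by (simp add: \<Psi>)
      then have "ln (\<Phi>0 / \<epsilon>) = ln \<Phi>0 + e" using \<epsilon> by (simp add: ln_div e_def)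
      also have "\<dots> \<le> \<bar>ln \<Phi>0\<bar> * e + e"
        using e1 mult_left_mono[OF e1, of "\<bar>ln \<Phi>0\<bar>"] by simp
      also have "\<dots> = c * e" by (simp add: c algebra_simps)
      finally show ?thesis .
    qed
    have A0: "1 / (\<mu> * \<eta>) > 0" using \<mu> \<eta>0 by simp
    \<comment> \<open>The reciprocal of the minimum is either \<open>20 * \<kappa>\<close> or
      \<open>2 / p = 2 * (m + 1)\<close>; the sum covers both.\<close>
    have A: "1 / (\<mu> * \<eta>) \<le> 20 * \<kappa> + 2 * (m + 1)"
    proof (cases "1 / (20 * L) \<le> p / (2 * \<mu>)")
      case True
      then have "\<eta> = 1 / (20 * L)" unfolding \<eta>_eq by (rule min_absorb1)
      then have "1 / (\<mu> * \<eta>) = 20 * \<kappa>" using L \<mu> by (simp add: \<kappa>)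
      then show ?thesis using m by simp
    next
      case False
      then have "p / (2 * \<mu>) \<le> 1 / (20 * L)" by linarith
      then have "\<eta> = p / (2 * \<mu>)" unfolding \<eta>_eq by (rule min_absorb2)
      then have "1 / (\<mu> * \<eta>) = 2 * (m + 1)" using \<mu> m by (simp add: pm)
      then show ?thesis using \<kappa>0 by simp
    qed
    have TT: "real T \<le> c * e * (20 * \<kappa> + 3 * (m + 1))"
      unfolding T' by (rule iteration_count_le[OF \<kappa>0 e1 c1 le A0 A m])
    have ce: "c * e \<ge> 1" using c1 e1 mult_mono[of 1 c 1 e] by simp
    define P where "P = (1 + ln \<kappa>) * (1 + ln (real n))"
    have lfo: "measure_pmf.expectation (run T) (\<lambda>s. real (lfo_calls s))
        \<le> 1000 * c * ((real n + \<kappa> * sqrt (real n)) * e)"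
    proof -
      let ?B = "real n + \<kappa> * sqrt (real n)"
      have "(1 - p) * (2 * real b) \<le> (1 - p) * (2 * (m + 1))" using ble p01 by (intro mult_left_mono) auto
      also have "\<dots> = 2 * m" using m by (simp add: pm field_simps)
      finally have it: "p * real n + (1 - p) * (2 * real b) \<le> real n / (m + 1) + 2 * m" by (simp add: pm)
      have it0: "0 \<le> p * real n + (1 - p) * (2 * real b)" using p01 by (intro add_nonneg_nonneg) auto
      have nB: "real n \<le> ?B" using \<kappa>0 by simp
      have "measure_pmf.expectation (run T) (\<lambda>s. real (lfo_calls s))
          \<le> real n + real T * (p * real n + (1 - p) * (2 * real b))" by (rule expectation_lfo_run)
      also have "\<dots> \<le> real n + (c * e * (20 * \<kappa> + 3 * (m + 1))) * (real n / (m + 1) + 2 * m)"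
        using TT it it0 m ce \<kappa>0 by (intro add_left_mono mult_mono) auto
      also have "\<dots> = real n + c * e * ((20 * \<kappa> + 3 * (m + 1)) * (real n / (m + 1) + 2 * m))" by simp
      also have "\<dots> \<le> c * e * ?B + c * e * (60 * ?B)"
      proof (intro add_mono mult_left_mono)
        have "1 * ?B \<le> c * e * ?B" using ce \<kappa>0 by (intro mult_right_mono) auto
        with nB show "real n \<le> c * e * ?B" by (simp only: mult_1 order_trans)
        show "(20 * \<kappa> + 3 * (m + 1)) * (real n / (m + 1) + 2 * m) \<le> 60 * ?B"
          by (rule lfo_count_le[OF n \<kappa>0 m_def])
      qed (use ce in linarith)
      also have "\<dots> = 61 * (c * e * ?B)" by simp
      also have "\<dots> \<le> 1000 * (c * e * ?B)"
        using c1 e1 \<kappa>0 by (intro mult_right_mono mult_nonneg_nonneg) auto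
      finally show ?thesis by (simp add: ac_simps)
    qed
    moreover have "real (comm_rounds s) \<le> 1000 * c * P * (\<kappa> / sqrt \<gamma> * e)"
      "run_time \<tau> s \<le> 1000 * c * P * (\<kappa> * (1 + \<tau> / sqrt \<gamma>) * e)"
      if \<kappa>1: "\<kappa> \<ge> 1" and s: "s \<in> set_pmf (run T)" for s
    proof -
      have sg: "0 < sqrt \<gamma>" using \<gamma> by simp
      have lnn: "0 \<le> ln (real n)" using n by simp
      have "1 * (1 + ln (real n)) \<le> P" unfolding P_def using \<kappa>1 lnn by (intro mult_right_mono) auto
      then have lP: "1 + ln (real n) \<le> P" by simp
      then have P1: "1 \<le> P" using lnn by linarith
      \<comment> \<open>26 is 20 + 3 + 3, from \<open>m \<le> \<kappa>\<close> and
        \<open>1 \<le> \<kappa>\<close>; for small \<kappa> the summand 3 would not be bounded by a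
        fixed multiple of \<kappa>.\<close>
      have "20 * \<kappa> + 3 * (m + 1) \<le> 26 * \<kappa>" using \<kappa>1 by (simp add: m_def)
      then have T26: "real T \<le> c * e * (26 * \<kappa>)" using TT ce by (meson mult_left_mono order_trans zero_le_one)
      have "real K \<le> 15 * ((1 + ln (real n)) / sqrt \<gamma>)" unfolding K by (rule gossip_count_le[OF n \<gamma>])
      also have "\<dots> \<le> 15 * (P / sqrt \<gamma>)" using lP sg by (intro mult_left_mono divide_right_mono) auto
      finally have KP: "real K \<le> 15 * (P / sqrt \<gamma>)" .
      define X where "X = c * P * (\<kappa> * e)"
      have X1: "X \<ge> 1"
      proof -
        have "1 * 1 \<le> (c * e) * (P * \<kappa>)"
          using ce P1 \<kappa>1 mult_mono[of 1 P 1 \<kappa>] by (intro mult_mono) auto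
        then show ?thesis by (simp add: X_def ac_simps)
      qed
      have "real (comm_rounds s) = 2 * (real K * real T)" using comm_rounds_run[OF s] by simp
      also have "\<dots> \<le> 2 * ((15 * (P / sqrt \<gamma>)) * (c * e * (26 * \<kappa>)))"
        using KP T26 P1 sg by (intro mult_left_mono mult_mono) auto
      also have "\<dots> = 780 * (X / sqrt \<gamma>)" by (simp add: X_def)
      finally have comm: "real (comm_rounds s) \<le> 780 * (X / sqrt \<gamma>)" .
      also have "\<dots> \<le> 1000 * (X / sqrt \<gamma>)" using X1 sg by (intro mult_right_mono) auto
      also have "\<dots> = 1000 * c * P * (\<kappa> / sqrt \<gamma> * e)" by (simp add: X_def)
      finally show "real (comm_rounds s) \<le> 1000 * c * P * (\<kappa> / sqrt \<gamma> * e)" .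
      have "c * e * (26 * \<kappa>) * 1 \<le> c * e * (26 * \<kappa>) * P"
        using P1 ce \<kappa>1 by (intro mult_left_mono) auto
      then have TX: "real T \<le> 26 * X" using T26 by (simp add: X_def ac_simps)
      have "run_time \<tau> s \<le> (1 + 2 * real T) + \<tau> * (780 * (X / sqrt \<gamma>))"
        unfolding run_time_def
      proof (intro add_mono mult_left_mono comm)
        show "real (grad_time s) \<le> 1 + 2 * real T" using grad_time_run[OF s] by linarith
      qed (use \<tau> in simp)
      also have "\<dots> \<le> 1000 * X + \<tau> * (1000 * (X / sqrt \<gamma>))"
        using TX X1 \<tau> sg by (intro add_mono mult_left_mono mult_right_mono) auto
      also have "\<dots> = 1000 * c * P * (\<kappa> * (1 + \<tau> / sqrt \<gamma>) * e)"
        by (simp add: X_def algebra_simps)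
      finally show "run_time \<tau> s \<le> 1000 * c * P * (\<kappa> * (1 + \<tau> / sqrt \<gamma>) * e)" .
    qed
    ultimately show ?thesis by (simp add: P_def)
  qed
  show ?thesis using out small unfolding q e_def by blast
qed

theorem corollary5p3:
  shows "\<exists>k::nat. \<forall>\<Phi>0::real. \<exists>C>0. \<exists>\<epsilon>0>0.
    \<forall>(n::nat) (d::nat) (fs :: nat \<Rightarrow> real vec \<Rightarrow> real) (L::real) (\<mu>::real)
      (E :: (nat \<times> nat) set) (W :: real mat) (\<gamma>::real) (\<tau>::real) (x0 :: real vec) (\<epsilon>::real).
      let f = avg_fun n fs;
          \<kappa> = L / \<mu>;
          p = 1 / (min (sqrt (real n)) \<kappa> + 1);
          b = nat \<lceil>(1 - p) / p\<rceil>;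
          \<eta> = min (1 / (20 * L)) (p / (2 * \<mu>));
          q = 1 / real n;
          K = nat \<lceil>sqrt 2 * (4 + ln (real n)) / ((sqrt 2 - 1) * sqrt \<gamma>)\<rceil>;
          T = nat \<lceil>1 / (\<mu> * \<eta>) * ln (drone_Lyapunov n d fs L W x0 b \<eta> p q K 0 / \<epsilon>)\<rceil>;
          run = drone n d fs W x0 b \<eta> p q K T;
          out = drone_output n d fs W x0 b \<eta> p q K T;
          polylog = ((1 + ln \<kappa>) * (1 + ln (real n))) ^ k
      in
        n \<ge> 1 \<and> L > 0 \<and> \<mu> > 0 \<and> 0 < \<gamma> \<and> \<gamma> \<le> 1 \<and> \<tau> > 0 \<and> \<epsilon> > 0 \<and>
        (\<forall>i<n. differentiable_vec d (fs i)) \<and>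
        bdd_below (f ` carrier_vec d) \<and>
        mean_squared_smooth n d fs L \<and>
        PL_condition d f \<mu> \<and>
        connected_network n E \<and> mixing_matrix n E W \<and> 1 - lambda2 W \<ge> \<gamma> \<and>
        x0 \<in> carrier_vec d \<and>
        drone_Lyapunov n d fs L W x0 b \<eta> p q K 0 = \<Phi>0
      \<longrightarrow>
        measure_pmf.expectation out (\<lambda>x. f x - inf_value d f) \<le> \<epsilon> \<and>
        (\<epsilon> < \<epsilon>0 \<longrightarrow>
           (\<kappa> \<ge> 1 \<longrightarrow>
              (\<forall>s\<in>set_pmf run.
                 real (comm_rounds s) \<le> C * polylog * (\<kappa> / sqrt \<gamma> * ln (1 / \<epsilon>)) \<and>
                 run_time \<tau> s \<le> C * polylog * (\<kappa> * (1 + \<tau> / sqrt \<gamma>) * ln (1 / \<epsilon>)))) \<and>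
           measure_pmf.expectation run (\<lambda>s. real (lfo_calls s))
              \<le> C * ((real n + \<kappa> * sqrt (real n)) * ln (1 / \<epsilon>)))"
  unfolding Let_def
\<comment> \<open>Exponent 1 is enough: the logarithm comes from the \<open>ln n\<close> in
  \<open>K\<close>.\<close>
proof (intro exI[of _ "1 :: nat"] allI, goal_cases)
  case (1 \<Phi>0)
  show ?case
  \<comment> \<open>1000 is a common bound for 780 = 2 * 15 * 26 in the communication, 53 = 1 + 2 *
    26 in the gradient time and 61 in the oracle calls. The threshold \<open>exp (- 1)\<close> makes
    \<open>ln (1 / \<epsilon>)\<close> at least 1.\<close>
  proof (rule exI[of _ "1000 * (1 + \<bar>ln \<Phi>0\<bar>)"], rule conjI, simp,
      rule exI[of _ "exp (- 1)"], rule conjI, simp, intro allI impI, elim conjE, goal_cases)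
    case 1
    show ?case
      by (rule drone_complexity[OF refl refl refl refl refl refl refl 1(1) 1(2) 1(3) 1(4) 1(5) 1(6)
            1(7) 1(8) 1(9) 1(10) 1(11) 1(13) 1(14) 1(15) 1(16) refl])
  qed
qed

end
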